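(* Let $G$ be a $3$-tree. There exists a convex-polyhedral surface $\mathcal{S}$ in $\mathbb{R}^3$ whose adjacency graph $\mathcal{G}(\mathcal{S})$ is isomorphic to $G$ if and only if $G$ is planar.
   Context: Graphs are finite, simple and undirected. The class of $3$-trees is defined recursively: $K_4$ is a $3$-tree, and a graph obtained from a $3$-tree $H$ by adding a new vertex $x$ with exactly three neighbors $u,v,w$ that form a triangle in $H$ is a $3$-tree. A polygon in $\mathbb{R}^3$ is a closed planar region (including its interior) bounded by a simple closed polygonal chain lying in some plane of $\mathbb{R}^3$; its vertices are called corners and its edges are called sides. A polyhedral surface $\mathcal{S}=\{S_1,\dots,S_n\}$ is a set of $n$ closed polygons embedded in $\mathbb{R}^3$ such that, for all pairwise distinct indices $i,j,k$: (1) $S_i$ and $S_j$ are interior-disjoint (with respect to the 2D relative interiors); (2) if $S_i\cap S_j\neq\emptyset$, then $S_i\cap S_j$ is either a single corner or a complete side of both $S_i$ and $S_j$; (3) if $S_i\cap S_j\cap S_k\neq\emptyset$, then it is a single corner (so a side is shared by at most two polygons). Sides need not be shared with another polygon. The adjacency graph $\mathcal{G}(\mathcal{S})$ has one vertex for each polygon of $\mathcal{S}$ and an edge between two vertices if and only if the corresponding polygons share a side (contacts in a single corner do not give an edge). A convex-polyhedral surface is a polyhedral surface all of whose polygons are strictly convex. *)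

theory Defs
  imports "HOL-Analysis.Analysis"
begin

text \<open>Graphs are pairs of a vertex set and a set of two-element edge sets.\<close>

type_synonym 'a ugraph = "'a set \<times> 'a set set"

definition simple_ugraph :: "'a ugraph \<Rightarrow> bool" where
  "simple_ugraph G \<longleftrightarrow> finite (fst G) \<and> (\<forall>e\<in>snd G. e \<subseteq> fst G \<and> card e = 2)"

definition ugraph_iso :: "'a ugraph \<Rightarrow> 'b ugraph \<Rightarrow> bool" where
  "ugraph_iso G H \<longleftrightarrow>
     (\<exists>f. bij_betw f (fst G) (fst H) \<and>
          (\<forall>u\<in>fst G. \<forall>v\<in>fst G. {u, v} \<in> snd G \<longleftrightarrow> {f u, f v} \<in> snd H))"

inductive three_tree :: "'a ugraph \<Rightarrow> bool" where
  K4: "card V = 4 \<Longrightarrow> three_tree (V, {{u, v} | u v. u \<in> V \<and> v \<in> V \<and> u \<noteq> v})"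
| stack: "\<lbrakk>three_tree (V, E); x \<notin> V; distinct [u, v, w];
           {u, v} \<in> E; {v, w} \<in> E; {u, w} \<in> E\<rbrakk>
          \<Longrightarrow> three_tree (insert x V, E \<union> {{x, u}, {x, v}, {x, w}})"

lemma three_tree_simple: "three_tree G \<Longrightarrow> simple_ugraph G"
proof (induction rule: three_tree.induct)
  case (K4 V)
  then have "finite V" by (metis card.infinite zero_neq_numeral)
  then show ?case by (auto simp: simple_ugraph_def)
next
  case (stack V E x u v w)
  then have "{u, v, w} \<subseteq> V" by (auto simp: simple_ugraph_def)
  with stack show ?case by (auto simp: simple_ugraph_def card_insert_if)
qed

text \<open>Topological planarity, with edges drawn as arbitrary Jordan arcs.\<close>

definition planar :: "'a ugraph \<Rightarrow> bool" where
  "planar G \<longleftrightarrow>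
     (\<exists>(pos :: 'a \<Rightarrow> complex) (\<gamma> :: 'a set \<Rightarrow> real \<Rightarrow> complex).
        inj_on pos (fst G) \<and>
        (\<forall>e\<in>snd G. arc (\<gamma> e) \<and>
            {pathstart (\<gamma> e), pathfinish (\<gamma> e)} = pos ` e \<and>
            path_image (\<gamma> e) \<inter> pos ` fst G = pos ` e) \<and>
        (\<forall>e\<in>snd G. \<forall>e'\<in>snd G. e \<noteq> e' \<longrightarrow>
            path_image (\<gamma> e) \<inter> path_image (\<gamma> e') = pos ` (e \<inter> e')))"

text \<open>
  A polygon is represented by the list of its corners in cyclic order. The list, rather than the
  region, is the primitive datum because a polygon that is not strictly convex may have corners
  with a straight angle, which cannot be recovered from the region.
\<close>

type_synonym corner_list = "(real ^ 3) list"

abbreviation next_corner :: "corner_list \<Rightarrow> nat \<Rightarrow> real ^ 3" where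
  "next_corner P i \<equiv> P ! (Suc i mod length P)"

definition side :: "corner_list \<Rightarrow> nat \<Rightarrow> (real ^ 3) set" where
  "side P i = closed_segment (P ! i) (next_corner P i)"

definition sides :: "corner_list \<Rightarrow> (real ^ 3) set set" where
  "sides P = side P ` {..<length P}"

definition boundary_chain :: "corner_list \<Rightarrow> (real ^ 3) set" where
  "boundary_chain P = \<Union> (sides P)"

text \<open>The chain is simple when two different sides meet only in their common endpoints.\<close>

definition polygon :: "corner_list \<Rightarrow> bool" where
  "polygon P \<longleftrightarrow>
     3 \<le> length P \<and> distinct P \<and> aff_dim (set P) = 2 \<and>
     (\<forall>i<length P. \<forall>j<length P. i \<noteq> j \<longrightarrow>
        side P i \<inter> side P j = {P ! i, next_corner P i} \<inter> {P ! j, next_corner P j})"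

text \<open>
  The points enclosed by the chain are those in bounded components of its complement relative to
  its plane. The library's \<open>inside\<close> takes the complement in the whole space, where it would be
  empty.
\<close>

definition enclosed :: "corner_list \<Rightarrow> (real ^ 3) set" where
  "enclosed P = (let U = affine hull set P - boundary_chain P in
     {x \<in> U. bounded (connected_component_set U x)})"

definition region :: "corner_list \<Rightarrow> (real ^ 3) set" where
  "region P = boundary_chain P \<union> enclosed P"

text \<open>
  In a convex polygon, a corner is an extreme point of the region exactly if its interior angle is
  less than a straight angle.
\<close>

definition strictly_convex_polygon :: "corner_list \<Rightarrow> bool" where
  "strictly_convex_polygon P \<longleftrightarrow>
     polygon P \<and> convex (region P) \<and> (\<forall>c\<in>set P. c extreme_point_of region P)"

text \<open>
  Different corner lists may describe the same polygon, but they cannot both belong to a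
  polyhedral surface, because their interiors are not disjoint.
\<close>

definition polyhedral_surface :: "corner_list set \<Rightarrow> bool" where
  "polyhedral_surface \<S> \<longleftrightarrow>
     finite \<S> \<and> (\<forall>P\<in>\<S>. polygon P) \<and>
     (\<forall>P\<in>\<S>. \<forall>Q\<in>\<S>. P \<noteq> Q \<longrightarrow>
        rel_interior (region P) \<inter> rel_interior (region Q) = {}) \<and>
     (\<forall>P\<in>\<S>. \<forall>Q\<in>\<S>. P \<noteq> Q \<longrightarrow> region P \<inter> region Q \<noteq> {} \<longrightarrow>
        (\<exists>c \<in> set P \<inter> set Q. region P \<inter> region Q = {c}) \<or>
        region P \<inter> region Q \<in> sides P \<inter> sides Q) \<and>
     (\<forall>P\<in>\<S>. \<forall>Q\<in>\<S>. \<forall>R\<in>\<S>. P \<noteq> Q \<longrightarrow> P \<noteq> R \<longrightarrow> Q \<noteq> R \<longrightarrow>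
        region P \<inter> region Q \<inter> region R \<noteq> {} \<longrightarrow>
        (\<exists>c \<in> set P \<inter> set Q \<inter> set R. region P \<inter> region Q \<inter> region R = {c}))"

definition convex_polyhedral_surface :: "corner_list set \<Rightarrow> bool" where
  "convex_polyhedral_surface \<S> \<longleftrightarrow>
     polyhedral_surface \<S> \<and> (\<forall>P\<in>\<S>. strictly_convex_polygon P)"

definition adjacency_graph :: "corner_list set \<Rightarrow> corner_list ugraph" where
  "adjacency_graph \<S> =
     (\<S>, {{P, Q} | P Q. P \<in> \<S> \<and> Q \<in> \<S> \<and> P \<noteq> Q \<and> sides P \<inter> sides Q \<noteq> {}})"

end

theory Submission
  imports Defs
begin

text \<open>
  A 3-tree in which no triangle has three common neighbours arises by stacking every new vertex
  into a face, that is, into a triangle with only one common neighbour so far. Dually, this is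
  successive truncation of corners, starting from a tetrahedron. The facets of the
  resulting simple polytope realise the graph, and its normal fan, projected from a point of the
  sphere, draws the graph in the plane.

  It remains to see that neither a planar graph nor an adjacency graph of convex polygons contains
  a triangle with three common neighbours. The first is the non-planarity of \<open>K\<^bsub>3,3\<^esub>\<close>. For the
  second, the planes of three mutually adjacent polygons bound a trihedral cone unless
  they coincide. A further polygon adjacent to all three passes
  them either on the side of the apex or on the opposite side, and on each side there is room for
  at most one. If the planes coincide, then the polygons adjacent to all three lie in this
  plane too, and one obtains a plane drawing of \<open>K\<^bsub>3,3\<^esub>\<close>.
\<close>

text \<open>A surface in space does not hand over a drawing of its adjacency graph: its polygons may
  also touch at corners and need not fit together to a sphere. Both directions of the theorem
  therefore pass through the same combinatorial condition on triangles. Geometry and combinatorics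
  are linked by the signs of affine functions at points. A polygon enters as the affine function of
  its plane, oriented towards its neighbours; an adjacency enters as a point of the shared side that
  lies on these two polygons and on no other. The orientation is where the edges of the triangle are
  used: two neighbours of a polygon that are adjacent to each other lie on one side of its plane.
  That a side of the cone has room for only one polygon becomes a statement on signs. Affine
  functions on space form a vector space of dimension four, so the three planes of the triangle and
  any two further planes satisfy a linear relation. In it the two further planes get coefficients of
  equal sign, which is impossible for all pairs among three planes at once. This form treats an apex
  at infinity without a case distinction.\<close>

subsection \<open>Nonplanarity of \<open>K\<^bsub>3,3\<^esub>\<close>\<close>

lemma connected_subset_open_part:
  assumes "connected W" "W \<subseteq> A \<union> B" "open A" "open B" "A \<inter> B = {}" "W \<inter> A \<noteq> {}"
  shows "W \<subseteq> A"
proof (rule ccontr)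
  assume "\<not> W \<subseteq> A"
  then have "W \<inter> B \<noteq> {}" using assms(2) by blast
  moreover have "A \<inter> B \<inter> W = {}" using assms(5) by blast
  ultimately show False using connectedD[OF assms(1,3,4) _ assms(2)] assms(6) by blast
qed

lemma Jordan_parts:
  fixes c :: "real \<Rightarrow> complex"
  assumes "simple_path c" "pathfinish c = pathstart c"
  shows "inside (path_image c) \<noteq> {}" "open (inside (path_image c))"
    "connected (inside (path_image c))" "open (outside (path_image c))"
    "connected (outside (path_image c))" "\<not> bounded (outside (path_image c))"
    "inside (path_image c) \<inter> outside (path_image c) = {}"
    "inside (path_image c) \<union> outside (path_image c) = - path_image c"
  using Jordan_inside_outside[OF assms] by blast+

lemma theta_arcs_loop:
  fixes c1 c2 :: "real \<Rightarrow> complex"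
  assumes "arc c1" "pathstart c1 = a" "pathfinish c1 = b"
    and "arc c2" "pathstart c2 = a" "pathfinish c2 = b"
    and "path_image c1 \<inter> path_image c2 = {a, b}"
  shows "simple_path (c1 +++ reversepath c2)"
    and "pathfinish (c1 +++ reversepath c2) = pathstart (c1 +++ reversepath c2)"
    and "path_image (c1 +++ reversepath c2) = path_image c1 \<union> path_image c2"
proof -
  show "simple_path (c1 +++ reversepath c2)"
    by (rule simple_path_join_loop) (use assms in \<open>auto simp: arc_reversepath\<close>)
  show "pathfinish (c1 +++ reversepath c2) = pathstart (c1 +++ reversepath c2)"
    using assms by simp
  show "path_image (c1 +++ reversepath c2) = path_image c1 \<union> path_image c2"
    using assms by (simp add: path_image_join)
qed

text \<open>Inversion about a point inside turns the curve inside out. The punctured inside has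
  points close to \<open>p\<close>, which are sent far away, so its connected image lies outside the
  image curve. Nonzero points inside the image curve must then come from the old outside, whose
  connected image cannot leave again.\<close>

lemma inverse_image_outside:
  fixes c :: "real \<Rightarrow> complex" and p :: complex
  assumes c: "simple_path c" "pathfinish c = pathstart c" and p: "p \<in> inside (path_image c)"
  defines "j \<equiv> \<lambda>z. inverse (z - p)"
  shows "j ` outside (path_image c) \<subseteq> inside (path_image (j \<circ> c))"
proof -
  let ?C = "path_image c" and ?D = "path_image (j \<circ> c)"
  note J = Jordan_parts[OF c]
  have pC: "p \<notin> ?C" using p by (auto simp: inside_def)
  have pO: "p \<notin> outside ?C" using p J(7) by blast
  have cont: "continuous_on (- {p}) j" unfolding j_def by (intro continuous_intros) auto
  \<comment> \<open>With \<open>inverse 0 = 0\<close> the map is injective on the whole plane. It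
    sends \<open>p\<close> to 0, and every other value is attained away from
    \<open>p\<close>.\<close>
  have inj: "inj j" unfolding j_def inj_def by simp
  have D: "?D = j ` ?C" by (simp add: path_image_compose)
  have "simple_path (j \<circ> c)"
  proof (rule simple_path_continuous_image)
    show "continuous_on ?C j" by (rule continuous_on_subset[OF cont]) (use pC in auto)
  qed (use c inj in \<open>auto intro: inj_on_subset\<close>)
  moreover have "pathfinish (j \<circ> c) = pathstart (j \<circ> c)"
    using c by (simp add: pathfinish_compose pathstart_compose)
  ultimately have JD: "inside ?D \<noteq> {}" "open (inside ?D)" "open (outside ?D)" "\<not> bounded (outside ?D)"
      "inside ?D \<inter> outside ?D = {}" "inside ?D \<union> outside ?D = - ?D"
    by (rule Jordan_parts)+
  let ?A = "j ` outside ?C" and ?B = "j ` (inside ?C - {p})"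
  have surj: "\<exists>z. z \<noteq> p \<and> j z = y" if "y \<noteq> 0" for y
    by (rule exI[of _ "p + inverse y"]) (use that in \<open>simp add: j_def\<close>)
  have cover: "y \<in> ?A \<or> y \<in> ?B \<or> y \<in> ?D" if "y \<noteq> 0" for y
  proof -
    obtain z where z: "z \<noteq> p" "j z = y" using surj[OF \<open>y \<noteq> 0\<close>] by blast
    then show ?thesis using J(8) unfolding D by blast
  qed
  have connA: "connected ?A"
    by (rule connected_continuous_image[OF continuous_on_subset[OF cont]]) (use pO J in auto)
  have connB: "connected ?B"
    by (rule connected_continuous_image[OF continuous_on_subset[OF cont]])
       (use J in \<open>auto intro!: connected_open_delete\<close>)
  have AD: "?A \<inter> ?D = {}" and BD: "?B \<inter> ?D = {}"
    unfolding D image_Int[OF inj, symmetric] using J(8) by blast+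
  have "\<exists>y\<in>outside ?D. y \<in> ?B"
  proof -
    obtain e where e: "e > 0" "ball p e \<subseteq> inside ?C"
      using J p open_contains_ball by metis
    obtain y where y: "y \<in> outside ?D" "norm y > inverse e"
      using JD by (meson bounded_iff not_le)
    then have "y \<noteq> 0" using e by auto
    have "inverse (norm y) < inverse (inverse e)"
      by (rule less_imp_inverse_less) (use y e in auto)
    then have "dist p (p + inverse y) < e" by (simp add: dist_norm norm_inverse)
    then have "p + inverse y \<in> inside ?C - {p}" using e \<open>y \<noteq> 0\<close> by auto
    moreover have "j (p + inverse y) = y" by (simp add: j_def)
    ultimately show ?thesis using y by (metis image_eqI)
  qed
  then have "?B \<inter> outside ?D \<noteq> {}" by blast
  moreover have "?B \<subseteq> outside ?D \<union> inside ?D" using BD JD by blast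
  ultimately have B_out: "?B \<subseteq> outside ?D"
    using connected_subset_open_part[OF connB, of "outside ?D" "inside ?D"] JD by blast
  have "inside ?D - {0} \<noteq> {}"
    using JD by (metis Diff_eq_empty_iff finite.emptyI finite_insert finite_imp_not_open finite_subset)
  then obtain y where "y \<in> inside ?D" "y \<noteq> 0" by blast
  then have "y \<in> ?A" using cover[of y] B_out JD(5,6) by blast
  then have "?A \<inter> inside ?D \<noteq> {}" using \<open>y \<in> inside ?D\<close> by blast
  then show ?thesis
    using connected_subset_open_part[OF connA, of "inside ?D" "outside ?D"] JD AD by blast
qed

text \<open>The third arc cuts the inside of the other two into two pieces, each bounded by
  \<open>c3\<close> and one of \<open>c1\<close>, \<open>c2\<close>. A connected set off all three
  arcs lies in one piece, and its closure then misses the inner points of the arc that does not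
  bound this piece.\<close>

lemma theta_complement_inside:
  fixes c1 c2 c3 :: "real \<Rightarrow> complex"
  assumes c1: "arc c1" "pathstart c1 = a" "pathfinish c1 = b"
    and c2: "arc c2" "pathstart c2 = a" "pathfinish c2 = b"
    and c3: "arc c3" "pathstart c3 = a" "pathfinish c3 = b"
    and disj: "path_image c1 \<inter> path_image c2 = {a, b}" "path_image c1 \<inter> path_image c3 = {a, b}"
      "path_image c2 \<inter> path_image c3 = {a, b}"
    and W: "connected W" "W \<inter> (path_image c1 \<union> path_image c2 \<union> path_image c3) = {}"
    and z1: "z1 \<in> closure W" "z1 \<in> path_image c1 - {a, b}"
    and z2: "z2 \<in> closure W" "z2 \<in> path_image c2 - {a, b}"
    and z3: "z3 \<in> closure W" "z3 \<in> path_image c3 - {a, b}"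
    and ins: "path_image c3 \<inter> inside (path_image c1 \<union> path_image c2) \<noteq> {}"
  shows False
proof -
  have ab: "a \<noteq> b" using c1 arc_distinct_ends by blast
  let ?I1 = "inside (path_image c1 \<union> path_image c3)" and ?I2 = "inside (path_image c2 \<union> path_image c3)"
    and ?I = "inside (path_image c1 \<union> path_image c2)"
  have sp: "simple_path c1" "simple_path c2" "simple_path c3" using c1 c2 c3 arc_imp_simple_path by auto
  have split: "?I1 \<inter> ?I2 = {}" "?I1 \<union> ?I2 \<union> (path_image c3 - {a, b}) = ?I"
    using split_inside_simple_closed_curve[OF sp(1) c1(2,3) sp(2) c2(2,3) sp(3) c3(2,3) ab disj ins] by blast+
  note J = Jordan_parts[OF theta_arcs_loop(1,2)[OF c1 c2 disj(1)],
      unfolded theta_arcs_loop(3)[OF c1 c2 disj(1)]]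
  note J1 = Jordan_parts[OF theta_arcs_loop(1,2)[OF c1 c3 disj(2)],
      unfolded theta_arcs_loop(3)[OF c1 c3 disj(2)]]
  note J2 = Jordan_parts[OF theta_arcs_loop(1,2)[OF c2 c3 disj(3)],
      unfolded theta_arcs_loop(3)[OF c2 c3 disj(3)]]
  have "z3 \<in> ?I" using split(2) z3(2) by blast
  then have "W \<inter> ?I \<noteq> {}" using J(2) z3(1) open_Int_closure_eq_empty[of ?I W] by blast
  moreover have "W \<subseteq> ?I \<union> outside (path_image c1 \<union> path_image c2)" using W(2) J(8) by blast
  ultimately have "W \<subseteq> ?I" using connected_subset_open_part[OF W(1), of ?I] J(2,4,7) by blast
  then have "W \<subseteq> ?I1 \<union> ?I2" using split W(2) by blast
  then have "W \<subseteq> ?I1 \<or> W \<subseteq> ?I2"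
    using connected_subset_open_part[OF W(1), of ?I1 ?I2] J1(2) J2(2) split(1) by blast
  then show False
  proof
    assume "W \<subseteq> ?I1"
    then have "z2 \<in> closure ?I1" using z2 closure_mono by blast
    moreover have "closure ?I1 \<subseteq> (path_image c1 \<union> path_image c3) \<union> ?I1"
      by (rule closure_inside_subset) (use c1 c3 in \<open>auto intro!: closed_arc_image\<close>)
    ultimately have "z2 \<in> ?I1" using z2(2) disj(1,3) by blast
    then show False using split(2) z2(2) J(8) by blast
  next
    assume "W \<subseteq> ?I2"
    then have "z1 \<in> closure ?I2" using z1 closure_mono by blast
    moreover have "closure ?I2 \<subseteq> (path_image c2 \<union> path_image c3) \<union> ?I2"
      by (rule closure_inside_subset) (use c2 c3 in \<open>auto intro!: closed_arc_image\<close>)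
    ultimately have "z1 \<in> ?I2" using z1(2) disj(1,2) by blast
    then show False using split(2) z1(2) J(8) by blast
  qed
qed

text \<open>If \<open>c3\<close> runs outside the loop of the other two arcs, inversion about a
  point inside the loop brings it inside and reduces to the previous case. So the three arcs may be
  treated alike: no face of a theta curve borders all of them.\<close>

lemma theta_complement:
  fixes c1 c2 c3 :: "real \<Rightarrow> complex"
  assumes c1: "arc c1" "pathstart c1 = a" "pathfinish c1 = b"
    and c2: "arc c2" "pathstart c2 = a" "pathfinish c2 = b"
    and c3: "arc c3" "pathstart c3 = a" "pathfinish c3 = b"
    and disj: "path_image c1 \<inter> path_image c2 = {a, b}" "path_image c1 \<inter> path_image c3 = {a, b}"
      "path_image c2 \<inter> path_image c3 = {a, b}"
    and W: "connected W" "W \<inter> (path_image c1 \<union> path_image c2 \<union> path_image c3) = {}"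
    and z1: "z1 \<in> closure W" "z1 \<in> path_image c1 - {a, b}"
    and z2: "z2 \<in> closure W" "z2 \<in> path_image c2 - {a, b}"
    and z3: "z3 \<in> closure W" "z3 \<in> path_image c3 - {a, b}"
  shows False
proof (cases "path_image c3 \<inter> inside (path_image c1 \<union> path_image c2) = {}")
  case False
  then show ?thesis using theta_complement_inside[OF assms] by blast
next
  case True
  let ?I = "inside (path_image c1 \<union> path_image c2)" and ?O = "outside (path_image c1 \<union> path_image c2)"
  note loop = theta_arcs_loop[OF c1 c2 disj(1)]
  note J = Jordan_parts[OF loop(1,2), unfolded loop(3)]
  obtain p where p: "p \<in> ?I" using J(1) by blast
  define j where "j z = inverse (z - p)" for z
  have c3_out: "path_image c3 - {a, b} \<subseteq> ?O" using True J(8) disj(2,3) by blast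
  have "W \<inter> ?O \<noteq> {}" using J(4) z3 c3_out open_Int_closure_eq_empty[of ?O W] by blast
  moreover have "W \<subseteq> ?I \<union> ?O" using W(2) J(8) by blast
  ultimately have WO: "W \<subseteq> ?O" using connected_subset_open_part[OF W(1), of ?O ?I] J(2,4,7) by blast
  have pW: "p \<notin> W" using WO p J(7) by blast
  have "p \<notin> path_image c1 \<union> path_image c2" using p J(8) by blast
  moreover have "p \<notin> path_image c3" using True p by blast
  ultimately have pc: "p \<notin> path_image c1" "p \<notin> path_image c2" "p \<notin> path_image c3" by auto
  have cont: "continuous_on (- {p}) j" unfolding j_def by (intro continuous_intros) auto
  have inj: "inj j" unfolding j_def inj_def by simp
  have arcs: "arc (j \<circ> c)" if "arc c" "p \<notin> path_image c" for c :: "real \<Rightarrow> complex"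
    unfolding arc_def
  proof
    show "path (j \<circ> c)"
      by (rule path_continuous_image[OF _ continuous_on_subset[OF cont]])
         (use that in \<open>auto simp: arc_def\<close>)
    show "inj_on (j \<circ> c) {0..1}"
      using that inj by (intro comp_inj_on) (auto simp: arc_def intro: inj_on_subset)
  qed
  have clo: "j z \<in> closure (j ` W)" if z: "z \<in> closure W" "z \<noteq> p" for z
  proof -
    have "isCont j z" unfolding j_def by (intro continuous_intros) (use z in auto)
    obtain f where f: "\<And>n. f n \<in> W" "f \<longlonglongrightarrow> z" using z(1) unfolding closure_sequential by blast
    have "(\<lambda>n. j (f n)) \<longlonglongrightarrow> j z" using isCont_tendsto_compose[OF \<open>isCont j z\<close> f(2)] .
    then show ?thesis unfolding closure_sequential using f(1) by (intro exI[of _ "\<lambda>n. j (f n)"]) auto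
  qed
  have imint: "j ` A \<inter> j ` B = j ` (A \<inter> B)" for A B using inj by (simp add: image_Int)
  have jz: "j z \<in> path_image (j \<circ> c) - {j a, j b}" if "z \<in> path_image c - {a, b}" for z and c :: "real \<Rightarrow> complex"
    using that inj by (auto simp: path_image_compose inj_def)
  have loopj: "path_image (j \<circ> (c1 +++ reversepath c2)) = path_image (j \<circ> c1) \<union> path_image (j \<circ> c2)"
    using loop(3) by (simp add: path_image_compose image_Un)
  have "j ` ?O \<subseteq> inside (path_image (j \<circ> c1) \<union> path_image (j \<circ> c2))"
    using inverse_image_outside[OF loop(1,2), unfolded loop(3), OF p] loopj unfolding j_def[abs_def] by simp
  then have ins: "path_image (j \<circ> c3) \<inter> inside (path_image (j \<circ> c1) \<union> path_image (j \<circ> c2)) \<noteq> {}"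
    using c3_out z3 by (fastforce simp: path_image_compose)
  show ?thesis
  proof (rule theta_complement_inside[where W = "j ` W", OF _ _ _ _ _ _ _ _ _ _ _ _ _ _ _ _ _ _ _ _ ins])
    show "connected (j ` W)"
      by (rule connected_continuous_image[OF continuous_on_subset[OF cont] W(1)]) (use pW in auto)
    show "j ` W \<inter> (path_image (j \<circ> c1) \<union> path_image (j \<circ> c2) \<union> path_image (j \<circ> c3)) = {}"
      using W(2) by (simp add: path_image_compose imint flip: image_Un)
    show "j z1 \<in> closure (j ` W)" "j z2 \<in> closure (j ` W)" "j z3 \<in> closure (j ` W)"
      using clo z1 z2 z3 pc by blast+
    show "j z1 \<in> path_image (j \<circ> c1) - {j a, j b}" "j z2 \<in> path_image (j \<circ> c2) - {j a, j b}"
      "j z3 \<in> path_image (j \<circ> c3) - {j a, j b}"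
      using jz z1 z2 z3 by blast+
  qed (use arcs c1 c2 c3 pc disj in \<open>simp_all add: pathstart_compose pathfinish_compose path_image_compose imint\<close>)
qed

text \<open>The paths from \<open>u1\<close> to \<open>u2\<close> through the three \<open>x\<close>
  form a theta curve. The edges at \<open>u3\<close>, drawn from \<open>u3\<close> up to their far
  ends, would be a connected set in one face whose closure reaches all three arcs.\<close>

lemma planar_no_K33:
  assumes G: "planar G"
    and d: "distinct [u1, u2, u3, x1, x2, x3]"
    and E: "\<And>u x. u \<in> {u1, u2, u3} \<Longrightarrow> x \<in> {x1, x2, x3} \<Longrightarrow> {u, x} \<in> snd G"
    and V: "{u1, u2, u3, x1, x2, x3} \<subseteq> fst G"
  shows False
proof -
  obtain pos :: "'a \<Rightarrow> complex" and \<gamma> :: "'a set \<Rightarrow> real \<Rightarrow> complex" where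
    inj: "inj_on pos (fst G)" and
    \<gamma>: "\<forall>e\<in>snd G. arc (\<gamma> e) \<and> {pathstart (\<gamma> e), pathfinish (\<gamma> e)} = pos ` e \<and>
            path_image (\<gamma> e) \<inter> pos ` fst G = pos ` e" and
    \<gamma>2: "\<forall>e\<in>snd G. \<forall>e'\<in>snd G. e \<noteq> e' \<longrightarrow>
            path_image (\<gamma> e) \<inter> path_image (\<gamma> e') = pos ` (e \<inter> e')"
    using G unfolding planar_def by blast
  \<comment> \<open>\<open>\<gamma>\<close> is indexed by unordered pairs, so each arc is reversed
    where necessary to start at the first argument of \<open>g\<close>.\<close>
  define g where "g u x = (if pathstart (\<gamma> {u, x}) = pos u then \<gamma> {u, x} else reversepath (\<gamma> {u, x}))"
    for u x
  have gim: "path_image (g u x) = path_image (\<gamma> {u, x})" for u x by (simp add: g_def)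
  have g: "arc (g u x) \<and> pathstart (g u x) = pos u \<and> pathfinish (g u x) = pos x"
    if "{u, x} \<in> snd G" for u x
  proof -
    have "arc (\<gamma> {u, x})" "{pathstart (\<gamma> {u, x}), pathfinish (\<gamma> {u, x})} = {pos u, pos x}"
      using \<gamma>[rule_format, OF that] by auto
    then show ?thesis by (auto simp: g_def arc_reversepath doubleton_eq_iff)
  qed
  have gi: "path_image (g u x) \<inter> path_image (g u' x') = pos ` ({u, x} \<inter> {u', x'})"
    if "{u, x} \<in> snd G" "{u', x'} \<in> snd G" "{u, x} \<noteq> {u', x'}" for u x u' x'
    unfolding gim using \<gamma>2[rule_format, OF that] .
  have E': "{x, u} \<in> snd G" if "u \<in> {u1, u2, u3}" "x \<in> {x1, x2, x3}" for u x
    using E[OF that] by (simp add: insert_commute)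
  define c where "c x = g u1 x +++ g x u2" for x
  have c: "arc (c x) \<and> pathstart (c x) = pos u1 \<and> pathfinish (c x) = pos u2 \<and>
      path_image (c x) = path_image (g u1 x) \<union> path_image (g x u2)" if "x \<in> {x1, x2, x3}" for x
  proof -
    have 1: "{u1, x} \<in> snd G" "{x, u2} \<in> snd G" using E E' that by auto
    have "path_image (g u1 x) \<inter> path_image (g x u2) = {pos x}"
    proof -
      have "{u1, x} \<inter> {x, u2} = {x}" "{u1, x} \<noteq> {x, u2}" using d that by (auto simp: doubleton_eq_iff)
      then show ?thesis using gi[OF 1] by (metis image_insert image_empty)
    qed
    then show ?thesis unfolding c_def using g[OF 1(1)] g[OF 1(2)] by (simp add: arc_join path_image_join)
  qed
  have disj: "path_image (c x) \<inter> path_image (c y) = {pos u1, pos u2}"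
    if "x \<in> {x1, x2, x3}" "y \<in> {x1, x2, x3}" "x \<noteq> y" for x y
  proof -
    have e: "{u1, x} \<in> snd G" "{x, u2} \<in> snd G" "{u1, y} \<in> snd G" "{y, u2} \<in> snd G"
      using E E' that by auto
    have n: "x \<noteq> u1" "x \<noteq> u2" "y \<noteq> u1" "y \<noteq> u2" "u1 \<noteq> u2" using d that by auto
    have s: "{u1, x} \<inter> {u1, y} = {u1}" "{u1, x} \<inter> {y, u2} = {}" "{x, u2} \<inter> {u1, y} = {}"
      "{x, u2} \<inter> {y, u2} = {u2}" "{u1, x} \<noteq> {u1, y}" "{u1, x} \<noteq> {y, u2}"
      "{x, u2} \<noteq> {u1, y}" "{x, u2} \<noteq> {y, u2}"
      using n that(3) by (auto simp: doubleton_eq_iff)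
    have "path_image (g u1 x) \<inter> path_image (g u1 y) = {pos u1}"
      "path_image (g u1 x) \<inter> path_image (g y u2) = {}"
      "path_image (g x u2) \<inter> path_image (g u1 y) = {}"
      "path_image (g x u2) \<inter> path_image (g y u2) = {pos u2}"
      using gi[OF e(1,3) s(5)] gi[OF e(1,4) s(6)] gi[OF e(2,3) s(7)] gi[OF e(2,4) s(8)]
      unfolding s(1-4) by simp_all
    moreover have "path_image (c x) = path_image (g u1 x) \<union> path_image (g x u2)"
      "path_image (c y) = path_image (g u1 y) \<union> path_image (g y u2)"
      using c[OF that(1)] c[OF that(2)] by blast+
    ultimately show ?thesis by (simp add: Int_Un_distrib Int_Un_distrib2 insert_commute)
  qed
  \<comment> \<open>The tips \<open>pos x\<close> are taken off so that the star at
    \<open>u3\<close> avoids the theta curve and touches it only with its closure.\<close>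
  define W where "W = (\<Union>x\<in>{x1, x2, x3}. path_image (g u3 x) - {pos x})"
  have Wx: "connected (path_image (g u3 x) - {pos x}) \<and> pos u3 \<in> path_image (g u3 x) - {pos x} \<and>
      pos x \<in> closure (path_image (g u3 x) - {pos x})" if "x \<in> {x1, x2, x3}" for x
  proof -
    have g': "arc (g u3 x)" "pathstart (g u3 x) = pos u3" "pathfinish (g u3 x) = pos x"
      using g E that by auto
    have c01: "continuous_on {0..1} (g u3 x)" using g' by (simp add: arc_def path_def)
    have eq: "path_image (g u3 x) - {pos x} = g u3 x ` {0..<1}"
    proof -
      have "inj_on (g u3 x) {0..1}" using g' by (simp add: arc_def)
      then have "g u3 x ` ({0..1} - {1}) = g u3 x ` {0..1} - g u3 x ` {1}" by (subst inj_on_image_set_diff) auto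
      moreover have "{0..1} - {1::real} = {0..<1}" by auto
      ultimately show ?thesis using g' by (simp add: path_image_def pathfinish_def)
    qed
    have "connected (g u3 x ` {0..<1})"
      by (rule connected_continuous_image[OF continuous_on_subset[OF c01]]) auto
    moreover have "pos u3 \<in> g u3 x ` {0..<1}" using g' by (auto simp: pathstart_def intro!: image_eqI[of _ _ 0])
    moreover have "pos x \<in> closure (g u3 x ` {0..<1})"
    proof -
      have "g u3 x ` closure {0..<1} \<subseteq> closure (g u3 x ` {0..<1})"
        by (rule image_closure_subset) (use c01 in \<open>auto intro: subsetD[OF closure_subset]\<close>)
      moreover have "(1::real) \<in> closure {0..<1}" by simp
      ultimately have "g u3 x 1 \<in> closure (g u3 x ` {0..<1})" by blast
      then show ?thesis using g' by (simp add: pathfinish_def)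
    qed
    ultimately show ?thesis using eq by simp
  qed
  have "connected W" unfolding W_def
    by (rule connected_Union) (use Wx in blast)+
  have gu3: "path_image (g u3 y) \<inter> path_image (c x) \<subseteq> {pos y}"
    if "x \<in> {x1, x2, x3}" "y \<in> {x1, x2, x3}" for x y
  proof -
    have e: "{u3, y} \<in> snd G" "{u1, x} \<in> snd G" "{x, u2} \<in> snd G" using E E' that by auto
    have n: "x \<noteq> u1" "x \<noteq> u2" "x \<noteq> u3" "y \<noteq> u1" "y \<noteq> u2" "y \<noteq> u3" "u1 \<noteq> u2" "u1 \<noteq> u3" "u2 \<noteq> u3"
      using d that by auto
    have s: "{u3, y} \<inter> {u1, x} \<subseteq> {y}" "{u3, y} \<inter> {x, u2} \<subseteq> {y}"
      "{u3, y} \<noteq> {u1, x}" "{u3, y} \<noteq> {x, u2}"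
      using n by (auto simp: doubleton_eq_iff)
    have "path_image (g u3 y) \<inter> path_image (g u1 x) \<subseteq> {pos y}"
      "path_image (g u3 y) \<inter> path_image (g x u2) \<subseteq> {pos y}"
      unfolding gi[OF e(1,2) s(3)] gi[OF e(1,3) s(4)] using s(1,2) by blast+
    then show ?thesis using c[OF that(1)] by blast
  qed
  have Wc: "W \<inter> path_image (c x) = {}" if "x \<in> {x1, x2, x3}" for x
    unfolding W_def using gu3[OF that] by blast
  have "pos x \<in> closure W" if "x \<in> {x1, x2, x3}" for x
    using Wx[OF that] that unfolding W_def by (meson UN_upper closure_mono subsetD)
  moreover have "pos x \<in> path_image (c x) - {pos u1, pos u2}" if "x \<in> {x1, x2, x3}" for x
  proof -
    have "pos x \<in> path_image (c x)" using c g E that by (metis UnCI insertI1 pathfinish_in_path_image)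
    moreover have "x \<noteq> u1" "x \<noteq> u2" using d that by auto
    ultimately show ?thesis using inj V that by (auto simp: inj_on_def)
  qed
  ultimately show False
    using theta_complement[of "c x1" "pos u1" "pos u2" "c x2" "c x3" W "pos x1" "pos x2" "pos x3"]
      c disj d Wc \<open>connected W\<close> by (simp add: Int_Un_distrib)
qed

subsection \<open>Stacked graphs and their vertex links\<close>

definition triple_stacked :: "'a set set \<Rightarrow> bool" where
  "triple_stacked E \<longleftrightarrow> (\<exists>u v w x y z. distinct [u, v, w, x, y, z] \<and>
     {u, v} \<in> E \<and> {v, w} \<in> E \<and> {u, w} \<in> E \<and> (\<forall>p\<in>{u, v, w}. \<forall>q\<in>{x, y, z}. {p, q} \<in> E))"

lemma triple_stacked_mono: "triple_stacked E \<Longrightarrow> E \<subseteq> E' \<Longrightarrow> triple_stacked E'"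
  unfolding triple_stacked_def by (meson subsetD)

section \<open>Lists read as cycles\<close>

text \<open>The indexing is that of \<open>side\<close>, so that side \<open>i\<close> of a corner
  list is the convex hull of its cyclic edge \<open>i\<close>.\<close>

definition cyclic_edge :: "'a list \<Rightarrow> nat \<Rightarrow> 'a set" where
  "cyclic_edge ys i = {ys ! i, ys ! (Suc i mod length ys)}"

definition cyclic_edges :: "'a list \<Rightarrow> 'a set set" where
  "cyclic_edges ys = cyclic_edge ys ` {..<length ys}"

lemma Suc_mod_inj: "i < n \<Longrightarrow> j < n \<Longrightarrow> Suc i mod n = Suc j mod n \<Longrightarrow> i = j"
  by (auto simp: mod_Suc split: if_splits)

lemma Suc_mod_surj:
  assumes "j < n" obtains i where "i < n" "j = Suc i mod n"
  using that[of "if j = 0 then n - 1 else j - 1"] assms by (cases j) auto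

lemma Suc_mod_less: "i < n \<Longrightarrow> Suc i mod n < n"
  by (rule mod_less_divisor) auto

lemma Suc_mod_neq: "i < n \<Longrightarrow> 2 \<le> n \<Longrightarrow> Suc i mod n \<noteq> i"
  "i < n \<Longrightarrow> 3 \<le> n \<Longrightarrow> Suc (Suc i mod n) mod n \<noteq> i"
  by (auto simp: mod_Suc)

text \<open>An entry is always addressed as the successor of an index \<open>i\<close>, which
  \<open>Suc_mod_surj\<close> permits; its two edges are then \<open>i\<close> and the next one, and
  no predecessor modulo the length is needed.\<close>

lemma cyclic_edges_at:
  assumes ys: "distinct ys" "3 \<le> length ys" and i: "i < length ys"
  shows "{e \<in> cyclic_edges ys. ys ! (Suc i mod length ys) \<in> e} =
      {cyclic_edge ys i, cyclic_edge ys (Suc i mod length ys)}"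
    and "cyclic_edge ys i \<noteq> cyclic_edge ys (Suc i mod length ys)"
proof -
  let ?n = "length ys" and ?j = "Suc i mod length ys"
  have j: "?j < ?n" by (rule Suc_mod_less[OF i])
  have "k = i \<or> k = ?j" if "k < ?n" "ys ! ?j \<in> cyclic_edge ys k" for k
  proof -
    have "?j = k \<or> ?j = Suc k mod ?n"
      using that j Suc_mod_less[OF that(1)] ys(1) by (auto simp: cyclic_edge_def nth_eq_iff_index_eq)
    then show ?thesis using Suc_mod_inj that(1) i by metis
  qed
  moreover have "ys ! ?j \<in> cyclic_edge ys i" "ys ! ?j \<in> cyclic_edge ys ?j" by (auto simp: cyclic_edge_def)
  ultimately show "{e \<in> cyclic_edges ys. ys ! ?j \<in> e} = {cyclic_edge ys i, cyclic_edge ys ?j}"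
    using i j by (auto simp: cyclic_edges_def)
  have "ys ! i \<notin> cyclic_edge ys ?j"
    using Suc_mod_neq[OF i] ys i j Suc_mod_less[OF j] by (auto simp: cyclic_edge_def nth_eq_iff_index_eq)
  then show "cyclic_edge ys i \<noteq> cyclic_edge ys ?j" by (auto simp: cyclic_edge_def)
qed

lemma cyclic_edge_inj:
  assumes ys: "distinct ys" "3 \<le> length ys"
  shows "inj_on (cyclic_edge ys) {..<length ys}"
proof (rule inj_onI)
  fix i j assume ij: "i \<in> {..<length ys}" "j \<in> {..<length ys}" "cyclic_edge ys i = cyclic_edge ys j"
  let ?n = "length ys"
  have "ys ! (Suc i mod ?n) \<in> cyclic_edge ys j" unfolding ij(3)[symmetric] by (simp add: cyclic_edge_def)
  then have "Suc i mod ?n = j \<or> Suc i mod ?n = Suc j mod ?n"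
    using ij Suc_mod_less[of i ?n] Suc_mod_less[of j ?n] ys(1) by (auto simp: cyclic_edge_def nth_eq_iff_index_eq)
  then show "i = j" using Suc_mod_inj cyclic_edges_at(2)[OF ys, of i] ij by auto
qed

lemma cyclic_edge_subset: "i < length ys \<Longrightarrow> cyclic_edge ys i \<subseteq> set ys"
  using Suc_mod_less[of i "length ys"] by (auto simp: cyclic_edge_def)

lemma cyclic_edges_rotate: "cyclic_edges (rotate m ys) = cyclic_edges ys"
proof -
  have sub: "cyclic_edges (rotate m ys) \<subseteq> cyclic_edges ys" for m and ys :: "'a list"
  proof
    fix e assume "e \<in> cyclic_edges (rotate m ys)"
    then obtain k where k: "k < length ys"
      and e: "e = {rotate m ys ! k, rotate m ys ! (Suc k mod length ys)}"
      by (auto simp: cyclic_edges_def cyclic_edge_def)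
    have "Suc k mod length ys < length ys" using k by (intro mod_less_divisor) auto
    moreover have "(m + Suc k mod length ys) mod length ys = Suc ((m + k) mod length ys) mod length ys"
      by (simp add: mod_simps)
    ultimately have "e = {ys ! ((m + k) mod length ys), ys ! (Suc ((m + k) mod length ys) mod length ys)}"
      using k e by (simp add: nth_rotate)
    moreover have "(m + k) mod length ys < length ys" using k by (intro mod_less_divisor) auto
    ultimately show "e \<in> cyclic_edges ys" by (auto simp: cyclic_edges_def cyclic_edge_def)
  qed
  show ?thesis
  proof (cases "length ys")
    case 0
    then show ?thesis by simp
  next
    case (Suc n)
    \<comment> \<open>Another \<open>m * n\<close> steps complete \<open>m\<close> full turns, so
      the inclusion just shown also applies backwards.\<close>
    have "rotate (m * n) (rotate m ys) = rotate (m * length ys) ys"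
      by (simp add: rotate_rotate Suc add.commute)
    also have "\<dots> = ys" by (rule rotate_id) simp
    finally have "cyclic_edges ys \<subseteq> cyclic_edges (rotate m ys)" using sub[of "m * n" "rotate m ys"] by simp
    then show ?thesis using sub by blast
  qed
qed

text \<open>After a rotation the edge \<open>{b, c}\<close> joins the last entry to the first, and
  subdividing it means appending \<open>x\<close>.\<close>

lemma cyclic_edges_insert:
  assumes ys: "distinct ys" "3 \<le> length ys" and bc: "{b, c} \<in> cyclic_edges ys"
    and x: "x \<notin> set ys"
  obtains ys' where "distinct ys'" "length ys' = Suc (length ys)" "set ys' = insert x (set ys)"
    "cyclic_edges ys' = cyclic_edges ys - {{b, c}} \<union> {{b, x}, {x, c}}"
proof -
  obtain i where i: "i < length ys" "{b, c} = {ys ! i, ys ! (Suc i mod length ys)}"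
    using bc by (auto simp: cyclic_edges_def cyclic_edge_def)
  define n where "n = length ys - 1"
  have n: "length ys = Suc n" "2 \<le> n" using ys by (auto simp: n_def)
  define zs where "zs = rotate (Suc i) ys"
  have zs: "length zs = Suc n" "distinct zs" "set zs = set ys" "cyclic_edges zs = cyclic_edges ys"
    unfolding zs_def using n ys by (simp_all only: cyclic_edges_rotate length_rotate distinct_rotate set_rotate)
  have "zs ! n = ys ! i"
  proof -
    have "(Suc i + n) mod length ys = i" using i n by (metis add_Suc_shift mod_add_self2 mod_less)
    then show ?thesis using n by (simp add: zs_def nth_rotate del: rotate_Suc)
  qed
  moreover have "zs ! 0 = ys ! (Suc i mod length ys)"
    using n by (simp add: zs_def nth_rotate del: rotate_Suc)
  ultimately have bc': "{b, c} = {zs ! n, zs ! 0}" using i by simp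
  have split: "{..<Suc n} = insert n {..<n}" "{..<Suc (Suc n)} = insert (Suc n) (insert n {..<n})" by auto
  have E1: "cyclic_edges zs = insert {zs ! n, zs ! 0} ((\<lambda>k. {zs ! k, zs ! Suc k}) ` {..<n})"
    unfolding cyclic_edges_def cyclic_edge_def zs split by auto
  have E2: "cyclic_edges (zs @ [x]) = {{zs ! n, x}, {x, zs ! 0}} \<union> (\<lambda>k. {zs ! k, zs ! Suc k}) ` {..<n}"
    unfolding cyclic_edges_def cyclic_edge_def length_append zs list.size add_Suc_right add_0_right split
    by (auto simp: nth_append zs)
  \<comment> \<open>With at least three entries the closing edge occurs only once as a set, so
    removing it removes no other edge.\<close>
  have "{zs ! k, zs ! Suc k} \<noteq> {zs ! n, zs ! 0}" if "k < n" for k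
  proof
    assume "{zs ! k, zs ! Suc k} = {zs ! n, zs ! 0}"
    then have "zs ! k = zs ! n \<and> zs ! Suc k = zs ! 0 \<or> zs ! k = zs ! 0 \<and> zs ! Suc k = zs ! n"
      by (simp add: doubleton_eq_iff)
    then show False using zs n that by (auto simp: nth_eq_iff_index_eq)
  qed
  then have "cyclic_edges ys - {{b, c}} = (\<lambda>k. {zs ! k, zs ! Suc k}) ` {..<n}"
    unfolding zs(4)[symmetric] E1 bc' by fastforce
  moreover have "{{b, x}, {x, c}} = {{zs ! n, x}, {x, zs ! 0}}"
    using bc' by (auto simp: doubleton_eq_iff)
  ultimately have "cyclic_edges (zs @ [x]) = cyclic_edges ys - {{b, c}} \<union> {{b, x}, {x, c}}"
    using E2 by auto
  then show ?thesis using that[of "zs @ [x]"] zs x n by simp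
qed

section \<open>Stacked graphs together with their faces\<close>

text \<open>\<open>F\<close> collects the triangles of a triangulated sphere, and stacking replaces
  one of them by three. All three contain the new vertex, so a triangle that has left
  \<open>F\<close> never returns and is never stacked onto again.\<close>

inductive stacked :: "'a set \<Rightarrow> 'a set set \<Rightarrow> 'a set set \<Rightarrow> bool" where
  K4: "card V = 4 \<Longrightarrow> stacked V {{u, v} | u v. u \<in> V \<and> v \<in> V \<and> u \<noteq> v} {T. T \<subseteq> V \<and> card T = 3}"
| stack: "\<lbrakk>stacked V E F; x \<notin> V; distinct [u, v, w]; {u, v, w} \<in> F\<rbrakk>
    \<Longrightarrow> stacked (insert x V) (E \<union> {{x, u}, {x, v}, {x, w}})
          (F - {{u, v, w}} \<union> {{x, u, v}, {x, v, w}, {x, u, w}})"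

lemma triangle_at_vertex:
  assumes "distinct [a, b, c]" "{a, b} \<in> D" "{b, c} \<in> D" "{a, c} \<in> D" "x \<in> {a, b, c}"
  obtains p q where "{a, b, c} = {x, p, q}" "p \<noteq> q" "p \<noteq> x" "q \<noteq> x" "{x, p} \<in> D" "{x, q} \<in> D"
proof -
  consider "x = a" | "x = b" | "x = c" using assms(5) by blast
  then show ?thesis
  proof cases
    case 1 then show ?thesis using that[of b c] assms by auto
  next
    case 2 then show ?thesis using that[of a c] assms by (auto simp: insert_commute)
  next
    case 3 then show ?thesis using that[of a b] assms by (auto simp: insert_commute)
  qed
qed

text \<open>The induction carries along that every face has a common neighbour and that every other
  triangle has at least two. Stacking onto a triangle outside \<open>F\<close> would then create a
  third one.\<close>

lemma three_tree_imp_stacked: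
  assumes "three_tree G" "\<not> triple_stacked (snd G)"
  obtains F where "stacked (fst G) (snd G) F"
proof -
  have "\<exists>F. stacked (fst G) (snd G) F \<and> (\<forall>t\<in>F. \<exists>y. \<forall>p\<in>t. {p, y} \<in> snd G) \<and>
    (\<forall>u v w. distinct [u, v, w] \<longrightarrow> {u, v} \<in> snd G \<longrightarrow> {v, w} \<in> snd G \<longrightarrow> {u, w} \<in> snd G \<longrightarrow>
      {u, v, w} \<notin> F \<longrightarrow> (\<exists>y z. y \<noteq> z \<and> (\<forall>p\<in>{u, v, w}. {p, y} \<in> snd G \<and> {p, z} \<in> snd G)))"
    using assms
  proof induction
    case (K4 V)
    let ?E = "{{u, v} | u v. u \<in> V \<and> v \<in> V \<and> u \<noteq> v}" and ?F = "{T. T \<subseteq> V \<and> card T = 3}"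
    have 1: "\<exists>y. \<forall>p\<in>t. {p, y} \<in> ?E" if "t \<in> ?F" for t
    proof -
      have "\<not> V \<subseteq> t" using that K4(1) card_mono[of t V] by (auto simp: card_ge_0_finite)
      then obtain y where "y \<in> V" "y \<notin> t" by blast
      then show ?thesis using that by blast
    qed
    have 2: "{u, v, w} \<in> ?F" if "distinct [u, v, w]" "{u, v} \<in> ?E" "{v, w} \<in> ?E" for u v w
    proof -
      have "u \<in> V" "v \<in> V" "w \<in> V" using that by (auto simp: doubleton_eq_iff)
      then show ?thesis using that by auto
    qed
    show ?case unfolding fst_conv snd_conv
    proof (rule exI[of _ ?F], intro conjI ballI allI impI)
      show "stacked V ?E ?F" by (rule stacked.K4[OF K4(1)])
      show "\<exists>y. \<forall>p\<in>t. {p, y} \<in> ?E" if "t \<in> ?F" for t by (rule 1[OF that])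
      show "\<exists>y z. y \<noteq> z \<and> (\<forall>p\<in>{u, v, w}. {p, y} \<in> ?E \<and> {p, z} \<in> ?E)"
        if "distinct [u, v, w]" "{u, v} \<in> ?E" "{v, w} \<in> ?E" "{u, w} \<in> ?E" "{u, v, w} \<notin> ?F" for u v w
        using 2[OF that(1-3)] that(5) by contradiction
    qed
  next
    case (stack V E x u v w)
    let ?E = "E \<union> {{x, u}, {x, v}, {x, w}}"
    have "simple_ugraph (V, E)" using stack.hyps by (simp add: three_tree_simple)
    then have E: "e \<subseteq> V" "card e = 2" if "e \<in> E" for e using that by (auto simp: simple_ugraph_def)
    have xE: "{x, y} \<notin> E" "{y, x} \<notin> E" for y using E stack.hyps by blast+
    have pp: "{p, p} \<notin> E" for p using E(2)[of "{p, p}"] by auto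
    have "\<not> triple_stacked E" using stack.prems triple_stacked_mono by (metis snd_conv Un_upper1)
    then obtain F where F: "stacked V E F" "\<forall>t\<in>F. \<exists>y. \<forall>p\<in>t. {p, y} \<in> E"
      and tri: "\<And>u v w. distinct [u, v, w] \<Longrightarrow> {u, v} \<in> E \<Longrightarrow> {v, w} \<in> E \<Longrightarrow> {u, w} \<in> E \<Longrightarrow>
        {u, v, w} \<notin> F \<Longrightarrow> \<exists>y z. y \<noteq> z \<and> (\<forall>p\<in>{u, v, w}. {p, y} \<in> E \<and> {p, z} \<in> E)"
      using stack.IH by auto
    have uvw: "{u, v, w} \<in> F"
    proof (rule ccontr)
      assume "{u, v, w} \<notin> F"
      then obtain y z where yz: "y \<noteq> z" "\<forall>p\<in>{u, v, w}. {p, y} \<in> E \<and> {p, z} \<in> E"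
        using tri[of u v w] stack.hyps by blast
      have "distinct [u, v, w, x, y, z]" using yz stack.hyps(3) xE pp by auto
      moreover have "\<forall>p\<in>{u, v, w}. \<forall>q\<in>{x, y, z}. {p, q} \<in> ?E" using yz by (auto simp: insert_commute)
      ultimately have "triple_stacked ?E" unfolding triple_stacked_def using stack.hyps by blast
      then show False using stack.prems by simp
    qed
    let ?F = "F - {{u, v, w}} \<union> {{x, u, v}, {x, v, w}, {x, u, w}}"
    have 1: "stacked (insert x V) ?E ?F" by (rule stacked.stack[OF F(1)]) (use stack.hyps uvw in auto)
    have 2: "\<exists>y. \<forall>p\<in>t. {p, y} \<in> ?E" if tF: "t \<in> ?F" for t
    proof -
      have D: "{x, w} \<in> ?E" "{u, w} \<in> ?E" "{v, w} \<in> ?E" "{x, u} \<in> ?E" "{w, u} \<in> ?E" "{v, u} \<in> ?E"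
          "{x, v} \<in> ?E" "{u, v} \<in> ?E" "{w, v} \<in> ?E"
        using stack.hyps by (simp_all add: insert_commute)
      consider "t \<in> F" | "t = {x, u, v}" | "t = {x, v, w}" | "t = {x, u, w}" using tF by blast
      then show ?thesis
      proof cases
        case 1 then show ?thesis using F(2) by blast
      next
        case 2 then show ?thesis using D by (intro exI[of _ w]) (simp only: ball_simps simp_thms)
      next
        case 3 then show ?thesis using D by (intro exI[of _ u]) (simp only: ball_simps simp_thms)
      next
        case 4 then show ?thesis using D by (intro exI[of _ v]) (simp only: ball_simps simp_thms)
      qed
    qed
    have 3: "\<exists>y z. y \<noteq> z \<and> (\<forall>p\<in>{a, b, c}. {p, y} \<in> ?E \<and> {p, z} \<in> ?E)"
      if abc: "distinct [a, b, c]" "{a, b} \<in> ?E" "{b, c} \<in> ?E" "{a, c} \<in> ?E" "{a, b, c} \<notin> ?F" for a b c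
    proof (cases "x \<in> {a, b, c}")
      case True
      then obtain p q where pq: "{a, b, c} = {x, p, q}" "p \<noteq> q" "p \<noteq> x" "q \<noteq> x"
        "{x, p} \<in> ?E" "{x, q} \<in> ?E"
        using triangle_at_vertex[OF abc(1-4)] by blast
      \<comment> \<open>The only edges at \<open>x\<close> go to \<open>u\<close>, \<open>v\<close>,
        \<open>w\<close>, so each triangle through \<open>x\<close> is one of the new faces.\<close>
      then have "p \<in> {u, v, w}" "q \<in> {u, v, w}" using xE by (auto simp: doubleton_eq_iff)
      then have "{x, p, q} \<in> ?F" using pq(2) by (auto simp: insert_commute)
      then show ?thesis using pq abc by metis
    next
      case False
      have "{p, q} \<in> E" if "{p, q} \<in> ?E" "p \<noteq> x" "q \<noteq> x" for p q
        using that by (auto simp: doubleton_eq_iff)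
      then have abcE: "{a, b} \<in> E" "{b, c} \<in> E" "{a, c} \<in> E" using abc(2-4) False by blast+
      show ?thesis
      proof (cases "{a, b, c} \<in> F")
        case True
        \<comment> \<open>This triangle has just left \<open>F\<close>. Its two common neighbours
          are the one it had as a face and \<open>x\<close>.\<close>
        then have eq: "{a, b, c} = {u, v, w}" using abc(5) by (metis DiffI UnI1 singletonD)
        obtain y where y: "\<forall>p\<in>{u, v, w}. {p, y} \<in> E" using F(2) uvw by blast
        then have "y \<noteq> x" using xE by auto
        moreover have "\<forall>p\<in>{u, v, w}. {p, x} \<in> ?E" by (auto simp: insert_commute)
        moreover have "\<forall>p\<in>{u, v, w}. {p, y} \<in> ?E" using y by simp
        ultimately have "y \<noteq> x \<and> (\<forall>p\<in>{u, v, w}. {p, y} \<in> ?E \<and> {p, x} \<in> ?E)" by simp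
        then show ?thesis unfolding eq by (intro exI[of _ y] exI[of _ x])
      next
        case False
        show ?thesis using tri[OF abc(1) abcE False] by blast
      qed
    qed
    show ?case unfolding fst_conv snd_conv
    proof (rule exI[of _ ?F], intro conjI ballI allI impI)
      show "stacked (insert x V) ?E ?F" by (rule 1)
      show "\<exists>y. \<forall>p\<in>t. {p, y} \<in> ?E" if "t \<in> ?F" for t by (rule 2[OF that])
      show "\<exists>y z. y \<noteq> z \<and> (\<forall>p\<in>{u, v, w}. {p, y} \<in> ?E \<and> {p, z} \<in> ?E)"
        if "distinct [u, v, w]" "{u, v} \<in> ?E" "{v, w} \<in> ?E" "{u, w} \<in> ?E" "{u, v, w} \<notin> ?F" for u v w
        by (rule 3[OF that])
    qed
  qed
  then show ?thesis using that by blast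
qed

lemma stacked_wf:
  assumes "stacked V E F"
  shows "finite V \<and> 4 \<le> card V \<and> (\<forall>e\<in>E. e \<subseteq> V \<and> card e = 2) \<and> (\<forall>t\<in>F. t \<subseteq> V \<and> card t = 3) \<and>
    (\<forall>t\<in>F. \<forall>x\<in>t. \<forall>y\<in>t. x \<noteq> y \<longrightarrow> {x, y} \<in> E)"
  using assms
proof induction
  case (K4 V)
  then have "finite V" by (metis card.infinite zero_neq_numeral)
  then show ?case using K4 by (auto simp: card_insert_if)
next
  case (stack V E F x u v w)
  then have uvw: "{u, v, w} \<subseteq> V" "{u, v} \<in> E" "{v, w} \<in> E" "{u, w} \<in> E" by auto
  let ?E = "E \<union> {{x, u}, {x, v}, {x, w}}" and ?F = "F - {{u, v, w}} \<union> {{x, u, v}, {x, v, w}, {x, u, w}}"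
  have "card (insert x V) = Suc (card V)" using stack by simp
  have edges: "\<forall>e\<in>?E. e \<subseteq> insert x V \<and> card e = 2"
    using stack uvw by (auto simp: card_insert_if)
  have faces: "\<forall>t\<in>?F. t \<subseteq> insert x V \<and> card t = 3"
    using stack uvw by (auto simp: card_insert_if)
  have pairs: "{p, q} \<in> ?E"
    if t: "t \<in> ?F" and pq: "p \<in> t" "q \<in> t" "p \<noteq> q"
    for t p q
  proof -
    define D where "D = ?E"
    have D: "{x, u} \<in> D" "{x, v} \<in> D" "{x, w} \<in> D" "{u, v} \<in> D" "{v, w} \<in> D" "{u, w} \<in> D"
      using uvw by (simp_all add: D_def)
    then have "{u, x} \<in> D" "{v, x} \<in> D" "{w, x} \<in> D" "{v, u} \<in> D" "{w, v} \<in> D" "{w, u} \<in> D"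
      by (simp_all add: insert_commute)
    note D = D this
    have "t \<in> F \<or> t = {x, u, v} \<or> t = {x, v, w} \<or> t = {x, u, w}" using t by blast
    then have "{p, q} \<in> D"
    proof (elim disjE)
      assume "t \<in> F"
      then show ?thesis using stack.IH pq by (simp add: D_def)
    qed (use D pq in auto)
    then show ?thesis by (simp add: D_def)
  qed
  show ?case
  proof (intro conjI)
    show "finite (insert x V)" "4 \<le> card (insert x V)"
      using stack.IH \<open>card (insert x V) = Suc (card V)\<close> by simp_all
  qed (rule edges, rule faces, intro ballI impI, rule pairs)
qed

lemma cyclic_edges_triangle: "cyclic_edges [b, c, d] = {{b, c}, {c, d}, {d, b}}"
proof -
  have "{..<3::nat} = {0, 1, 2}" by auto
  moreover have "length [b, c, d] = 3" "Suc 0 mod 3 = (1::nat)" "Suc 1 mod 3 = (2::nat)" "Suc 2 mod 3 = (0::nat)"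
    by simp_all
  moreover have "[b, c, d] ! 0 = b" "[b, c, d] ! 1 = c" "[b, c, d] ! 2 = d" by simp_all
  ultimately show ?thesis unfolding cyclic_edges_def cyclic_edge_def by (simp only: image_insert image_empty)
qed

lemma faces_at:
  "{t \<in> F - {T} \<union> {A, B, C}. a \<in> t} = {t \<in> F. a \<in> t} - {T} \<union> {t \<in> {A, B, C}. a \<in> t}"
  by blast

text \<open>Stacking onto the face \<open>{a, b, c}\<close> subdivides the edge
  \<open>{b, c}\<close> of the cycle around \<open>a\<close>.\<close>

lemma stacked_link_step:
  assumes ys: "distinct ys" "3 \<le> length ys" "{t \<in> F. a \<in> t} = insert a ` cyclic_edges ys"
      "{y. {a, y} \<in> E} = set ys"
    and abc: "{a, b, c} \<in> F" "distinct [a, b, c]" and aa: "{a} \<notin> E" and x: "{a, x} \<notin> E" "x \<noteq> a"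
    and F': "F' = F - {{a, b, c}} \<union> {{x, a, b}, {x, b, c}, {x, a, c}}"
    and E': "E' = E \<union> {{x, a}, {x, b}, {x, c}}"
  obtains ys' where "distinct ys'" "3 \<le> length ys'" "{t \<in> F'. a \<in> t} = insert a ` cyclic_edges ys'"
      "{y. {a, y} \<in> E'} = set ys'"
proof -
  have xys: "x \<notin> set ys" "a \<notin> set ys"
  proof -
    have "y \<in> set ys \<longleftrightarrow> {a, y} \<in> E" for y using ys(4) by blast
    then show "x \<notin> set ys" "a \<notin> set ys" using aa x(1) by simp_all
  qed
  have sub: "e \<subseteq> set ys" if "e \<in> cyclic_edges ys" for e
    using that ys(2) by (auto simp: cyclic_edges_def cyclic_edge_def intro!: nth_mem mod_less_divisor)
  have "{a, b, c} \<in> insert a ` cyclic_edges ys" using abc ys(3) by blast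
  then obtain e where e: "e \<in> cyclic_edges ys" "{a, b, c} = insert a e" by auto
  have "a \<notin> e" using sub[OF e(1)] xys by blast
  then have "e = {b, c}" using e(2) abc(2) by auto
  then have bc: "{b, c} \<in> cyclic_edges ys" using e by simp
  obtain ys' where ys': "distinct ys'" "length ys' = Suc (length ys)" "set ys' = insert x (set ys)"
    "cyclic_edges ys' = cyclic_edges ys - {{b, c}} \<union> {{b, x}, {x, c}}"
    using cyclic_edges_insert[OF ys(1,2) bc xys(1)] .
  have "insert a ` (cyclic_edges ys - {{b, c}}) = insert a ` cyclic_edges ys - {{a, b, c}}"
  proof -
    have "inj_on (insert a) (cyclic_edges ys)"
    proof (rule inj_onI)
      fix d e assume "d \<in> cyclic_edges ys" "e \<in> cyclic_edges ys" "insert a d = insert a e"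
      moreover have "a \<notin> d" "a \<notin> e" using sub xys calculation by blast+
      ultimately show "d = e" by (simp add: insert_ident)
    qed
    then show ?thesis by (subst inj_on_image_set_diff) (use bc in auto)
  qed
  then have "insert a ` cyclic_edges ys' = {t \<in> F. a \<in> t} - {{a, b, c}} \<union> {{a, b, x}, {a, x, c}}"
    unfolding ys'(4) image_Un ys(3) by simp
  also have "\<dots> = {t \<in> F'. a \<in> t}"
  proof -
    have "{t \<in> {A, B, C}. a \<in> t} = {A, C}" if "a \<in> A" "a \<notin> B" "a \<in> C" for A B C
      using that by blast
    then have "{t \<in> {{x, a, b}, {x, b, c}, {x, a, c}}. a \<in> t} = {{x, a, b}, {x, a, c}}"
      using abc(2) x by simp
    moreover have "{x, a, b} = {a, b, x}" "{x, a, c} = {a, x, c}" by blast+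
    ultimately show ?thesis unfolding F' faces_at by simp
  qed
  finally have "{t \<in> F'. a \<in> t} = insert a ` cyclic_edges ys'" by (rule sym)
  moreover have "{a, y} \<in> E' \<longleftrightarrow> y = x \<or> {a, y} \<in> E" for y
    unfolding E' using x abc by (auto simp: doubleton_eq_iff)
  then have "{y. {a, y} \<in> E'} = set ys'"
    unfolding ys'(3) ys(4)[symmetric] by blast
  ultimately show ?thesis using that[of ys'] ys' ys(2) by simp
qed

text \<open>A stacking subdivides the cycle around a vertex, leaves it alone, or starts a new one of
  length three around \<open>x\<close>. This cycle will order the polygon of \<open>a\<close>: its
  edges become the corners and its entries the sides.\<close>

lemma stacked_link:
  assumes "stacked V E F" "a \<in> V"
  shows "\<exists>ys. distinct ys \<and> 3 \<le> length ys \<and> {t \<in> F. a \<in> t} = insert a ` cyclic_edges ys \<and>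
    {y. {a, y} \<in> E} = set ys"
  using assms
proof (induction arbitrary: a)
  case (K4 V)
  let ?E = "{{u, v} | u v. u \<in> V \<and> v \<in> V \<and> u \<noteq> v}" and ?F = "{T. T \<subseteq> V \<and> card T = 3}"
  have "finite V" using K4(1) by (metis card.infinite zero_neq_numeral)
  then have "card (V - {a}) = 3" using K4 by simp
  then obtain b c d where bcd: "V - {a} = {b, c, d}" "distinct [b, c, d]"
    by (auto simp: card_3_iff)
  then have V: "V = {a, b, c, d}" "a \<noteq> b" "a \<noteq> c" "a \<noteq> d" using K4(2) by auto
  note E = cyclic_edges_triangle[of b c d]
  have "{t \<in> ?F. a \<in> t} = insert a ` cyclic_edges [b, c, d]"
  proof (intro subset_antisym subsetI)
    fix t assume t: "t \<in> {t \<in> ?F. a \<in> t}"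
    then have "finite t" "card t = 3" by (auto intro: card_ge_0_finite)
    then have "card (t - {a}) = 2" using t by simp
    moreover have "t - {a} \<subseteq> {b, c, d}" using t V by auto
    ultimately obtain p q where pq: "t - {a} = {p, q}" "p \<noteq> q" "p \<in> {b, c, d}" "q \<in> {b, c, d}"
      by (metis card_2_iff insert_subset)
    then have "t - {a} \<in> {{b, c}, {c, d}, {d, b}}"
      unfolding pq(1) using pq(2-4) by (elim insertE emptyE) (simp_all add: insert_commute)
    moreover have "t = insert a (t - {a})" using t by blast
    ultimately show "t \<in> insert a ` cyclic_edges [b, c, d]" unfolding E by (metis imageI)
  next
    fix t assume "t \<in> insert a ` cyclic_edges [b, c, d]"
    then show "t \<in> {t \<in> ?F. a \<in> t}" unfolding E using V bcd by auto
  qed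
  moreover have "{y. {a, y} \<in> ?E} = set [b, c, d]" using V by (auto simp: doubleton_eq_iff)
  ultimately show ?case using bcd by (intro exI[of _ "[b, c, d]"]) simp
next
  case (stack V E F x u v w)
  note wf = stacked_wf[OF stack.hyps(1)]
  have EV: "e \<subseteq> V" "card e = 2" if "e \<in> E" for e using wf that by simp_all
  have FV: "t \<subseteq> V" if "t \<in> F" for t using wf that by simp
  have xE: "{x, y} \<notin> E" "{y, x} \<notin> E" for y using EV(1) stack.hyps(2) by blast+
  have pp: "{p} \<notin> E" for p using EV(2)[of "{p}"] by auto
  have uvw: "{u, v, w} \<subseteq> V" using FV stack.hyps by blast
  let ?E = "E \<union> {{x, u}, {x, v}, {x, w}}" and ?F = "F - {{u, v, w}} \<union> {{x, u, v}, {x, v, w}, {x, u, w}}"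
  have step: ?case if abc: "{a, b, c} = {u, v, w}" "distinct [a, b, c]" for b c
  proof -
    have "a \<in> V" "a \<noteq> x" using uvw that stack.hyps(2) by blast+
    then obtain ys where ys: "distinct ys" "3 \<le> length ys" "{t \<in> F. a \<in> t} = insert a ` cyclic_edges ys"
      "{y. {a, y} \<in> E} = set ys" using stack.IH by blast
    \<comment> \<open>Written as images of the set \<open>{u, v, w}\<close>, the new edges and faces
      visibly depend on this set alone, whichever of its elements is \<open>a\<close>.\<close>
    have E: "?E = E \<union> {{x, a}, {x, b}, {x, c}}"
    proof -
      have "(\<lambda>z. {x, z}) ` {u, v, w} = (\<lambda>z. {x, z}) ` {a, b, c}" using that by simp
      then show ?thesis by simp
    qed
    have F: "?F = F - {{a, b, c}} \<union> {{x, a, b}, {x, b, c}, {x, a, c}}"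
    proof -
      have "(\<lambda>z. insert x ({u, v, w} - {z})) ` {u, v, w} = (\<lambda>z. insert x ({a, b, c} - {z})) ` {a, b, c}"
        using that by simp
      moreover have "(\<lambda>z. insert x ({u, v, w} - {z})) ` {u, v, w} = {{x, u, v}, {x, v, w}, {x, u, w}}"
        using stack.hyps(3) by (auto simp: insert_Diff_if)
      moreover have "(\<lambda>z. insert x ({a, b, c} - {z})) ` {a, b, c} = {{x, a, b}, {x, b, c}, {x, a, c}}"
        using that(2) by (auto simp: insert_Diff_if)
      ultimately show ?thesis using that(1) by simp
    qed
    have "{a, b, c} \<in> F" using that stack.hyps by simp
    obtain ys' where "distinct ys'" "3 \<le> length ys'" "{t \<in> ?F. a \<in> t} = insert a ` cyclic_edges ys'"
      "{y. {a, y} \<in> ?E} = set ys'"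
      using stacked_link_step[OF ys \<open>{a, b, c} \<in> F\<close> abc(2) pp xE(2) \<open>a \<noteq> x\<close>[symmetric] F E] .
    then show ?thesis by (intro exI[of _ ys'] conjI)
  qed
  consider "a = x" | "a = u" | "a = v" | "a = w" | "a \<in> V" "a \<notin> {u, v, w}" "a \<noteq> x"
    using stack.prems stack.hyps(2) by blast
  then show ?case
  proof cases
    case 1
    have xF: "x \<notin> t" if "t \<in> F" for t using FV[OF that] stack.hyps(2) by blast
    note E = cyclic_edges_triangle[of u v w]
    have "{t \<in> ?F. x \<in> t} = insert x ` cyclic_edges [u, v, w]"
    proof -
      have 1: "{t \<in> F. x \<in> t} = {}" using xF by blast
      have 2: "{t \<in> {{x, u, v}, {x, v, w}, {x, u, w}}. x \<in> t} = {{x, u, v}, {x, v, w}, {x, u, w}}"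
        by blast
      have 3: "{w, u} = {u, w}" by blast
      show ?thesis unfolding faces_at 1 2 E 3 by simp
    qed
    moreover have "{y. {x, y} \<in> ?E} = set [u, v, w]" using xE by (auto simp: doubleton_eq_iff)
    ultimately show ?thesis using 1 stack.hyps(3) by (intro exI[of _ "[u, v, w]"]) simp
  next
    case 2 then show ?thesis by (intro step[of v w]) (use stack.hyps(3) in \<open>auto simp: insert_commute\<close>)
  next
    case 3 then show ?thesis by (intro step[of u w]) (use stack.hyps(3) in \<open>auto simp: insert_commute\<close>)
  next
    case 4 then show ?thesis by (intro step[of u v]) (use stack.hyps(3) in \<open>auto simp: insert_commute\<close>)
  next
    case 5
    have "{t \<in> {A, B, C}. a \<in> t} = {}" if "a \<notin> A" "a \<notin> B" "a \<notin> C" for A B C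
      using that by blast
    then have new: "{t \<in> {{x, u, v}, {x, v, w}, {x, u, w}}. a \<in> t} = {}" using 5 by simp
    have "{u, v, w} \<notin> {t \<in> F. a \<in> t}" using 5 by blast
    then have "{t \<in> ?F. a \<in> t} = {t \<in> F. a \<in> t}" unfolding faces_at new by simp
    moreover have "{y. {a, y} \<in> ?E} = {y. {a, y} \<in> E}" using 5 by (auto simp: doubleton_eq_iff)
    ultimately show ?thesis using stack.IH[OF 5(1)] by simp
  qed
qed

lemma stacked_link_obtain:
  assumes "stacked V E F" "a \<in> V"
  obtains ys where "distinct ys" "3 \<le> length ys" "{t \<in> F. a \<in> t} = insert a ` cyclic_edges ys"
    "{y. {a, y} \<in> E} = set ys" "a \<notin> set ys"
proof -
  obtain ys where ys: "distinct ys" "3 \<le> length ys" "{t \<in> F. a \<in> t} = insert a ` cyclic_edges ys"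
    "{y. {a, y} \<in> E} = set ys" using stacked_link[OF assms] by blast
  have "{a} \<notin> E" using stacked_wf[OF assms(1)] by fastforce
  then have "a \<notin> set ys" using ys(4) by (metis insert_absorb2 mem_Collect_eq)
  then show ?thesis using that ys by blast
qed

lemma faces_at_edge:
  assumes ys: "distinct ys" "3 \<le> length ys" "{t \<in> F. a \<in> t} = insert a ` cyclic_edges ys" "a \<notin> set ys"
    and i: "i < length ys"
  shows "{t \<in> F. a \<in> t \<and> ys ! (Suc i mod length ys) \<in> t} =
      {insert a (cyclic_edge ys i), insert a (cyclic_edge ys (Suc i mod length ys))}"
    and "insert a (cyclic_edge ys i) \<noteq> insert a (cyclic_edge ys (Suc i mod length ys))"
proof -
  let ?b = "ys ! (Suc i mod length ys)"
  have "?b \<noteq> a" using ys(4) Suc_mod_less[OF i] nth_mem by metis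
  have "{t \<in> F. a \<in> t \<and> ?b \<in> t} = {t \<in> {t \<in> F. a \<in> t}. ?b \<in> t}" by blast
  also have "\<dots> = insert a ` {e \<in> cyclic_edges ys. ?b \<in> e}" unfolding ys(3) using \<open>?b \<noteq> a\<close> by auto
  finally show "{t \<in> F. a \<in> t \<and> ?b \<in> t} =
      {insert a (cyclic_edge ys i), insert a (cyclic_edge ys (Suc i mod length ys))}"
    unfolding cyclic_edges_at(1)[OF ys(1,2) i] by simp
  have "a \<notin> cyclic_edge ys i" "a \<notin> cyclic_edge ys (Suc i mod length ys)"
    using ys(4) cyclic_edge_subset[OF i] cyclic_edge_subset[OF Suc_mod_less[OF i]] by blast+
  then show "insert a (cyclic_edge ys i) \<noteq> insert a (cyclic_edge ys (Suc i mod length ys))"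
    using cyclic_edges_at(2)[OF ys(1,2) i] by (simp add: insert_ident)
qed

lemma stackedD:
  assumes "stacked V E F"
  shows "finite V" "4 \<le> card V" "\<And>e. e \<in> E \<Longrightarrow> e \<subseteq> V" "\<And>e. e \<in> E \<Longrightarrow> card e = 2"
    "\<And>t. t \<in> F \<Longrightarrow> t \<subseteq> V" "\<And>t. t \<in> F \<Longrightarrow> card t = 3"
    "\<And>t x y. t \<in> F \<Longrightarrow> x \<in> t \<Longrightarrow> y \<in> t \<Longrightarrow> x \<noteq> y \<Longrightarrow> {x, y} \<in> E"
  using stacked_wf[OF assms] by simp_all

lemma stacked_finite_faces: "stacked V E F \<Longrightarrow> finite F"
  by (rule finite_subset[of _ "Pow V"]) (auto dest: stackedD(5) simp: stackedD(1))

text \<open>In the cycle around \<open>a\<close>, the neighbour \<open>b\<close> is an entry and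
  lies on exactly two edges.\<close>

lemma stacked_edge_faces:
  assumes S: "stacked V E F" and ab: "{a, b} \<in> E"
  obtains t1 t2 where "t1 \<noteq> t2" "{t \<in> F. a \<in> t \<and> b \<in> t} = {t1, t2}"
proof -
  have "a \<in> V" using stackedD(3)[OF S ab] by simp
  then obtain ys where ys: "distinct ys" "3 \<le> length ys" "{t \<in> F. a \<in> t} = insert a ` cyclic_edges ys"
    "{y. {a, y} \<in> E} = set ys" "a \<notin> set ys" by (rule stacked_link_obtain[OF S])
  have "b \<in> set ys" using ab ys(4) by blast
  then obtain i where i: "i < length ys" "b = ys ! (Suc i mod length ys)"
    by (metis in_set_conv_nth Suc_mod_surj)
  show ?thesis
    by (rule that[OF faces_at_edge(2,1)[OF ys(1-3,5) i(1), folded i(2)]])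
qed

text \<open>If all faces at \<open>a\<close> contained \<open>b\<close>, then \<open>a\<close> and
  \<open>b\<close> would be adjacent and share only two faces, while at least three faces meet at
  \<open>a\<close>. This supplies the strict inequalities later on: a corner on the facet of
  \<open>a\<close> but off the facet of \<open>b\<close>.\<close>

lemma stacked_face_avoiding:
  assumes S: "stacked V E F" and a: "a \<in> V" and "b \<noteq> a"
  obtains t where "t \<in> F" "a \<in> t" "b \<notin> t"
proof (rule ccontr)
  assume "\<not> thesis"
  then have all: "b \<in> t" if "t \<in> F" "a \<in> t" for t using that \<open>\<And>t. \<lbrakk>t \<in> F; a \<in> t; b \<notin> t\<rbrakk> \<Longrightarrow> thesis\<close> by blast
  obtain ys where ys: "distinct ys" "3 \<le> length ys" "{t \<in> F. a \<in> t} = insert a ` cyclic_edges ys"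
    "{y. {a, y} \<in> E} = set ys" "a \<notin> set ys" by (rule stacked_link_obtain[OF S a])
  have "inj_on (\<lambda>i. insert a (cyclic_edge ys i)) {..<length ys}"
  proof (rule inj_onI)
    fix i j assume ij: "i \<in> {..<length ys}" "j \<in> {..<length ys}"
      and eq: "insert a (cyclic_edge ys i) = insert a (cyclic_edge ys j)"
    have "a \<notin> cyclic_edge ys i" "a \<notin> cyclic_edge ys j" using ys(5) cyclic_edge_subset ij by blast+
    then show "i = j" using eq cyclic_edge_inj[OF ys(1,2)] ij by (auto simp: insert_ident inj_on_def)
  qed
  then have card: "card {t \<in> F. a \<in> t} = length ys"
    unfolding ys(3) cyclic_edges_def image_image by (simp add: card_image)
  then have "{t \<in> F. a \<in> t} \<noteq> {}" using ys(2) by (metis card.empty not_numeral_le_zero)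
  then obtain t where t: "t \<in> F" "a \<in> t" by blast
  then have "{a, b} \<in> E" using all stackedD(7)[OF S t(1)] \<open>b \<noteq> a\<close> by metis
  then obtain t1 t2 where "t1 \<noteq> t2" "{t \<in> F. a \<in> t \<and> b \<in> t} = {t1, t2}"
    by (rule stacked_edge_faces[OF S])
  moreover have "{t \<in> F. a \<in> t \<and> b \<in> t} = {t \<in> F. a \<in> t}" using all by blast
  ultimately have "card {t \<in> F. a \<in> t} = 2" by simp
  then show False using card ys(2) by simp
qed

subsection \<open>Stacked graphs as duals of simple polytopes\<close>

text \<open>An affine function is stored as a pair of gradient and constant, so that affine
  functions form a Euclidean space of one dimension more and can be added, scaled and tested for
  linear dependence.\<close>

definition affval :: "'b::euclidean_space \<times> real \<Rightarrow> 'b \<Rightarrow> real" where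
  "affval f x = fst f \<bullet> x + snd f"

lemma affval_add: "affval (f + g) x = affval f x + affval g x"
  and affval_scaleR: "affval (c *\<^sub>R f) x = c * affval f x"
  and affval_zero: "affval 0 x = 0"
  by (simp_all add: affval_def inner_add_left distrib_left)

lemma affval_convex:
  assumes "u + v = 1"
  shows "affval f (u *\<^sub>R x + v *\<^sub>R y) = u * affval f x + v * affval f y"
proof -
  have "snd f = u * snd f + v * snd f" using assms by (metis distrib_right mult_1)
  then show ?thesis by (simp add: affval_def inner_add_right algebra_simps)
qed

text \<open>\<open>N y\<close> vanishes on the facet of \<open>y\<close> and is positive on the rest
  of the polytope, and \<open>p t\<close> is the corner where the three facets of the face
  \<open>t\<close> meet. Only these incidences are recorded; the realisation and the drawing are
  both built from them, without the polytope as a set.\<close>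

definition simple_polytope :: "'a set \<Rightarrow> 'a set set \<Rightarrow> ('a \<Rightarrow> (real^3) \<times> real) \<Rightarrow> ('a set \<Rightarrow> real^3) \<Rightarrow> bool" where
  "simple_polytope V F N p \<longleftrightarrow>
     (\<forall>t\<in>F. \<forall>y\<in>V. affval (N y) (p t) \<ge> 0 \<and> (affval (N y) (p t) = 0 \<longleftrightarrow> y \<in> t))"

lemma simple_polytope_tetrahedron:
  assumes "card V = 4"
  shows "\<exists>N p. simple_polytope V {T. T \<subseteq> V \<and> card T = 3} N p"
proof -
  let ?F = "{T. T \<subseteq> V \<and> card T = 3}"
  have fin: "finite V" using assms by (metis card.infinite zero_neq_numeral)
  obtain a where "a \<in> V" using assms by fastforce
  then have "card (V - {a}) = 3" using assms fin by simp
  then obtain b c d where bcd: "V - {a} = {b, c, d}" "distinct [b, c, d]"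
    by (auto simp: card_3_iff)
  then have V: "V = {a, b, c, d}" "distinct [a, b, c, d]" using \<open>a \<in> V\<close> by auto
  \<comment> \<open>\<open>(- 1, 1)\<close> is one minus the sum of the coordinates and the other
    three are the coordinates themselves, which gives the facets of the standard simplex.
    \<open>q y\<close> is the corner opposite to the facet of \<open>y\<close>.\<close>
  define N :: "'a \<Rightarrow> (real^3) \<times> real" where
    "N y = (if y = a then (- 1, 1) else if y = b then (axis 1 1, 0) else if y = c then (axis 2 1, 0) else (axis 3 1, 0))" for y
  define q :: "'a \<Rightarrow> real^3" where
    "q y = (if y = a then 0 else if y = b then axis 1 1 else if y = c then axis 2 1 else axis 3 1)" for y
  have Nq: "affval (N y) (q z) = (if y = z then 1 else 0)" if "y \<in> V" "z \<in> V" for y z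
  proof -
    have "(- 1 :: real^3) \<bullet> axis k 1 = -1" for k by (simp add: inner_axis)
    moreover have "(axis i 1 :: real^3) \<bullet> axis j 1 = (if i = j then 1 else 0)" for i j
      by (simp add: inner_axis_axis)
    ultimately show ?thesis using that V by (auto simp: affval_def N_def q_def)
  qed
  \<comment> \<open>A face \<open>t\<close> misses exactly one vertex, and its corner is opposite to
    the facet of that vertex.\<close>
  define p where "p t = q (SOME z. z \<in> V \<and> z \<notin> t)" for t
  have "affval (N y) (p t) \<ge> 0 \<and> (affval (N y) (p t) = 0 \<longleftrightarrow> y \<in> t)" if t: "t \<in> ?F" and y: "y \<in> V" for t y
  proof -
    have "card (V - t) = 1" using t assms fin card_Diff_subset[of t V] finite_subset[of t V] by simp
    then obtain z where z: "V - t = {z}" by (auto simp: card_1_singleton_iff)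
    then have "(SOME z. z \<in> V \<and> z \<notin> t) = z" by (intro some_equality) auto
    then have "p t = q z" by (simp add: p_def)
    moreover have "y = z \<longleftrightarrow> y \<notin> t" "z \<in> V" using z y by blast+
    ultimately show ?thesis using Nq[OF y, of z] by auto
  qed
  then show ?thesis unfolding simple_polytope_def by blast
qed

text \<open>The faces of the graph index the corners of the polytope, so stacking a vertex onto a face
  truncates the corresponding corner.\<close>

lemma simple_polytope_truncate:
  assumes P: "simple_polytope V F N p" and "finite V" and x: "x \<notin> V" and d: "distinct [u, v, w]"
    and T: "{u, v, w} \<in> F"
    and F: "finite F" "\<And>t. t \<in> F \<Longrightarrow> t \<subseteq> V \<and> card t = 3"
    and nb: "\<And>e. e \<subseteq> {u, v, w} \<Longrightarrow> card e = 2 \<Longrightarrow> \<exists>t\<in>F. t \<noteq> {u, v, w} \<and> e \<subseteq> t"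
  shows "\<exists>N p. simple_polytope (insert x V) (F - {{u, v, w}} \<union> {{x, u, v}, {x, v, w}, {x, u, w}}) N p"
proof -
  let ?T = "{u, v, w}"
  have P0: "affval (N y) (p t) \<ge> 0" and P1: "affval (N y) (p t) = 0 \<longleftrightarrow> y \<in> t" if "t \<in> F" "y \<in> V" for t y
    using P that by (auto simp: simple_polytope_def)
  have uvw: "u \<in> V" "v \<in> V" "w \<in> V" using F(2)[OF T] by auto
  \<comment> \<open>\<open>G\<close> vanishes at the corner to be cut off and is positive at all
    others, so a small level \<open>e\<close> of \<open>G\<close> separates it from them.\<close>
  define G where "G = N u + N v + N w"
  have G: "affval G z = affval (N u) z + affval (N v) z + affval (N w) z" for z
    by (simp add: G_def affval_add)
  have GT: "affval G (p ?T) = 0" using P1[OF T uvw(1)] P1[OF T uvw(2)] P1[OF T uvw(3)] by (simp add: G)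
  have Gpos: "affval G (p t) > 0" if t: "t \<in> F" "t \<noteq> ?T" for t
  proof -
    have "\<not> ?T \<subseteq> t"
    proof
      assume "?T \<subseteq> t"
      moreover have "finite t" "card t = card ?T" using F(2)[OF t(1)] F(2)[OF T] by (auto intro: card_ge_0_finite)
      ultimately show False using t(2) card_subset_eq by metis
    qed
    then have "\<not> (affval (N u) (p t) = 0 \<and> affval (N v) (p t) = 0 \<and> affval (N w) (p t) = 0)"
      using P1[OF t(1)] uvw by auto
    then show ?thesis using P0[OF t(1) uvw(1)] P0[OF t(1) uvw(2)] P0[OF t(1) uvw(3)] by (auto simp: G)
  qed
  obtain e where e: "e > 0" "\<And>t. t \<in> F \<Longrightarrow> t \<noteq> ?T \<Longrightarrow> e < affval G (p t)"
  proof -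
    let ?A = "insert 1 ((\<lambda>t. affval G (p t)) ` (F - {?T}))"
    have fin: "finite ?A" "?A \<noteq> {}" using F(1) by auto
    have "\<forall>r\<in>?A. r > 0" using Gpos by auto
    then have "Min ?A > 0" using fin by simp
    moreover have "Min ?A \<le> affval G (p t)" if "t \<in> F" "t \<noteq> ?T" for t
      using fin(1) that by (intro Min_le) auto
    ultimately show ?thesis using that[of "Min ?A / 2"] by fastforce
  qed
  define Nx where "Nx = G - (0, e)"
  have Nx: "affval Nx z = affval G z - e" for z by (simp add: Nx_def affval_def algebra_simps)
  define N' where "N' = N(x := Nx)"
  have N': "N' x = Nx" "\<And>y. y \<in> V \<Longrightarrow> N' y = N y" using x by (auto simp: N'_def)
  have new: "\<exists>z. \<forall>y\<in>insert x V. affval (N' y) z \<ge> 0 \<and> (affval (N' y) z = 0 \<longleftrightarrow> y \<in> insert x d)"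
    if d: "d \<subseteq> ?T" "card d = 2" for d
  proof -
    obtain t where t: "t \<in> F" "t \<noteq> ?T" "d \<subseteq> t" using nb[OF d] by blast
    \<comment> \<open>The new corner divides the old edge from \<open>p ?T\<close> to
      \<open>p t\<close> where \<open>G\<close> reaches the level \<open>e\<close>.\<close>
    define s where "s = e / affval G (p t)"
    have s: "0 < s" "s < 1" "s * affval G (p t) = e" using e(1) e(2)[OF t(1,2)] by (auto simp: s_def)
    define z where "z = (1 - s) *\<^sub>R p ?T + s *\<^sub>R p t"
    have z: "affval f z = (1 - s) * affval f (p ?T) + s * affval f (p t)" for f
      unfolding z_def by (rule affval_convex) simp
    have "affval (N' x) z = 0" using GT s by (simp add: N' Nx z algebra_simps)
    moreover have "affval (N y) z \<ge> 0 \<and> (affval (N y) z = 0 \<longleftrightarrow> y \<in> d)" if y: "y \<in> V" for y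
    proof -
      \<comment> \<open>Two different faces share at most two vertices, so \<open>t\<close> meets
        \<open>?T\<close> in \<open>d\<close> only.\<close>
      have "y \<in> d \<longleftrightarrow> y \<in> ?T \<and> y \<in> t"
      proof -
        have ft: "finite t" "card t = 3" using F(2)[OF t(1)] by (auto intro: card_ge_0_finite)
        have "card (?T \<inter> t) \<noteq> 3"
        proof
          assume c: "card (?T \<inter> t) = 3"
          have "?T \<inter> t = t" by (rule card_subset_eq) (use ft c in auto)
          moreover have "?T \<inter> t = ?T" by (rule card_subset_eq) (use c F(2)[OF T] in auto)
          ultimately show False using t(2) by simp
        qed
        moreover have "card (?T \<inter> t) \<le> 3" using card_mono[OF ft(1), of "?T \<inter> t"] ft by auto
        ultimately have "card (?T \<inter> t) \<le> card d" using d by simp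
        then have "d = ?T \<inter> t" by (intro card_seteq) (use d t in auto)
        then show ?thesis by blast
      qed
      moreover have "(1 - s) * affval (N y) (p ?T) \<ge> 0" "s * affval (N y) (p t) \<ge> 0"
        "(1 - s) * affval (N y) (p ?T) = 0 \<longleftrightarrow> y \<in> ?T" "s * affval (N y) (p t) = 0 \<longleftrightarrow> y \<in> t"
        using s P0[OF T y] P0[OF t(1) y] P1[OF T y] P1[OF t(1) y] by auto
      ultimately show ?thesis unfolding z by linarith
    qed
    ultimately show ?thesis using x d(1) uvw by (intro exI[of _ z]) (auto simp: N')
  qed
  then obtain q where q: "\<And>d y. d \<subseteq> ?T \<Longrightarrow> card d = 2 \<Longrightarrow> y \<in> insert x V \<Longrightarrow>
      affval (N' y) (q d) \<ge> 0 \<and> (affval (N' y) (q d) = 0 \<longleftrightarrow> y \<in> insert x d)"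
    by metis
  define p' where "p' t = (if x \<in> t then q (t - {x}) else p t)" for t
  have "affval (N' y) (p' t) \<ge> 0 \<and> (affval (N' y) (p' t) = 0 \<longleftrightarrow> y \<in> t)"
    if t: "t \<in> F - {?T} \<union> {{x, u, v}, {x, v, w}, {x, u, w}}" and y: "y \<in> insert x V" for t y
  proof (cases "t \<in> F - {?T}")
    case True
    then have xt: "x \<notin> t" using F(2) x by blast
    then have "p' t = p t" by (simp add: p'_def)
    moreover have "affval Nx (p t) > 0" using e(2)[of t] True by (simp add: Nx)
    ultimately show ?thesis using y True P0[of t y] P1[of t y] xt by (auto simp: N')
  next
    case False
    then have "t \<in> {{x, u, v}, {x, v, w}, {x, u, w}}" using t by (simp only: Un_iff simp_thms)
    then have "t \<in> insert x ` {{u, v}, {v, w}, {u, w}}" by simp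
    then obtain d where td: "t = insert x d" "d = {u, v} \<or> d = {v, w} \<or> d = {u, w}" by blast
    moreover have "card {u, v} = 2" "card {v, w} = 2" "card {u, w} = 2"
      using \<open>distinct [u, v, w]\<close> by simp_all
    moreover have "x \<notin> ?T" using x uvw by auto
    ultimately have d: "t = insert x d" "d \<subseteq> ?T" "card d = 2" "x \<notin> d" by auto
    then have "p' t = q d" by (simp add: p'_def)
    then show ?thesis using q[OF d(2,3) y] d(1) by simp
  qed
  then show ?thesis unfolding simple_polytope_def by blast
qed

lemma stacked_simple_polytope:
  assumes "stacked V E F"
  shows "\<exists>N p. simple_polytope V F N p"
  using assms
proof induction
  case (K4 V)
  then show ?case by (rule simple_polytope_tetrahedron)
next
  case (stack V E F x u v w)
  note wf = stackedD[OF stack.hyps(1)]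
  obtain N p where P: "simple_polytope V F N p" using stack.IH by blast
  show ?case
  proof (rule simple_polytope_truncate[OF P _ stack.hyps(2-4)])
    show "finite V" "finite F" by (rule wf(1) stacked_finite_faces stack.hyps)+
    show "t \<subseteq> V \<and> card t = 3" if "t \<in> F" for t using wf(5,6)[OF that] ..
    fix e assume e: "e \<subseteq> {u, v, w}" "card e = 2"
    then obtain a b where ab: "e = {a, b}" "a \<noteq> b" by (auto simp: card_2_iff)
    have abT: "a \<in> {u, v, w}" "b \<in> {u, v, w}" using e(1) ab(1) by auto
    have "{a, b} \<in> E" by (rule wf(7)[OF stack.hyps(4) abT ab(2)])
    then obtain t1 t2 where f: "t1 \<noteq> t2" "{t \<in> F. a \<in> t \<and> b \<in> t} = {t1, t2}"
      by (rule stacked_edge_faces[OF stack.hyps(1)])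
    have mem: "{t1, t2} \<subseteq> {t \<in> F. a \<in> t \<and> b \<in> t}" unfolding f(2) by (rule subset_refl)
    show "\<exists>t\<in>F. t \<noteq> {u, v, w} \<and> e \<subseteq> t"
    proof (cases "t1 = {u, v, w}")
      case True
      then show ?thesis using mem f(1) ab(1) by (intro bexI[of _ t2]) simp_all
    next
      case False
      then show ?thesis using mem ab(1) by (intro bexI[of _ t1]) simp_all
    qed
  qed
qed

section \<open>Zero sets and half-spaces of affine functions\<close>

lemma affine_affval_zero: "affine {x. affval f x = 0}"
proof -
  have "{x. affval f x = 0} = {x. fst f \<bullet> x = - snd f}" by (auto simp: affval_def)
  then show ?thesis by (simp add: affine_hyperplane)
qed

lemma convex_affval_nonneg: "convex {x. affval f x \<ge> 0}"
proof -
  have "{x. affval f x \<ge> 0} = {x. fst f \<bullet> x \<ge> - snd f}" by (auto simp: affval_def)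
  then show ?thesis by (simp add: convex_halfspace_ge)
qed

lemma open_affval_pos: "open {x. affval f x > 0}" and open_affval_neg: "open {x. affval f x < 0}"
proof -
  have "{x. affval f x > 0} = {x. fst f \<bullet> x > - snd f}" "{x. affval f x < 0} = {x. fst f \<bullet> x < - snd f}"
    by (auto simp: affval_def)
  then show "open {x. affval f x > 0}" "open {x. affval f x < 0}"
    by (simp_all add: open_halfspace_gt open_halfspace_lt)
qed

lemma affval_zero_affine_hull: "(\<And>x. x \<in> S \<Longrightarrow> affval f x = 0) \<Longrightarrow> x \<in> affine hull S \<Longrightarrow> affval f x = 0"
  using hull_minimal[of S "{x. affval f x = 0}" affine] affine_affval_zero by blast

lemma affval_nonneg_convex_hull: "(\<And>x. x \<in> S \<Longrightarrow> affval f x \<ge> 0) \<Longrightarrow> x \<in> convex hull S \<Longrightarrow> affval f x \<ge> 0"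
  using hull_minimal[of S "{x. affval f x \<ge> 0}" convex] convex_affval_nonneg by blast

text \<open>A convex combination of nonnegative values is zero only if every point with positive
  weight has the value zero.\<close>

lemma convex_hull_face:
  assumes "finite S" "\<And>p. p \<in> S \<Longrightarrow> affval f p \<ge> 0" "x \<in> convex hull S" "affval f x = 0"
  shows "x \<in> convex hull {p \<in> S. affval f p = 0}"
proof -
  obtain u where u: "\<And>p. p \<in> S \<Longrightarrow> 0 \<le> u p" "sum u S = 1" "(\<Sum>p\<in>S. u p *\<^sub>R p) = x"
    using assms(3) unfolding convex_hull_finite[OF assms(1)] by blast
  let ?T = "{p \<in> S. affval f p = 0}"
  have "(\<Sum>p\<in>S. u p * affval f p) = (\<Sum>p\<in>S. fst f \<bullet> (u p *\<^sub>R p)) + (\<Sum>p\<in>S. u p * snd f)"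
    unfolding affval_def by (simp add: distrib_left sum.distrib)
  also have "\<dots> = fst f \<bullet> (\<Sum>p\<in>S. u p *\<^sub>R p) + sum u S * snd f"
    by (simp only: inner_sum_right sum_distrib_right)
  finally have "(\<Sum>p\<in>S. u p * affval f p) = fst f \<bullet> (\<Sum>p\<in>S. u p *\<^sub>R p) + sum u S * snd f" .
  then have "(\<Sum>p\<in>S. u p * affval f p) = 0" using assms(4) u by (simp add: affval_def)
  moreover have "\<And>p. p \<in> S \<Longrightarrow> u p * affval f p \<ge> 0" using u assms by simp
  ultimately have "\<forall>p\<in>S. u p * affval f p = 0" using assms(1) by (subst (asm) sum_nonneg_eq_0_iff) auto
  then have z: "\<forall>p\<in>S - ?T. u p = 0" by auto
  have "sum u ?T = 1" using u(2) z assms(1) by (subst sum.mono_neutral_left[of S]) auto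
  moreover have "(\<Sum>p\<in>?T. u p *\<^sub>R p) = x"
    using u(3) z assms(1) by (subst sum.mono_neutral_left[of S]) auto
  moreover have "finite ?T" using assms(1) by simp
  ultimately show ?thesis unfolding convex_hull_finite[OF \<open>finite ?T\<close>] using u(1) by blast
qed

subsection \<open>Strictly convex polygons\<close>

lemma next_corner_in_set: "i < length P \<Longrightarrow> next_corner P i \<in> set P"
  by (rule nth_mem[OF Suc_mod_less])

lemma side_eq_hull: "side P i = convex hull (cyclic_edge P i)"
  by (simp add: side_def cyclic_edge_def segment_convex_hull)

lemma side_subset_hull: "i < length P \<Longrightarrow> side P i \<subseteq> convex hull set P"
  unfolding side_eq_hull by (rule hull_mono[OF cyclic_edge_subset])

lemma boundary_chain_subset_hull: "boundary_chain P \<subseteq> convex hull set P"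
  unfolding boundary_chain_def sides_def using side_subset_hull by blast

lemma corner_in_boundary: "c \<in> set P \<Longrightarrow> c \<in> boundary_chain P"
  unfolding boundary_chain_def sides_def by (auto simp: in_set_conv_nth side_def)

text \<open>From a point \<open>x\<close> outside the hull, the ray leading away from a corner
  \<open>q\<close> never meets the hull, because \<open>x\<close> lies between \<open>q\<close> and
  the later points of the ray. So the component of \<open>x\<close> is unbounded.\<close>

lemma enclosed_subset_hull:
  assumes "P \<noteq> []"
  shows "enclosed P \<subseteq> convex hull set P"
proof
  fix x assume x: "x \<in> enclosed P"
  let ?A = "affine hull set P" and ?H = "convex hull set P"
  let ?U = "?A - boundary_chain P"
  have xU: "x \<in> ?U" "bounded (connected_component_set ?U x)"
    using x by (auto simp: enclosed_def Let_def)
  show "x \<in> ?H"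
  proof (rule ccontr)
    assume xH: "x \<notin> ?H"
    obtain q where q: "q \<in> set P" using assms by (cases P) auto
    then have qH: "q \<in> ?H" "q \<in> ?A" by (auto simp: hull_inc)
    then have "x \<noteq> q" using xH by blast
    define r where "r t = x + t *\<^sub>R (x - q)" for t :: real
    have rU: "r t \<in> ?U" if "t \<ge> 0" for t
    proof -
      have "r t = (1 + t) *\<^sub>R x + (- t) *\<^sub>R q" by (simp add: r_def algebra_simps)
      then have "r t \<in> ?A" using mem_affine[OF affine_affine_hull, of x "set P" q "1 + t" "- t"] xU(1) qH(2)
        by simp
      moreover have "r t \<notin> ?H"
      proof
        assume "r t \<in> ?H"
        have "x = (1 / (1 + t)) *\<^sub>R r t + (t / (1 + t)) *\<^sub>R q"
        proof -
          have "(1 / (1 + t)) *\<^sub>R r t + (t / (1 + t)) *\<^sub>R q = (1 / (1 + t)) *\<^sub>R (r t + t *\<^sub>R q)"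
            by (simp add: scaleR_add_right)
          also have "r t + t *\<^sub>R q = (1 + t) *\<^sub>R x" by (simp add: r_def algebra_simps)
          finally show ?thesis using that by simp
        qed
        also have "\<dots> \<in> ?H"
          by (rule convexD[OF convex_convex_hull \<open>r t \<in> ?H\<close> qH(1)])
             (use that in \<open>auto simp: add_divide_distrib[symmetric]\<close>)
        finally show False using xH by blast
      qed
      ultimately show ?thesis using boundary_chain_subset_hull by blast
    qed
    have "connected (r ` {0..})"
      by (intro connected_continuous_image) (auto simp: r_def intro!: continuous_intros)
    moreover have "x \<in> r ` {0..}" by (rule image_eqI[of _ _ 0]) (auto simp: r_def)
    ultimately have "r ` {0..} \<subseteq> connected_component_set ?U x"
      using rU by (intro connected_component_maximal) auto
    then have "bounded (r ` {0..})" using xU(2) bounded_subset by blast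
    then obtain B where B: "\<And>t. t \<ge> 0 \<Longrightarrow> norm (r t) \<le> B" unfolding bounded_iff by auto
    have "norm (t *\<^sub>R (x - q)) \<le> B + norm x" if "t \<ge> 0" for t
    proof -
      have "norm (t *\<^sub>R (x - q)) = norm (r t - x)" by (simp add: r_def)
      also have "\<dots> \<le> norm (r t) + norm x" by (rule norm_triangle_ineq4)
      finally show ?thesis using B[OF that] by simp
    qed
    \<comment> \<open>At this parameter the point has moved from \<open>x\<close> by
      \<open>\<bar>B + norm x + 1\<bar>\<close>, which exceeds the bound.\<close>
    from this[of "(B + norm x + 1) / norm (x - q)"] B[of 0] \<open>x \<noteq> q\<close>
    have "\<bar>B + norm x + 1\<bar> \<le> B + norm x"
      using norm_ge_zero[of "r 0"] by (simp add: order_trans[OF norm_ge_zero])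
    then show False by linarith
  qed
qed

text \<open>This trades the topological definition of the region for a convex hull, with which all
  later geometry works.\<close>

lemma region_eq_hull:
  assumes "strictly_convex_polygon P"
  shows "region P = convex hull set P"
proof
  have "P \<noteq> []" using assms by (auto simp: strictly_convex_polygon_def polygon_def)
  then show "region P \<subseteq> convex hull set P"
    unfolding region_def using enclosed_subset_hull boundary_chain_subset_hull by blast
  show "convex hull set P \<subseteq> region P"
    by (rule hull_minimal)
      (use assms corner_in_boundary in \<open>auto simp: strictly_convex_polygon_def region_def\<close>)
qed

lemma not_collinear_affine_hull:
  fixes a b c :: "'b::euclidean_space"
  assumes "\<not> collinear {a, b, c}" "{a, b, c} \<subseteq> S" "affine S" "aff_dim S \<le> 2"
  shows "affine hull {a, b, c} = S"
proof (rule affine_dim_equal)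
  show "affine hull {a, b, c} \<subseteq> S" using assms by (intro hull_minimal) auto
  then have "aff_dim {a, b, c} \<le> aff_dim S" using aff_dim_subset[of "affine hull {a, b, c}" S] by simp
  moreover have "aff_dim {a, b, c} > 1" using assms(1) by (simp add: collinear_aff_dim)
  ultimately show "aff_dim (affine hull {a, b, c}) = aff_dim S" using assms(4) by simp
qed (use assms in auto)

text \<open>Since \<open>z\<close> is off the plane of \<open>f\<close>, that plane meets the plane
  of the polygon only in the line of the side. A point of the polygon on this line beyond an end of
  the side would put that corner strictly between two points of the region, although it is
  extreme.\<close>

lemma line_meets_hull_in_side:
  assumes P: "strictly_convex_polygon P" and i: "i < length P"
    and f: "affval f (P ! i) = 0" "affval f (next_corner P i) = 0"
    and z: "z \<in> set P" "affval f z \<noteq> 0"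
    and y: "y \<in> convex hull set P" "affval f y = 0"
  shows "y \<in> side P i"
proof -
  let ?a = "P ! i" and ?b = "next_corner P i"
  have pol: "3 \<le> length P" "distinct P" "aff_dim (set P) = 2" using P
    by (auto simp: strictly_convex_polygon_def polygon_def)
  have ext: "c extreme_point_of (convex hull set P)" if "c \<in> set P" for c
    using P that by (auto simp: strictly_convex_polygon_def region_eq_hull[OF P])
  have ab: "?a \<in> set P" "?b \<in> set P" "?a \<noteq> ?b"
    using i pol Suc_mod_less[OF i] Suc_mod_neq(1)[OF i] by (auto simp: nth_eq_iff_index_eq)
  have col: "collinear {?a, ?b, y}"
  proof (rule ccontr)
    assume "\<not> collinear {?a, ?b, y}"
    moreover have "{?a, ?b, y} \<subseteq> affine hull set P"
      using ab y(1) convex_hull_subset_affine_hull by (auto simp: hull_inc)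
    ultimately have "affine hull {?a, ?b, y} = affine hull set P"
      using pol by (intro not_collinear_affine_hull) auto
    then have "z \<in> affine hull {?a, ?b, y}" using z(1) by (simp add: hull_inc)
    then have "affval f z = 0" by (rule affval_zero_affine_hull[rotated]) (use f y in auto)
    then show False using z by simp
  qed
  have inH: "?a \<in> convex hull set P" "?b \<in> convex hull set P" using ab by (auto simp: hull_inc)
  consider "between (?b, y) ?a" | "between (y, ?a) ?b" | "between (?a, ?b) y"
    using col unfolding collinear_between_cases by blast
  then show ?thesis
  proof cases
    case 1
    moreover have "?a \<notin> open_segment ?b y"
      using ext[OF ab(1)] inH y(1) unfolding extreme_point_of_def by blast
    ultimately have "?a = y" using ab(3) by (auto simp: between_mem_segment open_segment_def)
    then show ?thesis by (metis side_def ends_in_segment(1))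
  next
    case 2
    moreover have "?b \<notin> open_segment y ?a"
      using ext[OF ab(2)] inH y(1) unfolding extreme_point_of_def by blast
    ultimately have "?b = y" using ab(3) by (auto simp: between_mem_segment open_segment_def)
    then show ?thesis by (metis side_def ends_in_segment(2))
  next
    case 3
    then show ?thesis by (simp add: side_def between_mem_segment)
  qed
qed

text \<open>The line through a side supports the polygon: a sign change elsewhere on the chain would
  happen on the side itself, against simplicity.\<close>

lemma side_supports:
  assumes P: "strictly_convex_polygon P" and i: "i < length P"
    and f: "affval f (P ! i) = 0" "affval f (next_corner P i) = 0"
    and z: "z \<in> set P" "affval f z \<noteq> 0"
  obtains \<sigma> :: real where "\<sigma> = 1 \<or> \<sigma> = - 1"
    "\<And>x. x \<in> set P \<Longrightarrow> \<sigma> * affval f x \<ge> 0"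
proof -
  let ?n = "length P"
  have pol: "3 \<le> ?n" "distinct P"
    and simple: "\<And>i j. i < ?n \<Longrightarrow> j < ?n \<Longrightarrow> i \<noteq> j \<Longrightarrow>
        side P i \<inter> side P j = {P ! i, next_corner P i} \<inter> {P ! j, next_corner P j}"
    using P by (auto simp: strictly_convex_polygon_def polygon_def)
  have ext: "c extreme_point_of (convex hull set P)" if "c \<in> set P" for c
    using P that by (auto simp: strictly_convex_polygon_def region_eq_hull[OF P])
  \<comment> \<open>A further corner on the line would lie in the interior of the side and would not
    be extreme.\<close>
  have nz: "affval f (P ! k) \<noteq> 0" if k: "k < ?n" "k \<noteq> i" "k \<noteq> Suc i mod ?n" for k
  proof
    assume "affval f (P ! k) = 0"
    then have "P ! k \<in> closed_segment (P ! i) (next_corner P i)"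
      using line_meets_hull_in_side[OF P i f z, of "P ! k"] k by (simp add: side_def hull_inc)
    moreover have "P ! k \<noteq> P ! i" "P ! k \<noteq> next_corner P i"
      using k i pol Suc_mod_less[OF i] by (auto simp: nth_eq_iff_index_eq)
    ultimately have "P ! k \<in> open_segment (P ! i) (next_corner P i)" by (simp add: open_segment_def)
    then show False using ext[of "P ! k"] k i next_corner_in_set[OF i] unfolding extreme_point_of_def
      by (meson hull_inc nth_mem)
  qed
  have adj: "affval f (P ! k) * affval f (next_corner P k) > 0"
    if k: "k < ?n" "k \<noteq> i" "k \<noteq> Suc i mod ?n" "Suc k mod ?n \<noteq> i" for k
  proof (rule ccontr)
    assume neg: "\<not> ?thesis"
    have k': "Suc k mod ?n < ?n" "Suc k mod ?n \<noteq> Suc i mod ?n"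
      using Suc_mod_less[OF k(1)] Suc_mod_inj[OF k(1) i] k(2) by auto
    let ?u = "affval f (P ! k)" and ?v = "affval f (next_corner P k)"
    have uv: "?u \<noteq> 0" "?v \<noteq> 0" using nz k k' by auto
    then have "?u * ?v < 0" using neg by (simp add: not_less less_le)
    \<comment> \<open>\<open>t\<close> is the parameter of the zero between the opposite values
      \<open>?u\<close> and \<open>?v\<close>.\<close>
    define t where "t = ?u / (?u - ?v)"
    have d: "?u - ?v \<noteq> 0" using \<open>?u * ?v < 0\<close> by (auto simp: mult_less_0_iff)
    have t: "0 \<le> t" "t \<le> 1" using \<open>?u * ?v < 0\<close> by (auto simp: t_def mult_less_0_iff field_simps)
    define y where "y = (1 - t) *\<^sub>R (P ! k) + t *\<^sub>R next_corner P k"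
    have "affval f y = (1 - t) * ?u + t * ?v" unfolding y_def by (rule affval_convex) simp
    also have "\<dots> = ?u - t * (?u - ?v)" by (simp add: algebra_simps)
    also have "\<dots> = 0" using d by (simp add: t_def)
    finally have fy: "affval f y = 0" .
    have yk: "y \<in> side P k" using t by (auto simp: side_def y_def in_segment)
    then have "y \<in> side P i"
      using side_subset_hull[OF k(1)] by (intro line_meets_hull_in_side[OF P i f z _ fy]) auto
    then have "y \<in> {P ! k, next_corner P k}" using yk simple[OF i k(1)] k(2) by blast
    then show False using fy uv by auto
  qed
  have lt: "(i + m) mod ?n < ?n" for m using i by (intro mod_less_divisor) auto
  \<comment> \<open>Counted from \<open>i\<close>, the offsets 0 and 1 are the ends of the side, and
    the offsets from 2 to \<open>?n - 1\<close> pass through all other corners in order, so that one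
    sign spreads along them.\<close>
  define g where "g m = affval f (P ! ((i + m) mod ?n))" for m
  have idx: "(i + m) mod ?n \<noteq> i \<and> (i + m) mod ?n \<noteq> Suc i mod ?n \<and> Suc ((i + m) mod ?n) mod ?n = (i + Suc m) mod ?n"
    if "2 \<le> m" "m < ?n" for m
  proof -
    have "(i + m) mod ?n = (if i + m < ?n then i + m else i + m - ?n)"
      using i that by (cases "i + m < ?n") (simp_all add: le_mod_geq)
    moreover have "Suc i mod ?n = (if Suc i < ?n then Suc i else 0)" using i by (simp add: mod_Suc)
    moreover have "Suc ((i + m) mod ?n) mod ?n = (i + Suc m) mod ?n" by (simp add: mod_Suc_eq)
    ultimately show ?thesis using i that by auto
  qed
  have gpos: "g 2 * g m > 0" if "2 \<le> m" "m < ?n" for m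
    using that
  proof (induction m rule: dec_induct)
    case base
    then have "g 2 \<noteq> 0" unfolding g_def using idx[of 2] lt nz[of "(i + 2) mod ?n"] by (metis order_refl)
    then show ?case by (auto simp: zero_less_mult_iff linorder_neq_iff)
  next
    case (step m)
    have m: "2 \<le> m" "m < ?n" using step by auto
    have "Suc ((i + m) mod ?n) mod ?n \<noteq> i"
      using idx[OF m] idx[of "Suc m"] step.prems m by (metis le_SucI)
    then have "g m * g (Suc m) > 0"
      unfolding g_def using idx[OF m] lt adj[of "(i + m) mod ?n"] by simp
    then show ?case using step.IH m by (auto simp: zero_less_mult_iff)
  qed
  define \<sigma> :: real where "\<sigma> = (if g 2 > 0 then 1 else - 1)"
  have "\<sigma> * affval f x \<ge> 0" if x: "x \<in> set P" for x
  proof -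
    obtain k where k: "k < ?n" "x = P ! k" using x by (metis in_set_conv_nth)
    show ?thesis
    proof (cases "k = i \<or> k = Suc i mod ?n")
      case True
      then show ?thesis using k f by auto
    next
      case False
      define m where "m = (if k \<ge> i then k - i else k + ?n - i)"
      have m: "(i + m) mod ?n = k" "m < ?n" using k(1) i by (auto simp: m_def)
      have "m \<noteq> 0" using False m(1) i by (metis add.right_neutral mod_less)
      moreover have "m \<noteq> 1" using False m(1) by (metis Suc_eq_plus1)
      ultimately have "g 2 * g m > 0" using gpos m(2) by simp
      then have "\<sigma> * g m > 0" by (auto simp: \<sigma>_def zero_less_mult_iff)
      then show ?thesis using m k by (simp add: g_def)
    qed
  qed
  then show ?thesis using that[of \<sigma>] by (simp add: \<sigma>_def)
qed

lemma side_supports_region: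
  assumes P: "strictly_convex_polygon P" and s: "s \<in> sides P"
    and f: "\<And>x. x \<in> s \<Longrightarrow> affval f x = 0" and z: "z \<in> region P" "affval f z \<noteq> 0"
  obtains \<sigma> :: real where "\<sigma> = 1 \<or> \<sigma> = - 1"
    "\<And>x. x \<in> region P \<Longrightarrow> \<sigma> * affval f x \<ge> 0" "\<And>x. x \<in> region P \<Longrightarrow> affval f x = 0 \<longleftrightarrow> x \<in> s"
proof -
  note R = region_eq_hull[OF P]
  obtain i where i: "i < length P" "s = side P i" using s by (auto simp: sides_def)
  have f': "affval f (P ! i) = 0" "affval f (next_corner P i) = 0" using f i by (auto simp: side_def)
  obtain c where c: "c \<in> set P" "affval f c \<noteq> 0"
  proof (rule ccontr)
    assume "\<not> thesis"
    then have "\<And>x. x \<in> set P \<Longrightarrow> affval f x = 0" using that by blast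
    then have "affval f z = 0"
      by (rule affval_zero_affine_hull) (use z(1) R convex_hull_subset_affine_hull in auto)
    then show False using z by simp
  qed
  obtain \<sigma> :: real where \<sigma>: "\<sigma> = 1 \<or> \<sigma> = - 1" "\<And>x. x \<in> set P \<Longrightarrow> \<sigma> * affval f x \<ge> 0"
    using side_supports[OF P i(1) f' c] by metis
  have "\<sigma> * affval f x \<ge> 0" if "x \<in> region P" for x
    using affval_nonneg_convex_hull[of "set P" "\<sigma> *\<^sub>R f" x] \<sigma>(2) that R by (simp add: affval_scaleR)
  moreover have "affval f x = 0 \<longleftrightarrow> x \<in> s" if "x \<in> region P" for x
    using line_meets_hull_in_side[OF P i(1) f' c] that R i(2) f by auto
  ultimately show ?thesis using that[of \<sigma>] \<sigma>(1) by blast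
qed

lemma doubletons_inter:
  assumes "{p, q} \<noteq> {r, s}"
  shows "{p, q} \<inter> {r, s} = {} \<or> (\<exists>c. {p, q} \<inter> {r, s} = {c})"
proof (cases "p \<in> {r, s} \<and> q \<in> {r, s}")
  case True
  then have "p = q" using assms by auto
  then show ?thesis using True by simp
next
  case False
  then show ?thesis by (cases "p \<in> {r, s}"; cases "q \<in> {r, s}") (simp_all only: Int_insert_left if_True if_False Int_empty_left, blast+)
qed

text \<open>Each \<open>f i\<close> supports the corners exactly along side \<open>i\<close>. So the
  hull is the part of its plane where all \<open>f i\<close> are nonnegative, and this yields the
  simple chain, the enclosed points and the extreme corners.\<close>

lemma strictly_convex_polygonI:
  assumes len: "3 \<le> length P" and dist: "distinct P" and dim: "aff_dim (set P) \<le> 2"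
    and f0: "\<And>i. i < length P \<Longrightarrow> affval (f i) (P ! i) = 0 \<and> affval (f i) (next_corner P i) = 0"
    and f1: "\<And>i x. i < length P \<Longrightarrow> x \<in> set P \<Longrightarrow> x \<noteq> P ! i \<Longrightarrow> x \<noteq> next_corner P i \<Longrightarrow> affval (f i) x > 0"
  shows "strictly_convex_polygon P"
proof -
  let ?n = "length P" and ?H = "convex hull set P" and ?A = "affine hull set P"
  have ne: "P \<noteq> []" using len by (metis list.size(3) not_numeral_le_zero)
  have fnn: "affval (f i) x \<ge> 0" if "i < ?n" "x \<in> set P" for i x
    using f0[OF that(1)] f1[OF that] by (cases "x = P ! i \<or> x = next_corner P i") auto
  have fz: "{x \<in> set P. affval (f i) x = 0} = cyclic_edge P i" if i: "i < ?n" for i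
    using f0[OF i] f1[OF i] i next_corner_in_set[OF i] unfolding cyclic_edge_def by (auto simp: less_le)
  have face: "x \<in> side P i" if "i < ?n" "x \<in> ?H" "affval (f i) x = 0" for i x
    using convex_hull_face[of "set P" "f i" x] that fnn fz[OF that(1)] by (simp add: side_eq_hull)
  have fside: "affval (f i) x = 0" if i: "i < ?n" and x: "x \<in> side P i" for i x
  proof -
    have "x \<in> affine hull (cyclic_edge P i)"
      using x convex_hull_subset_affine_hull unfolding side_eq_hull by blast
    then show ?thesis by (rule affval_zero_affine_hull[rotated]) (use fz[OF i] in blast)
  qed
  \<comment> \<open>The zeros of \<open>f i\<close> on side \<open>j\<close> form a face of that
    segment, spanned by the ends that the two sides share.\<close>
  have inter: "x \<in> convex hull (cyclic_edge P i \<inter> cyclic_edge P j)"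
    if ij: "i < ?n" "j < ?n" and x: "x \<in> side P j" "affval (f i) x = 0" for i j x
  proof -
    have "x \<in> convex hull {p \<in> cyclic_edge P j. affval (f i) p = 0}"
      using x fnn[OF ij(1)] cyclic_edge_subset[OF ij(2)]
      by (intro convex_hull_face) (auto simp: side_eq_hull cyclic_edge_def)
    moreover have "{p \<in> cyclic_edge P j. affval (f i) p = 0} = cyclic_edge P i \<inter> cyclic_edge P j"
      using fz[OF ij(1)] cyclic_edge_subset[OF ij(2)] by blast
    ultimately show ?thesis by simp
  qed
  have simple: "side P i \<inter> side P j = {P ! i, next_corner P i} \<inter> {P ! j, next_corner P j}"
    if ij: "i < ?n" "j < ?n" "i \<noteq> j" for i j
  proof
    let ?E = "cyclic_edge P i \<inter> cyclic_edge P j"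
    have ne: "cyclic_edge P i \<noteq> cyclic_edge P j"
      using cyclic_edge_inj[OF dist len] ij by (auto simp: inj_on_def)
    have hullE: "convex hull ?E = ?E"
    proof -
      have "?E = {} \<or> (\<exists>c. ?E = {c})"
        using ne unfolding cyclic_edge_def by (rule doubletons_inter)
      then show ?thesis by (elim disjE exE) (simp_all only: convex_hull_empty convex_hull_singleton)
    qed
    show "side P i \<inter> side P j \<subseteq> {P ! i, next_corner P i} \<inter> {P ! j, next_corner P j}"
      using inter[OF ij(1,2)] fside[OF ij(1)] hullE unfolding cyclic_edge_def by blast
    show "{P ! i, next_corner P i} \<inter> {P ! j, next_corner P j} \<subseteq> side P i \<inter> side P j"
      by (auto simp: side_def)
  qed
  \<comment> \<open>At the corner after side \<open>i\<close>, the functions of its two sides act as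
    coordinates: each vanishes at one neighbouring corner and is positive at the other.\<close>
  have nbr: "\<exists>a c. a \<in> set P \<and> c \<in> set P \<and> \<not> collinear {a, P ! (Suc i mod ?n), c} \<and>
      affval (f i) a = 0 \<and> affval (f i) c > 0 \<and>
      affval (f (Suc i mod ?n)) a > 0 \<and> affval (f (Suc i mod ?n)) c = 0"
    if i: "i < ?n" for i
  proof -
    let ?j = "Suc i mod ?n" let ?k = "Suc ?j mod ?n"
    have j: "?j < ?n" "?k < ?n" using Suc_mod_less i by blast+
    have n: "?j \<noteq> i" "?k \<noteq> ?j" "?k \<noteq> i" using Suc_mod_neq i j(1) len by auto
    have nP: "P ! i \<noteq> P ! ?j" "P ! ?k \<noteq> P ! ?j" "P ! i \<noteq> P ! ?k"
      using i j n dist by (auto simp: nth_eq_iff_index_eq)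
    have c: "affval (f i) (P ! ?k) > 0" by (rule f1[OF i]) (use nP j in auto)
    have a: "affval (f ?j) (P ! i) > 0" by (rule f1[OF j(1)]) (use nP i in auto)
    have "\<not> collinear {P ! i, P ! ?j, P ! ?k}"
    proof
      assume "collinear {P ! i, P ! ?j, P ! ?k}"
      then have "P ! ?k \<in> affine hull {P ! i, P ! ?j}" using nP by (simp add: collinear_3_affine_hull)
      then have "affval (f i) (P ! ?k) = 0" by (rule affval_zero_affine_hull[rotated]) (use f0[OF i] in auto)
      then show False using c by simp
    qed
    then show ?thesis using a c f0[OF i] f0[OF j(1)] i j
      by (intro exI[of _ "P ! i"] exI[of _ "P ! ?k"]) auto
  qed
  have dim2: "aff_dim (set P) = 2"
  proof -
    have "0 < ?n" using ne by simp
    from nbr[OF this] obtain a b c where abc: "{a, b, c} \<subseteq> set P" "\<not> collinear {a, b, c}"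
      using nth_mem[OF Suc_mod_less[OF \<open>0 < ?n\<close>]] by blast
    then have "aff_dim (set P) > 1" using aff_dim_subset[OF abc(1)] by (auto simp: collinear_aff_dim)
    then show ?thesis using dim by simp
  qed
  then have pol: "polygon P" unfolding polygon_def using len dist simple by blast
  have in_hull: "y \<in> ?H" if y: "y \<in> ?A" "\<And>i. i < ?n \<Longrightarrow> affval (f i) y \<ge> 0" for y
  proof (rule ccontr)
    assume "y \<notin> ?H"
    moreover have "closed ?H" by (simp add: compact_imp_closed finite_imp_compact_convex_hull)
    ultimately obtain d b where d: "d \<bullet> y < b" "\<And>x. x \<in> ?H \<Longrightarrow> d \<bullet> x > b"
      using separating_hyperplane_closed_point[of ?H y] convex_convex_hull by blast
    have fin: "finite ((\<lambda>p. d \<bullet> p) ` set P)" "(\<lambda>p. d \<bullet> p) ` set P \<noteq> {}" using ne by simp_all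
    \<comment> \<open>\<open>q\<close> minimises \<open>d\<close> among the corners. It spans the
      plane together with its two neighbours, and the signs of its two side functions at
      \<open>y\<close> put \<open>y\<close> in the cone from \<open>q\<close> through these
      neighbours. So \<open>d\<close> cannot be smaller at \<open>y\<close> than at
      \<open>q\<close>.\<close>
    obtain q where q: "q \<in> set P" "\<And>p. p \<in> set P \<Longrightarrow> d \<bullet> q \<le> d \<bullet> p"
      using Min_in[OF fin] Min_le[OF fin(1)] by (metis (no_types, lifting) imageE imageI)
    obtain i where i: "i < ?n" "q = next_corner P i"
      using q(1) by (metis in_set_conv_nth Suc_mod_surj)
    let ?j = "Suc i mod ?n"
    have j: "?j < ?n" by (rule Suc_mod_less[OF i(1)])
    obtain a c where ac: "a \<in> set P" "c \<in> set P" "\<not> collinear {a, q, c}" "affval (f i) a = 0" "affval (f i) c > 0"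
      "affval (f ?j) a > 0" "affval (f ?j) c = 0" using nbr[OF i(1)] i(2) by blast
    have "affine hull {a, q, c} = ?A"
      by (rule not_collinear_affine_hull[OF ac(3)]) (use ac q dim in \<open>auto simp: hull_inc\<close>)
    then obtain u v w where uvw: "u + v + w = 1" "y = u *\<^sub>R a + v *\<^sub>R q + w *\<^sub>R c"
      using y(1) unfolding affine_hull_3 by blast
    have ev: "affval g y = u * affval g a + v * affval g q + w * affval g c" for g
    proof -
      have "snd g = (u + v + w) * snd g" using uvw by simp
      then show ?thesis unfolding affval_def uvw(2) by (simp add: inner_add_right algebra_simps)
    qed
    have fq: "affval (f i) q = 0" "affval (f ?j) q = 0" using f0[OF i(1)] f0[OF j] i by auto
    have "w * affval (f i) c \<ge> 0" using y(2)[OF i(1)] ev[of "f i"] ac fq by simp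
    then have w: "w \<ge> 0" using ac(5) by (simp add: zero_le_mult_iff)
    have "u * affval (f ?j) a \<ge> 0" using y(2)[OF j] ev[of "f ?j"] ac fq by simp
    then have u: "u \<ge> 0" using ac(6) by (simp add: zero_le_mult_iff)
    have "d \<bullet> q = (u + v + w) * (d \<bullet> q)" using uvw(1) by simp
    also have "\<dots> = u * (d \<bullet> q) + v * (d \<bullet> q) + w * (d \<bullet> q)" by (simp add: algebra_simps)
    also have "\<dots> \<le> u * (d \<bullet> a) + v * (d \<bullet> q) + w * (d \<bullet> c)"
      using mult_left_mono[OF q(2)[OF ac(1)] u] mult_left_mono[OF q(2)[OF ac(2)] w] by simp
    also have "\<dots> = d \<bullet> y" unfolding uvw(2) by (simp add: inner_add_right)
    finally show False using d(1) d(2)[of q] q(1) by (auto simp: hull_inc)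
  qed
  have hull_region: "?H \<subseteq> region P"
  proof
    fix x assume xH: "x \<in> ?H"
    show "x \<in> region P"
    proof (cases "x \<in> boundary_chain P")
      case True
      then show ?thesis by (simp add: region_def)
    next
      case False
      let ?U = "?A - boundary_chain P"
      let ?C = "connected_component_set ?U x"
      \<comment> \<open>Off the chain, a point of the plane has all \<open>f i\<close> positive or
        some \<open>f i\<close> negative. These are two disjoint open sets, so the component of
        \<open>x\<close> stays in the first and hence in the hull, which is bounded.\<close>
      let ?O = "\<Inter>i<?n. {y. affval (f i) y > 0}" and ?N = "\<Union>i<?n. {y. affval (f i) y < 0}"
      have offside: "affval (f i) y \<noteq> 0" if "i < ?n" "y \<in> ?H" "y \<notin> boundary_chain P" for i y
        using face[OF that(1,2)] that unfolding boundary_chain_def sides_def by blast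
      have nn: "affval (f i) y \<ge> 0" if "i < ?n" "y \<in> ?H" for i y
        using affval_nonneg_convex_hull[of "set P" "f i" y] fnn[OF that(1)] that(2) by blast
      have xU: "x \<in> ?U" using xH False convex_hull_subset_affine_hull by blast
      have "?U \<subseteq> ?O \<union> ?N"
      proof
        fix y assume y: "y \<in> ?U"
        show "y \<in> ?O \<union> ?N"
        proof (cases "\<forall>i<?n. affval (f i) y \<ge> 0")
          case True
          then have "y \<in> ?H" using in_hull y by blast
          then have "\<forall>i<?n. affval (f i) y > 0" using True offside y by (metis DiffD2 less_le)
          then show ?thesis by simp
        next
          case False
          then show ?thesis by (auto simp: not_le)
        qed
      qed
      then have "?C \<subseteq> ?O \<union> ?N" using connected_component_subset by blast
      moreover have "open ?O" "open ?N" by (auto intro!: open_INT open_UN open_affval_pos open_affval_neg)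
      moreover have "?O \<inter> ?N = {}" by (auto dest: less_trans)
      moreover have "x \<in> ?C \<inter> ?O"
        using xU nn xH offside[OF _ xH] False by (auto simp: less_le)
      ultimately have "?C \<subseteq> ?O" by (intro connected_subset_open_part[of ?C ?O ?N]) (rule connected_connected_component | blast)+
      moreover have "?C \<subseteq> ?A" using connected_component_subset by blast
      ultimately have "?C \<subseteq> ?H" using in_hull by (auto simp: less_imp_le subset_iff)
      then have "bounded ?C"
        using bounded_subset compact_imp_bounded finite_imp_compact_convex_hull by blast
      then have "x \<in> enclosed P" using xU unfolding enclosed_def Let_def by blast
      then show ?thesis by (simp add: region_def)
    qed
  qed
  have region: "region P = ?H"
    using ne hull_region enclosed_subset_hull boundary_chain_subset_hull unfolding region_def by blast
  have "c extreme_point_of ?H" if c: "c \<in> set P" for c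
  proof -
    obtain i where i: "i < ?n" "c = next_corner P i"
      using c by (metis in_set_conv_nth Suc_mod_surj)
    let ?j = "Suc i mod ?n"
    have j: "?j < ?n" by (rule Suc_mod_less[OF i(1)])
    \<comment> \<open>A corner is the only point of the hull at which both of its side functions
      vanish. As these are nonnegative on the hull, they vanish at both ends of any open segment
      through the corner.\<close>
    have only: "y = c" if y: "y \<in> ?H" "affval (f i) y = 0" "affval (f ?j) y = 0" for y
    proof -
      have "y \<in> side P i \<inter> side P ?j" using face y i j by blast
      then have "y \<in> {P ! i, next_corner P i} \<inter> {P ! ?j, next_corner P ?j}"
        using simple[OF i(1) j] Suc_mod_neq(1)[OF i(1)] len by auto
      moreover have "P ! i \<noteq> P ! ?j" "P ! i \<noteq> next_corner P ?j"
        using i(1) j Suc_mod_less[OF j] Suc_mod_neq[OF i(1)] len dist by (auto simp: nth_eq_iff_index_eq)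
      ultimately show ?thesis using i by auto
    qed
    have fc: "affval (f i) c = 0" "affval (f ?j) c = 0" using f0[OF i(1)] f0[OF j] i by auto
    show ?thesis unfolding extreme_point_of_def
    proof (intro conjI ballI notI)
      show "c \<in> ?H" using c by (simp add: hull_inc)
      fix x y assume x: "x \<in> ?H" and y: "y \<in> ?H" and "c \<in> open_segment x y"
      then obtain u where u: "0 < u" "u < 1" "c = (1 - u) *\<^sub>R x + u *\<^sub>R y" "x \<noteq> y"
        unfolding in_segment by blast
      have "affval (f k) x = 0 \<and> affval (f k) y = 0" if k: "k < ?n" "affval (f k) c = 0" for k
      proof -
        have "affval (f k) c = (1 - u) * affval (f k) x + u * affval (f k) y"
          unfolding u(3) by (rule affval_convex) simp
        moreover have "affval (f k) x \<ge> 0" "affval (f k) y \<ge> 0"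
          using affval_nonneg_convex_hull[of "set P" "f k"] fnn[OF k(1)] x y by blast+
        then have "(1 - u) * affval (f k) x \<ge> 0" "u * affval (f k) y \<ge> 0" using u by auto
        ultimately have "(1 - u) * affval (f k) x = 0" "u * affval (f k) y = 0" using k(2) by linarith+
        then show ?thesis using u by auto
      qed
      then have "x = c" "y = c" using only x y fc i(1) j by blast+
      then show False using u(4) by simp
    qed
  qed
  then show ?thesis
    unfolding strictly_convex_polygon_def using pol region by simp
qed

subsection \<open>Realising and drawing stacked graphs\<close>

text \<open>The segment from \<open>z\<close> to a relative interior point \<open>x\<close> can be
  prolonged within \<open>C\<close> beyond \<open>x\<close>. If \<open>f\<close> were no longer
  positive at \<open>x\<close>, it would be negative further on.\<close>

lemma rel_interior_affval_pos:
  assumes "convex C" "x \<in> rel_interior C" "\<And>y. y \<in> C \<Longrightarrow> affval f y \<ge> 0" "z \<in> C" "affval f z > 0"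
  shows "affval f x > 0"
proof -
  obtain e where e: "e > 1" "(1 - e) *\<^sub>R z + e *\<^sub>R x \<in> C"
    using assms(1,2,4) convex_rel_interior_iff by (metis empty_iff)
  have "0 \<le> (1 - e) * affval f z + e * affval f x"
    using assms(3)[OF e(2)] by (simp add: affval_convex)
  moreover have "(1 - e) * affval f z < 0" using e(1) assms(5) by (simp add: mult_less_0_iff)
  ultimately have "e * affval f x > 0" by linarith
  then show ?thesis using e(1) by (simp add: zero_less_mult_iff)
qed

text \<open>The polygon of \<open>a\<close> is the facet \<open>N a = 0\<close>, with corners
  \<open>p t\<close> for the faces \<open>t\<close> at \<open>a\<close> in the order of the cycle
  around \<open>a\<close>. How the polygons meet follows from one formula: the intersection of two
  facets is spanned by their common corners.\<close>

lemma stacked_realizable: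
  assumes S: "stacked V E F"
  shows "\<exists>\<S>. convex_polyhedral_surface \<S> \<and> ugraph_iso (adjacency_graph \<S>) (V, E)"
proof -
  obtain N p where "simple_polytope V F N p" using stacked_simple_polytope[OF S] by blast
  then have N0: "affval (N y) (p t) \<ge> 0" and N1: "affval (N y) (p t) = 0 \<longleftrightarrow> y \<in> t" if "t \<in> F" "y \<in> V" for t y
    using that by (auto simp: simple_polytope_def)
  note wf = stackedD[OF S]
  have p_inj: "inj_on p F"
  proof (rule inj_onI)
    fix t t' assume tt: "t \<in> F" "t' \<in> F" "p t = p t'"
    have "y \<in> t \<longleftrightarrow> y \<in> t'" if "y \<in> V" for y using N1[OF tt(1) that] N1[OF tt(2) that] tt(3) by simp
    then show "t = t'" using wf(5)[OF tt(1)] wf(5)[OF tt(2)] by blast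
  qed
  have "\<forall>a\<in>V. \<exists>ys. distinct ys \<and> 3 \<le> length ys \<and> {t \<in> F. a \<in> t} = insert a ` cyclic_edges ys \<and>
      {y. {a, y} \<in> E} = set ys \<and> a \<notin> set ys"
  proof
    fix a assume "a \<in> V"
    then obtain ys where "distinct ys" "3 \<le> length ys" "{t \<in> F. a \<in> t} = insert a ` cyclic_edges ys"
      "{y. {a, y} \<in> E} = set ys" "a \<notin> set ys" by (rule stacked_link_obtain[OF S])
    then show "\<exists>ys. distinct ys \<and> 3 \<le> length ys \<and> {t \<in> F. a \<in> t} = insert a ` cyclic_edges ys \<and>
      {y. {a, y} \<in> E} = set ys \<and> a \<notin> set ys" by (intro exI[of _ ys] conjI)
  qed
  then obtain ys where ys': "\<forall>a\<in>V. distinct (ys a) \<and> 3 \<le> length (ys a) \<and>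
      {t \<in> F. a \<in> t} = insert a ` cyclic_edges (ys a) \<and> {y. {a, y} \<in> E} = set (ys a) \<and> a \<notin> set (ys a)"
    by (rule bchoice[THEN exE])
  have ys: "distinct (ys a)" "3 \<le> length (ys a)" "{t \<in> F. a \<in> t} = insert a ` cyclic_edges (ys a)"
      "{y. {a, y} \<in> E} = set (ys a)" "a \<notin> set (ys a)" if "a \<in> V" for a
    using bspec[OF ys' that] by - (elim conjE, assumption)+
  define fc where "fc a i = insert a (cyclic_edge (ys a) i)" for a i
  define P where "P a = map (\<lambda>i. p (fc a i)) [0..<length (ys a)]" for a
  have lenP: "length (P a) = length (ys a)" and nthP: "i < length (ys a) \<Longrightarrow> P a ! i = p (fc a i)" for a i
    by (simp_all add: P_def)
  have fcF: "fc a i \<in> F" if "a \<in> V" "i < length (ys a)" for a i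
    using ys(3)[OF that(1)] that(2) unfolding fc_def cyclic_edges_def by blast
  have setP: "set (P a) = p ` {t \<in> F. a \<in> t}" if "a \<in> V" for a
    unfolding ys(3)[OF that] by (auto simp: P_def fc_def cyclic_edges_def)
  have distP: "distinct (P a)" if a: "a \<in> V" for a
  proof -
    have "i = j" if ij: "i < length (ys a)" "j < length (ys a)" and eq: "p (fc a i) = p (fc a j)" for i j
    proof -
      have "fc a i = fc a j" using p_inj eq fcF[OF a] ij by (auto simp: inj_on_def)
      moreover have "a \<notin> cyclic_edge (ys a) i" "a \<notin> cyclic_edge (ys a) j"
        using ys(5)[OF a] cyclic_edge_subset ij by blast+
      ultimately show ?thesis
        using cyclic_edge_inj[OF ys(1,2)[OF a]] ij by (auto simp: fc_def insert_ident inj_on_def)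
    qed
    then show ?thesis unfolding P_def by (simp add: distinct_map inj_on_def)
  qed
  have at_edge: "{t \<in> F. a \<in> t \<and> ys a ! (Suc i mod length (ys a)) \<in> t} = {fc a i, fc a (Suc i mod length (ys a))}"
    if "a \<in> V" "i < length (ys a)" for a i
    unfolding fc_def by (rule faces_at_edge(1)[OF ys(1,2,3,5)[OF that(1)] that(2)])
  have nbV: "ys a ! i \<in> V" "{a, ys a ! i} \<in> E" if "a \<in> V" "i < length (ys a)" for a i
  proof -
    show "{a, ys a ! i} \<in> E" using ys(4)[OF that(1)] nth_mem[OF that(2)] by blast
    then show "ys a ! i \<in> V" using wf(3) by blast
  qed
  have scp: "strictly_convex_polygon (P a)" if a: "a \<in> V" for a
  proof (rule strictly_convex_polygonI)
    show "3 \<le> length (P a)" "distinct (P a)" using lenP ys(2)[OF a] distP[OF a] by simp_all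
    have Na: "affval (N a) x = 0" if "x \<in> set (P a)" for x using that setP[OF a] N1[OF _ a] by auto
    have "V \<noteq> {a}" using wf(2) by auto
    then obtain b where b: "b \<in> V" "b \<noteq> a" using a by blast
    obtain t where t: "t \<in> F" "b \<in> t" "a \<notin> t" using stacked_face_avoiding[OF S b(1), of a] b(2) by metis
    have "set (P a) \<noteq> {}" using lenP ys(2)[OF a] by (metis list.size(3) not_numeral_le_zero set_empty)
    then obtain x where x: "x \<in> set (P a)" by (meson equals0I)
    \<comment> \<open>\<open>N a\<close> vanishes at the corners of its polygon but not at the
      corner of a face avoiding \<open>a\<close>, so it is not constant and its zero set is a
      plane.\<close>
    have "fst (N a) \<noteq> 0"
    proof
      assume "fst (N a) = 0"
      then have "affval (N a) (p t) = affval (N a) x" by (simp add: affval_def)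
      then show False using Na[OF x] N1[OF t(1) a] t(3) by simp
    qed
    then have "aff_dim {x. fst (N a) \<bullet> x = - snd (N a)} = 2" by (simp add: aff_dim_hyperplane)
    moreover have "set (P a) \<subseteq> {x. fst (N a) \<bullet> x = - snd (N a)}" using Na by (auto simp: affval_def eq_neg_iff_add_eq_0)
    ultimately show "aff_dim (set (P a)) \<le> 2" using aff_dim_subset by metis
  next
    fix i assume i: "i < length (P a)"
    \<comment> \<open>Side \<open>i\<close> joins the corners of the two faces that contain both
      \<open>a\<close> and this neighbour, so the facet of the neighbour supports the polygon there.
      The entry is the successor of \<open>i\<close> because it is the one shared by the cyclic
      edges \<open>i\<close> and \<open>Suc i\<close>.\<close>
    let ?y = "ys a ! (Suc i mod length (ys a))"
    have i': "i < length (ys a)" "Suc i mod length (ys a) < length (ys a)" using i lenP Suc_mod_less by metis+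
    have y: "?y \<in> V" by (rule nbV(1)[OF a i'(2)])
    have mem: "{fc a i, fc a (Suc i mod length (ys a))} \<subseteq> {t \<in> F. a \<in> t \<and> ?y \<in> t}"
      unfolding at_edge[OF a i'(1)] by (rule subset_refl)
    show "affval (N ?y) (P a ! i) = 0 \<and> affval (N ?y) (next_corner (P a) i) = 0"
      using N1[OF _ y] mem unfolding lenP nthP[OF i'(1)] nthP[OF i'(2)] by simp
    fix x assume x: "x \<in> set (P a)" "x \<noteq> P a ! i" "x \<noteq> next_corner (P a) i"
    obtain t where t: "t \<in> F" "a \<in> t" "x = p t" using x(1) setP[OF a] by auto
    have "t \<noteq> fc a i" "t \<noteq> fc a (Suc i mod length (ys a))"
      using x(2,3) t(3) unfolding lenP nthP[OF i'(1)] nthP[OF i'(2)] by auto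
    then have "t \<notin> {t \<in> F. a \<in> t \<and> ?y \<in> t}" unfolding at_edge[OF a i'(1)] by simp
    then show "affval (N ?y) x > 0" using t N0[OF t(1) y] N1[OF t(1) y] by (simp add: less_le)
  qed
  have region: "region (P a) = convex hull (p ` {t \<in> F. a \<in> t})" if "a \<in> V" for a
    using region_eq_hull[OF scp[OF that]] setP[OF that] by simp
  have Nnn: "affval (N b) x \<ge> 0" if "a \<in> V" "b \<in> V" "x \<in> region (P a)" for a b x
    by (rule affval_nonneg_convex_hull[of "p ` {t \<in> F. a \<in> t}"]) (use N0 that region in auto)
  have Nz: "affval (N a) x = 0" if "a \<in> V" "x \<in> region (P a)" for a x
  proof (rule affval_zero_affine_hull[of "p ` {t \<in> F. a \<in> t}"])
    show "x \<in> affine hull (p ` {t \<in> F. a \<in> t})"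
      using that region convex_hull_subset_affine_hull by blast
  qed (use N1 that in auto)
  \<comment> \<open>Cutting with one more facet keeps exactly the corners on it. The predicate
    \<open>Q\<close> lets the cut be repeated for a third facet.\<close>
  have hull_cut: "x \<in> convex hull (p ` {t \<in> F. Q t \<and> b \<in> t})"
    if "b \<in> V" "x \<in> convex hull (p ` {t \<in> F. Q t})" "affval (N b) x = 0" for Q b x
  proof -
    have "x \<in> convex hull {q \<in> p ` {t \<in> F. Q t}. affval (N b) q = 0}"
      by (rule convex_hull_face) (use that N0 stacked_finite_faces[OF S] in auto)
    moreover have "{q \<in> p ` {t \<in> F. Q t}. affval (N b) q = 0} = p ` {t \<in> F. Q t \<and> b \<in> t}"
      using N1 that(1) by auto
    ultimately show ?thesis by simp
  qed
  have inter: "region (P a) \<inter> region (P b) = convex hull (p ` {t \<in> F. a \<in> t \<and> b \<in> t})"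
    if "a \<in> V" "b \<in> V" for a b
  proof
    show "region (P a) \<inter> region (P b) \<subseteq> convex hull (p ` {t \<in> F. a \<in> t \<and> b \<in> t})"
      using hull_cut[OF that(2), of _ "\<lambda>t. a \<in> t"] region[OF that(1)] Nz[OF that(2)] by blast
    show "convex hull (p ` {t \<in> F. a \<in> t \<and> b \<in> t}) \<subseteq> region (P a) \<inter> region (P b)"
      unfolding region[OF that(1)] region[OF that(2)] by (intro Int_greatest hull_mono image_mono) auto
  qed
  have inter_side: "region (P a) \<inter> region (P b) \<in> sides (P a)" if ab: "a \<in> V" "b \<in> V" "{a, b} \<in> E" for a b
  proof -
    have "b \<in> set (ys a)" using ys(4)[OF ab(1)] ab(3) by blast
    then obtain i where i: "i < length (ys a)" "b = ys a ! (Suc i mod length (ys a))"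
      by (metis in_set_conv_nth Suc_mod_surj)
    have "region (P a) \<inter> region (P b) = convex hull (p ` {fc a i, fc a (Suc i mod length (ys a))})"
      unfolding inter[OF ab(1,2)] using at_edge[OF ab(1) i(1)] i(2) by simp
    also have "\<dots> = side (P a) i"
      using nthP[OF i(1)] nthP[OF Suc_mod_less[OF i(1)]] by (simp add: side_def segment_convex_hull lenP)
    finally show ?thesis using i(1) by (simp add: sides_def lenP)
  qed
  \<comment> \<open>Polygons of nonadjacent vertices are even disjoint, so in this surface no two
    polygons meet in a single corner.\<close>
  have inter_empty: "region (P a) \<inter> region (P b) = {}" if ab: "a \<in> V" "b \<in> V" "a \<noteq> b" "{a, b} \<notin> E" for a b
  proof -
    have "{t \<in> F. a \<in> t \<and> b \<in> t} = {}" using wf(7) ab(3,4) by blast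
    then show ?thesis unfolding inter[OF ab(1,2)] by simp
  qed
  have avoid: "\<exists>z\<in>region (P a). affval (N b) z > 0" if ab: "a \<in> V" "b \<in> V" "a \<noteq> b" for a b
  proof -
    obtain t where t: "t \<in> F" "a \<in> t" "b \<notin> t" using stacked_face_avoiding[OF S ab(1)] ab(3) by metis
    then have "affval (N b) (p t) > 0" using N0[OF t(1) ab(2)] N1[OF t(1) ab(2)] by (simp add: less_le)
    moreover have "p t \<in> region (P a)" unfolding region[OF ab(1)] using t by (intro hull_inc) auto
    ultimately show ?thesis by blast
  qed
  have P_inj: "inj_on P V"
  proof (rule inj_onI, rule ccontr)
    fix a b assume ab: "a \<in> V" "b \<in> V" "P a = P b" "a \<noteq> b"
    then obtain z where "z \<in> region (P b)" "affval (N b) z > 0" using avoid[OF ab(1,2,4)] by auto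
    then show False using Nz[OF ab(2)] by fastforce
  qed
  have pol: "polygon (P a)" if "a \<in> V" for a using scp[OF that] by (simp add: strictly_convex_polygon_def)
  have rel: "rel_interior (region (P a)) \<inter> rel_interior (region (P b)) = {}"
    if ab: "a \<in> V" "b \<in> V" "a \<noteq> b" for a b
  proof -
    obtain z where z: "z \<in> region (P a)" "affval (N b) z > 0" using avoid[OF ab] by blast
    have "convex (region (P a))" unfolding region[OF ab(1)] by simp
    then have "affval (N b) x > 0" if "x \<in> rel_interior (region (P a))" for x
      by (rule rel_interior_affval_pos[OF _ that _ z]) (rule Nnn[OF ab(1,2)])
    moreover have "affval (N b) x = 0" if "x \<in> rel_interior (region (P b))" for x
      using that rel_interior_subset Nz[OF ab(2)] by blast
    ultimately show ?thesis by fastforce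
  qed
  have triple: "\<exists>c \<in> set (P a) \<inter> set (P b) \<inter> set (P d). region (P a) \<inter> region (P b) \<inter> region (P d) = {c}"
    if abd: "a \<in> V" "b \<in> V" "d \<in> V" "a \<noteq> b" "a \<noteq> d" "b \<noteq> d"
      and ne: "region (P a) \<inter> region (P b) \<inter> region (P d) \<noteq> {}" for a b d
  proof -
    have sub: "x \<in> convex hull (p ` {t \<in> F. (a \<in> t \<and> b \<in> t) \<and> d \<in> t})"
      if "x \<in> region (P a) \<inter> region (P b) \<inter> region (P d)" for x
      using hull_cut[OF abd(3), of x "\<lambda>t. a \<in> t \<and> b \<in> t"] that inter[OF abd(1,2)] Nz[OF abd(3)] by blast
    \<comment> \<open>Faces have three elements, so three facets share at most one corner.\<close>
    have only: "t = {a, b, d}" if "t \<in> F" "a \<in> t" "b \<in> t" "d \<in> t" for t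
    proof -
      have "card t = 3" "finite t" using wf(6)[OF that(1)] by (auto intro: card_ge_0_finite)
      then show ?thesis using that abd(4-6) by (intro card_seteq[symmetric]) auto
    qed
    have "{t \<in> F. (a \<in> t \<and> b \<in> t) \<and> d \<in> t} \<noteq> {}"
    proof
      assume e: "{t \<in> F. (a \<in> t \<and> b \<in> t) \<and> d \<in> t} = {}"
      obtain x where "x \<in> region (P a) \<inter> region (P b) \<inter> region (P d)" using ne by (meson equals0I)
      from sub[OF this] show False unfolding e by simp
    qed
    then obtain t where t: "t \<in> {t \<in> F. (a \<in> t \<and> b \<in> t) \<and> d \<in> t}" by (meson equals0I)
    then have "t = {a, b, d}" using only[of t] by simp
    then have T: "{a, b, d} \<in> F" using t by simp
    have T1: "{t \<in> F. (a \<in> t \<and> b \<in> t) \<and> d \<in> t} = {{a, b, d}}"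
    proof (rule set_eqI, rule iffI)
      fix t assume "t \<in> {{a, b, d}}"
      then show "t \<in> {t \<in> F. (a \<in> t \<and> b \<in> t) \<and> d \<in> t}" using T by simp
    qed (use only in simp)
    have "region (P a) \<inter> region (P b) \<inter> region (P d) \<subseteq> {p {a, b, d}}"
    proof
      fix x assume "x \<in> region (P a) \<inter> region (P b) \<inter> region (P d)"
      from sub[OF this] show "x \<in> {p {a, b, d}}" unfolding T1 by simp
    qed
    then have "region (P a) \<inter> region (P b) \<inter> region (P d) = {p {a, b, d}}" using ne by (metis subset_singletonD)
    moreover have "p {a, b, d} \<in> set (P a) \<inter> set (P b) \<inter> set (P d)"
      using T by (simp add: setP[OF abd(1)] setP[OF abd(2)] setP[OF abd(3)])
    ultimately show ?thesis by blast
  qed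
  have surf: "convex_polyhedral_surface (P ` V)"
    unfolding convex_polyhedral_surface_def polyhedral_surface_def
  proof (intro conjI ballI impI)
    show "finite (P ` V)" using wf(1) by simp
    show "polygon Q" if "Q \<in> P ` V" for Q using that pol by auto
    show "strictly_convex_polygon Q" if "Q \<in> P ` V" for Q using that scp by auto
    show "rel_interior (region Q) \<inter> rel_interior (region R) = {}"
      if "Q \<in> P ` V" "R \<in> P ` V" "Q \<noteq> R" for Q R using that rel by auto
    show "(\<exists>c\<in>set Q \<inter> set R. region Q \<inter> region R = {c}) \<or> region Q \<inter> region R \<in> sides Q \<inter> sides R"
      if QR: "Q \<in> P ` V" "R \<in> P ` V" "Q \<noteq> R" "region Q \<inter> region R \<noteq> {}" for Q R
    proof -
      obtain a b where ab: "a \<in> V" "b \<in> V" "Q = P a" "R = P b" using QR by blast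
      have "{a, b} \<in> E" using inter_empty[of a b] ab QR by metis
      then show ?thesis using inter_side[of a b] inter_side[of b a] ab by (simp add: Int_commute insert_commute)
    qed
    show "\<exists>c\<in>set Q \<inter> set R \<inter> set T. region Q \<inter> region R \<inter> region T = {c}"
      if QRT: "Q \<in> P ` V" "R \<in> P ` V" "T \<in> P ` V" "Q \<noteq> R" "Q \<noteq> T" "R \<noteq> T"
        "region Q \<inter> region R \<inter> region T \<noteq> {}" for Q R T
    proof -
      obtain a b d where "a \<in> V" "b \<in> V" "d \<in> V" "Q = P a" "R = P b" "T = P d" using QRT(1-3) by blast
      then show ?thesis using triple[of a b d] QRT(4-7) by blast
    qed
  qed
  have adj: "{P a, P b} \<in> snd (adjacency_graph (P ` V)) \<longleftrightarrow> {a, b} \<in> E" if ab: "a \<in> V" "b \<in> V" for a b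
  proof
    assume "{P a, P b} \<in> snd (adjacency_graph (P ` V))"
    then obtain Q R where QR: "{P a, P b} = {Q, R}" "Q \<noteq> R" "sides Q \<inter> sides R \<noteq> {}"
      by (auto simp: adjacency_graph_def)
    then have ne: "P a \<noteq> P b" "sides (P a) \<inter> sides (P b) \<noteq> {}"
      unfolding doubleton_eq_iff by (auto simp: Int_commute)
    then obtain s where s: "s \<in> sides (P a)" "s \<in> sides (P b)" by blast
    have "sides Q \<subseteq> Pow (region Q)" for Q by (auto simp: region_def boundary_chain_def)
    then have "s \<subseteq> region (P a) \<inter> region (P b)" using s by blast
    moreover have "s \<noteq> {}" using s(1) by (auto simp: sides_def side_def)
    ultimately show "{a, b} \<in> E" using inter_empty[OF ab] ne(1) by blast
  next
    assume E: "{a, b} \<in> E"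
    then have "a \<noteq> b" using wf(4)[OF E] by auto
    then have "P a \<noteq> P b" using P_inj ab by (auto simp: inj_on_def)
    moreover have "region (P a) \<inter> region (P b) \<in> sides (P a) \<inter> sides (P b)"
      using inter_side[OF ab E] inter_side[of b a] ab E by (simp add: Int_commute insert_commute)
    ultimately show "{P a, P b} \<in> snd (adjacency_graph (P ` V))"
      unfolding adjacency_graph_def snd_conv using ab by blast
  qed
  have "ugraph_iso (adjacency_graph (P ` V)) (V, E)"
    unfolding ugraph_iso_def
  proof (intro exI[of _ "inv_into V P"] conjI ballI)
    show "bij_betw (inv_into V P) (fst (adjacency_graph (P ` V))) (fst (V, E))"
      using bij_betw_inv_into[OF inj_on_imp_bij_betw[OF P_inj]] by (simp add: adjacency_graph_def)
    fix Q R assume "Q \<in> fst (adjacency_graph (P ` V))" "R \<in> fst (adjacency_graph (P ` V))"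
    then obtain a b where ab: "a \<in> V" "b \<in> V" "Q = P a" "R = P b" by (auto simp: adjacency_graph_def)
    then show "({Q, R} \<in> snd (adjacency_graph (P ` V))) = ({inv_into V P Q, inv_into V P R} \<in> snd (V, E))"
      using adj[OF ab(1,2)] P_inj by (simp add: inv_into_f_f)
  qed
  with surf show ?thesis by blast
qed

text \<open>Directions are told apart by the corners of the polytope that minimise them. On the normal
  fan this recovers the cone containing the direction, so distinct cones meet only in common faces.\<close>

lemma stacked_planar:
  assumes S: "stacked V E F"
  shows "planar (V, E)"
proof -
  obtain N p where "simple_polytope V F N p" using stacked_simple_polytope[OF S] by blast
  then have N0: "affval (N y) (p t) \<ge> 0" and N1: "affval (N y) (p t) = 0 \<longleftrightarrow> y \<in> t" if "t \<in> F" "y \<in> V" for t y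
    using that by (auto simp: simple_polytope_def)
  note wf = stackedD[OF S]
  define n where "n a = fst (N a)" for a
  have n: "n a \<bullet> x = affval (N a) x - snd (N a)" for a x by (simp add: n_def affval_def)
  define M where "M c = {t \<in> F. \<forall>t'\<in>F. c \<bullet> p t \<le> c \<bullet> p t'}" for c
  \<comment> \<open>Minimisers are read off by writing the direction, on the corners, as a constant
    plus a nonnegative function that has a zero.\<close>
  have M: "M c = {t \<in> F. g t = 0}"
    if "\<And>t. t \<in> F \<Longrightarrow> c \<bullet> p t = k + g t \<and> g t \<ge> 0" "t0 \<in> F" "g t0 = 0" for c k g t0
    unfolding M_def using that by force
  \<comment> \<open>The carrier stands for the normal cone around \<open>c\<close>, named by the
    vertices whose normals span it: one for a normal itself, two inside the cone of an edge, three
    inside the cone of a corner.\<close>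
  define car where "car c = \<Inter> (M c)" for c
  have car_sgn: "car (sgn c) = car c" if "c \<noteq> 0" for c
  proof -
    have "M (sgn c) = M c" using that by (auto simp: M_def sgn_div_norm field_simps)
    then show ?thesis by (simp add: car_def)
  qed
  have edgeV: "a \<in> V" "b \<in> V" "a \<noteq> b" if "{a, b} \<in> E" for a b
    using wf(3)[OF that] wf(4)[OF that] by auto
  have ex_face: "\<exists>t\<in>F. a \<in> t" if a: "a \<in> V" for a
  proof -
    have "\<not> V \<subseteq> {a}" using wf(2) card_mono[of "{a}" V] by auto
    then obtain b where "b \<noteq> a" by blast
    then show ?thesis using stacked_face_avoiding[OF S a] by metis
  qed
  have inter1: "\<Inter>{t \<in> F. a \<in> t} = {a}" if a: "a \<in> V" for a
  proof -
    have "b = a" if "b \<in> \<Inter>{t \<in> F. a \<in> t}" for b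
    proof (rule ccontr)
      assume "b \<noteq> a"
      then obtain t where "t \<in> F" "a \<in> t" "b \<notin> t" using stacked_face_avoiding[OF S a] by metis
      then show False using that by blast
    qed
    then show ?thesis by (intro set_eqI iffI) simp_all
  qed
  have inter2: "\<Inter>{t \<in> F. a \<in> t \<and> b \<in> t} = {a, b} \<and> (\<exists>t\<in>F. a \<in> t \<and> b \<in> t)" if ab: "{a, b} \<in> E" for a b
  proof -
    obtain t1 t2 where t: "t1 \<noteq> t2" "{t \<in> F. a \<in> t \<and> b \<in> t} = {t1, t2}"
      by (rule stacked_edge_faces[OF S ab])
    have mem: "{t1, t2} \<subseteq> {t \<in> F. a \<in> t \<and> b \<in> t}" unfolding t(2) by (rule subset_refl)
    then have c: "card t1 = 3" "card t2 = 3" "finite t1" "finite t2"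
      using wf(6) by (auto intro: card_ge_0_finite)
    have "t1 \<inter> t2 \<noteq> t1" using t(1) c by (metis card_seteq inf_le2 order_refl)
    then have "card (t1 \<inter> t2) < card t1" using c by (intro psubset_card_mono) auto
    then have "card (t1 \<inter> t2) \<le> card {a, b}" using c edgeV[OF ab] by simp
    then have "{a, b} = t1 \<inter> t2" using mem c by (intro card_seteq) auto
    then show ?thesis unfolding t(2) using mem by auto
  qed
  have car_vertex: "car (n a) = {a}" if a: "a \<in> V" for a
  proof -
    obtain t0 where t0: "t0 \<in> F" "a \<in> t0" using ex_face[OF a] by blast
    have "M (n a) = {t \<in> F. affval (N a) (p t) = 0}"
      by (rule M[of _ "- snd (N a)" _ t0]) (use N0 N1 a t0 in \<open>auto simp: n\<close>)
    also have "\<dots> = {t \<in> F. a \<in> t}" using N1 a by blast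
    finally show ?thesis using inter1[OF a] by (simp add: car_def)
  qed
  have car_edge: "c = n a \<or> c = n b \<or> car c = {a, b}"
    if ab: "{a, b} \<in> E" and c: "c \<in> closed_segment (n a) (n b)" for a b c
  proof -
    obtain s where s: "0 \<le> s" "s \<le> 1" "c = (1 - s) *\<^sub>R n a + s *\<^sub>R n b" using c by (auto simp: in_segment)
    show ?thesis
    proof (cases "s = 0 \<or> s = 1")
      case True
      then show ?thesis using s(3) by auto
    next
      case False
      then have s': "0 < s" "0 < 1 - s" using s by auto
      let ?g = "\<lambda>t. (1 - s) * affval (N a) (p t) + s * affval (N b) (p t)"
      obtain t0 where t0: "t0 \<in> F" "a \<in> t0" "b \<in> t0" using inter2[OF ab] by blast
      have g0: "(1 - s) * affval (N a) (p t) \<ge> 0" "s * affval (N b) (p t) \<ge> 0" if "t \<in> F" for t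
        using N0[OF that] edgeV[OF ab] s' by simp_all
      have "M c = {t \<in> F. ?g t = 0}"
      proof (rule M[of _ "- (1 - s) * snd (N a) - s * snd (N b)" _ t0])
        show "c \<bullet> p t = - (1 - s) * snd (N a) - s * snd (N b) + ?g t \<and> ?g t \<ge> 0" if "t \<in> F" for t
          using g0[OF that] by (simp add: s(3) inner_add_left n algebra_simps)
        show "?g t0 = 0" using N1[OF t0(1) edgeV(1)[OF ab]] N1[OF t0(1) edgeV(2)[OF ab]] t0 by simp
      qed (rule t0)
      also have "\<dots> = {t \<in> F. a \<in> t \<and> b \<in> t}"
      proof -
        have "?g t = 0 \<longleftrightarrow> a \<in> t \<and> b \<in> t" if "t \<in> F" for t
          using g0[OF that] s' N1[OF that edgeV(1)[OF ab]] N1[OF that edgeV(2)[OF ab]]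
          by (simp add: add_nonneg_eq_0_iff)
        then show ?thesis by blast
      qed
      finally have "car c = \<Inter>{t \<in> F. a \<in> t \<and> b \<in> t}" by (simp add: car_def)
      then show ?thesis using inter2[OF ab] by simp
    qed
  qed
  \<comment> \<open>A nonempty carrier therefore certifies that a direction is nonzero and can be
    projected to the sphere.\<close>
  have car0: "car 0 = {}"
  proof -
    have "M 0 = F" by (auto simp: M_def)
    moreover have "\<exists>t\<in>F. a \<notin> t" for a
    proof -
      have "\<not> V \<subseteq> {a}" using wf(2) card_mono[of "{a}" V] by auto
      then obtain b where "b \<in> V" "a \<noteq> b" by blast
      then show ?thesis using stacked_face_avoiding[OF S] by metis
    qed
    ultimately show ?thesis unfolding car_def by blast
  qed
  obtain T where T: "T \<in> F"
  proof -
    have "V \<noteq> {}" using wf(2) by auto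
    then show ?thesis using ex_face that by blast
  qed
  \<comment> \<open>The sum of the three normals at a corner is minimised at this corner only, so
    its carrier has three elements. Vertices and edges have carriers of at most two, and thus the
    sphere can be punctured here without touching the drawing.\<close>
  define c0 where "c0 = sum n T"
  have finT: "finite T" "T \<subseteq> V" "card T = 3" using wf(5,6)[OF T] by (auto intro: card_ge_0_finite)
  have "car c0 = T"
  proof -
    let ?g = "\<lambda>t. \<Sum>a\<in>T. affval (N a) (p t)"
    have "M c0 = {t \<in> F. ?g t = 0}"
    proof (rule M[of _ "- (\<Sum>a\<in>T. snd (N a))" _ T])
      show "c0 \<bullet> p t = - (\<Sum>a\<in>T. snd (N a)) + ?g t \<and> ?g t \<ge> 0" if "t \<in> F" for t
        using N0[OF that] finT by (auto simp: c0_def inner_sum_left n sum_subtractf intro!: sum_nonneg)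
      show "?g T = 0" using N1[OF T] finT by (intro sum.neutral) auto
    qed (rule T)
    also have "\<dots> = {T}"
    proof -
      have "t = T" if t: "t \<in> F" "?g t = 0" for t
      proof -
        have "\<forall>a\<in>T. affval (N a) (p t) = 0"
          using t(2) N0[OF t(1)] finT by (subst (asm) sum_nonneg_eq_0_iff) auto
        then have "T \<subseteq> t" using N1[OF t(1)] finT by blast
        moreover have "card t = 3" "finite t" using wf(6)[OF t(1)] by (auto intro: card_ge_0_finite)
        ultimately show ?thesis using finT by (metis card_subset_eq)
      qed
      moreover have "?g T = 0" using N1[OF T] finT by (intro sum.neutral) auto
      ultimately show ?thesis using T by blast
    qed
    finally show ?thesis by (simp add: car_def)
  qed
  then have card0: "card (car c0) = 3" using finT by simp
  then have "c0 \<noteq> 0" using car0 by auto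
  then have c0: "c0 \<noteq> 0" "card (car (sgn c0)) = 3" using card0 car_sgn by simp_all
  have "(sphere 0 1 - {sgn c0}) homeomorphic (UNIV :: complex set)"
    by (rule homeomorphic_punctured_sphere_affine) (use c0 in \<open>auto simp: norm_sgn\<close>)
  then obtain h :: "real^3 \<Rightarrow> complex" and h' where "homeomorphism (sphere 0 1 - {sgn c0}) UNIV h h'"
    unfolding homeomorphic_def by blast
  then have h: "continuous_on (sphere 0 1 - {sgn c0}) h" "inj_on h (sphere 0 1 - {sgn c0})"
    unfolding homeomorphism_def by (auto intro: inj_on_inverseI)
  define D where "D = {c. c \<noteq> 0 \<and> card (car c) < 3}"
  have D_sphere: "sgn c \<in> sphere 0 1 - {sgn c0}" if "c \<in> D" for c
    using that c0(2) car_sgn[of c] by (auto simp: D_def norm_sgn)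
  define \<phi> where "\<phi> c = h (sgn c)" for c
  have \<phi>_cont: "continuous_on D \<phi>"
  proof -
    have "continuous_on D (\<lambda>c. inverse (norm c) *\<^sub>R c)" by (intro continuous_intros) (auto simp: D_def)
    then have "continuous_on D sgn" by (simp add: sgn_div_norm[abs_def])
    then have "continuous_on D (h \<circ> sgn)"
      using continuous_on_compose continuous_on_subset[OF h(1)] D_sphere by (metis image_subsetI)
    then show ?thesis by (simp add: \<phi>_def[abs_def] o_def)
  qed
  have \<phi>_sgn: "sgn c = sgn c'" if "c \<in> D" "c' \<in> D" "\<phi> c = \<phi> c'" for c c'
    using that h(2) D_sphere unfolding \<phi>_def inj_on_def by blast
  have \<phi>_car: "car c = car c'" if "c \<in> D" "c' \<in> D" "\<phi> c = \<phi> c'" for c c'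
    using \<phi>_sgn[OF that] car_sgn[of c] car_sgn[of c'] that(1,2) by (simp add: D_def)
  have vD: "n a \<in> D" if "a \<in> V" for a using car_vertex[OF that] car0 by (auto simp: D_def)
  have eD: "closed_segment (n a) (n b) \<subseteq> D" if ab: "{a, b} \<in> E" for a b
  proof
    fix c assume c: "c \<in> closed_segment (n a) (n b)"
    have "car c = {a} \<or> car c = {b} \<or> car c = {a, b}"
      using car_edge[OF ab c] car_vertex edgeV[OF ab] by auto
    then have "car c \<noteq> {} \<and> card (car c) < 3" using edgeV(3)[OF ab] by (elim disjE) simp_all
    then show "c \<in> D" using car0 unfolding D_def by (cases "c = 0") simp_all
  qed
  define pos where "pos a = \<phi> (n a)" for a
  have "\<exists>a b. e = {a, b}" if "e \<in> E" for e using wf(4)[OF that] by (auto simp: card_2_iff)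
  then obtain A B where AB: "\<And>e. e \<in> E \<Longrightarrow> e = {A e, B e}" by metis
  define \<gamma> where "\<gamma> e = \<phi> \<circ> linepath (n (A e)) (n (B e))" for e
  have ABE: "{A e, B e} \<in> E" if "e \<in> E" for e using AB[OF that] that by simp
  have im: "path_image (\<gamma> e) = \<phi> ` closed_segment (n (A e)) (n (B e))" for e
    by (simp add: \<gamma>_def path_image_compose)
  have arc: "arc (\<gamma> e)" if e: "e \<in> E" for e
    unfolding arc_def
  proof
    let ?a = "A e" and ?b = "B e"
    note ab = ABE[OF e]
    show "path (\<gamma> e)" unfolding \<gamma>_def
      by (rule path_continuous_image[OF _ continuous_on_subset[OF \<phi>_cont]]) (use eD[OF ab] in auto)
    show "inj_on (\<gamma> e) {0..1}"
    proof (rule inj_onI)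
      fix s s' :: real assume s: "s \<in> {0..1}" "s' \<in> {0..1}" "\<gamma> e s = \<gamma> e s'"
      let ?c = "\<lambda>s. (1 - s) *\<^sub>R n ?a + s *\<^sub>R n ?b"
      have "?c r \<in> closed_segment (n ?a) (n ?b)" if "r \<in> {0..1}" for r
        using that by (auto simp: in_segment)
      then have inD: "?c s \<in> D" "?c s' \<in> D" using eD[OF ab] s(1,2) by blast+
      have "\<phi> (?c s) = \<phi> (?c s')" using s(3) by (simp add: \<gamma>_def linepath_def)
      then have eq: "sgn (?c s) = sgn (?c s')" by (rule \<phi>_sgn[OF inD])
      define k where "k = norm (?c s') / norm (?c s)"
      have "?c s \<noteq> 0" "?c s' \<noteq> 0" using inD by (auto simp: D_def)
      have "k *\<^sub>R ?c s = norm (?c s') *\<^sub>R sgn (?c s)" by (simp add: k_def sgn_div_norm divide_inverse)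
      also have "\<dots> = ?c s'" unfolding eq using \<open>?c s' \<noteq> 0\<close> by (simp add: sgn_div_norm)
      finally have k: "k *\<^sub>R ?c s = ?c s'" .
      obtain t0 where t0: "t0 \<in> F" "?a \<in> t0" "?b \<in> t0" using inter2[OF ab] by blast
      obtain t1 where t1: "t1 \<in> F" "?a \<in> t1" "?b \<notin> t1"
        using stacked_face_avoiding[OF S, of ?a ?b] edgeV[OF ab] by metis
      obtain t2 where t2: "t2 \<in> F" "?b \<in> t2" "?a \<notin> t2"
        using stacked_face_avoiding[OF S, of ?b ?a] edgeV[OF ab] by metis
      note V = edgeV(1,2)[OF ab]
      have A0: "affval (N ?a) (p t0) = 0" "affval (N ?b) (p t0) = 0" "affval (N ?a) (p t1) = 0"
        "affval (N ?b) (p t1) \<noteq> 0" "affval (N ?b) (p t2) = 0" "affval (N ?a) (p t2) \<noteq> 0"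
        using N1 V t0 t1 t2 by auto
      \<comment> \<open>Against these differences of corners, the point with parameter
        \<open>s\<close> takes the values \<open>s\<close> and \<open>1 - s\<close> up to fixed
        nonzero factors. Hence \<open>k * s = s'\<close> and \<open>k * (1 - s) = 1 - s'\<close>,
        and adding the two gives \<open>k = 1\<close>.\<close>
      have ca: "?c s \<bullet> (p t1 - p t0) = s * affval (N ?b) (p t1)"
        "?c s \<bullet> (p t2 - p t0) = (1 - s) * affval (N ?a) (p t2)" for s
        using A0 by (simp_all add: inner_add_left inner_diff_right n algebra_simps)
      have "k * s = s'" using arg_cong[OF k, of "\<lambda>c. c \<bullet> (p t1 - p t0)"] A0 unfolding inner_scaleR_left ca by simp
      moreover have "k * (1 - s) = 1 - s'"
        using arg_cong[OF k, of "\<lambda>c. c \<bullet> (p t2 - p t0)"] A0 unfolding inner_scaleR_left ca by simp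
      ultimately have "k = 1" by (simp add: algebra_simps)
      then show "s = s'" using \<open>k * s = s'\<close> by simp
    qed
  qed
  have ends: "{pathstart (\<gamma> e), pathfinish (\<gamma> e)} = pos ` e" if e: "e \<in> E" for e
  proof -
    have "pathstart (\<gamma> e) = pos (A e)" "pathfinish (\<gamma> e) = pos (B e)"
      by (simp_all add: \<gamma>_def pathstart_compose pathfinish_compose pos_def)
    moreover have "pos ` e = pos ` {A e, B e}" using AB[OF e] by (rule arg_cong)
    ultimately show ?thesis by simp
  qed
  \<comment> \<open>A point of an arc is either the position of an end, with a one-element carrier,
    or has the whole edge as its carrier. Comparing carriers then leaves only common ends where
    different arcs meet.\<close>
  have pts: "(\<exists>v\<in>e. z = pos v \<and> car c = {v}) \<or> car c = e"
    if e: "e \<in> E" and c: "c \<in> closed_segment (n (A e)) (n (B e))" "z = \<phi> c" for e z c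
  proof -
    have mem: "A e \<in> e" "B e \<in> e" by (subst (2) AB[OF e], simp)+
    note V = edgeV(1,2)[OF ABE[OF e]]
    consider "c = n (A e)" | "c = n (B e)" | "car c = {A e, B e}" using car_edge[OF ABE[OF e] c(1)] by metis
    then show ?thesis
    proof cases
      case 1
      then have "z = pos (A e)" "car c = {A e}" using c(2) car_vertex[OF V(1)] by (simp_all add: pos_def)
      then show ?thesis using mem by (intro disjI1 bexI[of _ "A e"]) simp_all
    next
      case 2
      then have "z = pos (B e)" "car c = {B e}" using c(2) car_vertex[OF V(2)] by (simp_all add: pos_def)
      then show ?thesis using mem by (intro disjI1 bexI[of _ "B e"]) simp_all
    next
      case 3
      then show ?thesis using AB[OF e] by simp
    qed
  qed
  have pos_in: "pos ` e \<subseteq> path_image (\<gamma> e)" if e: "e \<in> E" for e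
    unfolding ends[OF e, symmetric]
    using pathstart_in_path_image[of "\<gamma> e"] pathfinish_in_path_image[of "\<gamma> e"] by blast
  have arcpos: "path_image (\<gamma> e) \<inter> pos ` V = pos ` e" if e: "e \<in> E" for e
  proof
    show "path_image (\<gamma> e) \<inter> pos ` V \<subseteq> pos ` e"
    proof
      fix z assume "z \<in> path_image (\<gamma> e) \<inter> pos ` V"
      then obtain c v where c: "c \<in> closed_segment (n (A e)) (n (B e))" "z = \<phi> c" and v: "v \<in> V" "z = \<phi> (n v)"
        unfolding im pos_def by blast
      have "car c = car (n v)" by (rule \<phi>_car) (use c v eD[OF ABE[OF e]] vD in auto)
      then have "car c = {v}" using car_vertex[OF v(1)] by simp
      moreover have "e \<noteq> {v}" using wf(4)[OF e] by auto
      ultimately show "z \<in> pos ` e" using pts[OF e c] by auto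
    qed
    show "pos ` e \<subseteq> path_image (\<gamma> e) \<inter> pos ` V" using pos_in[OF e] wf(3)[OF e] by blast
  qed
  have cross: "path_image (\<gamma> e) \<inter> path_image (\<gamma> e') = pos ` (e \<inter> e')"
    if e: "e \<in> E" and e': "e' \<in> E" and "e \<noteq> e'" for e e'
  proof
    show "pos ` (e \<inter> e') \<subseteq> path_image (\<gamma> e) \<inter> path_image (\<gamma> e')" using pos_in[OF e] pos_in[OF e'] by blast
    show "path_image (\<gamma> e) \<inter> path_image (\<gamma> e') \<subseteq> pos ` (e \<inter> e')"
    proof
      fix z assume "z \<in> path_image (\<gamma> e) \<inter> path_image (\<gamma> e')"
      then obtain c c' where c: "c \<in> closed_segment (n (A e)) (n (B e))" "z = \<phi> c"
        and c': "c' \<in> closed_segment (n (A e')) (n (B e'))" "z = \<phi> c'" unfolding im by blast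
      have eq: "car c = car c'" by (rule \<phi>_car) (use c c' eD[OF ABE[OF e]] eD[OF ABE[OF e']] in auto)
      have ne: "e \<noteq> {v}" "e' \<noteq> {v}" for v using wf(4)[OF e] wf(4)[OF e'] by auto
      from pts[OF e c] show "z \<in> pos ` (e \<inter> e')"
      proof
        assume "\<exists>v\<in>e. z = pos v \<and> car c = {v}"
        then obtain v where v: "v \<in> e" "z = pos v" "car c = {v}" by blast
        then have "v \<in> e'" using pts[OF e' c'] eq ne by auto
        then show ?thesis using v by blast
      next
        assume "car c = e"
        then show ?thesis using pts[OF e' c'] eq ne \<open>e \<noteq> e'\<close> by auto
      qed
    qed
  qed
  have "inj_on pos V"
    by (rule inj_onI) (use \<phi>_car vD car_vertex in \<open>metis pos_def singleton_inject\<close>)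
  then show ?thesis
    unfolding planar_def fst_conv snd_conv using arc ends arcpos cross
    by (intro exI[of _ pos] exI[of _ \<gamma>] conjI ballI impI)
qed

subsection \<open>Three mutually adjacent convex polygons\<close>

text \<open>The coefficients range over a space of dimension five, so the linear combination cannot
  depend on them injectively.\<close>

lemma five_vectors_dependent:
  fixes v1 v2 v3 v4 v5 :: "'b::euclidean_space"
  assumes "DIM('b) \<le> 4"
  obtains c1 c2 c3 c4 c5 :: real where "(c1, c2, c3, c4, c5) \<noteq> (0, 0, 0, 0, 0)"
    "c1 *\<^sub>R v1 + c2 *\<^sub>R v2 + c3 *\<^sub>R v3 + c4 *\<^sub>R v4 + c5 *\<^sub>R v5 = 0"
proof -
  define T :: "real \<times> real \<times> real \<times> real \<times> real \<Rightarrow> 'b" where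
    "T = (\<lambda>(c1, c2, c3, c4, c5). c1 *\<^sub>R v1 + c2 *\<^sub>R v2 + c3 *\<^sub>R v3 + c4 *\<^sub>R v4 + c5 *\<^sub>R v5)"
  have lin: "linear T" by (rule linearI) (auto simp: T_def algebra_simps)
  have "\<not> inj T"
  proof
    assume "inj T"
    then have "dim (range T) = dim (UNIV :: (real \<times> real \<times> real \<times> real \<times> real) set)"
      by (intro dim_image_eq[OF lin]) (auto intro: inj_on_subset)
    moreover have "dim (range T) \<le> DIM('b)" by (rule dim_subset_UNIV)
    ultimately show False using assms by simp
  qed
  then obtain c where "T c = 0" "c \<noteq> 0" using linear_injective_0[OF lin] by blast
  then show ?thesis using that[of "fst c" "fst (snd c)" "fst (snd (snd c))" "fst (snd (snd (snd c)))"
        "snd (snd (snd (snd c)))"] by (cases c) (auto simp: T_def zero_prod_def)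
qed

text \<open>The planes \<open>g\<close> bound a trihedral cone (possibly with its apex at infinity), whose faces
  carry three mutually adjacent polygons. Two planes \<open>f\<close> passing these polygons on the same side,
  towards the apex or away from it, would have to cross within all three faces.\<close>

lemma no_three_caps:
  fixes g f :: "nat \<Rightarrow> 'b::euclidean_space \<times> real" and a :: "nat \<Rightarrow> 'b" and q :: "nat \<Rightarrow> nat \<Rightarrow> 'b"
  assumes dim: "DIM('b) \<le> 3"
    and ga: "\<And>l k. l < 3 \<Longrightarrow> k < 3 \<Longrightarrow> affval (g l) (a k) \<ge> 0 \<and> (affval (g l) (a k) = 0 \<longleftrightarrow> l \<noteq> k)"
    and gq: "\<And>l k i. l < 3 \<Longrightarrow> k < 3 \<Longrightarrow> i < 3 \<Longrightarrow>
      affval (g l) (q k i) \<ge> 0 \<and> (affval (g l) (q k i) = 0 \<longleftrightarrow> l = k)"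
    and fq: "\<And>j k i. j < 3 \<Longrightarrow> k < 3 \<Longrightarrow> i < 3 \<Longrightarrow>
      affval (f j) (q k i) \<ge> 0 \<and> (affval (f j) (q k i) = 0 \<longleftrightarrow> j = i)"
  shows False
proof -
  have gpos: "affval (g l) (q k i) > 0" if "l < 3" "k < 3" "i < 3" "l \<noteq> k" for l k i
    using gq[OF that(1-3)] that(4) by linarith
  have fpos: "affval (f j) (q k i) > 0" if "j < 3" "k < 3" "i < 3" "j \<noteq> i" for j k i
    using fq[OF that(1-3)] that(4) by linarith
  have lt: "(0::nat) < 3" "(1::nat) < 3" "(2::nat) < 3" by simp_all
  note gz = gq[THEN conjunct2, THEN iffD2] and fz = fq[THEN conjunct2, THEN iffD2]
  have az: "affval (g l) (a k) = 0" if "l < 3" "k < 3" "l \<noteq> k" for l k using ga[OF that(1,2)] that(3) by simp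
  have ap: "affval (g k) (a k) > 0" if "k < 3" for k using ga[OF that that] by linarith
  define comb where "comb c0 c1 c2 x i y j z =
      c0 * affval (g 0) z + c1 * affval (g 1) z + c2 * affval (g 2) z + x * affval (f i) z + y * affval (f j) z"
    for c0 c1 c2 x y :: real and i j :: nat and z
  define rel where "rel c0 c1 c2 x i y j \<longleftrightarrow> (\<forall>z. comb c0 c1 c2 x i y j z = 0)"
    for c0 c1 c2 x y :: real and i j :: nat
  \<comment> \<open>At \<open>q k i\<close> the functions \<open>g k\<close> and \<open>f i\<close>
    vanish and the term of \<open>f j\<close> is nonpositive, so the other two \<open>g\<close>,
    which are positive there, have a nonnegative weighted sum. At \<open>q k j\<close> the
    corresponding sum is nonpositive.\<close>
  have opp: False if ij: "i < 3" "j < 3" "i \<noteq> j" and xy: "x \<ge> 0" "y \<le> 0" "(x, y) \<noteq> (0, 0)"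
    and rel: "rel c0 c1 c2 x i y j" for i j x y c0 c1 c2
  proof -
    note r = rel[unfolded rel_def comb_def, rule_format]
    have yf: "y * affval (f j) (q k i) \<le> 0" and xf: "x * affval (f i) (q k j) \<ge> 0" if "k < 3" for k
      using fpos[of j k i] fpos[of i k j] ij that xy by (simp_all add: mult_nonpos_nonneg)
    have z: "affval (g k) (q k l) = 0" if "k < 3" "l < 3" for k l using gz that by blast
    have zf: "affval (f l) (q k l) = 0" if "k < 3" "l < 3" for k l using fz that by blast
    have i0: "c1 * affval (g 1) (q 0 i) + c2 * affval (g 2) (q 0 i) \<ge> 0"
      "c0 * affval (g 0) (q 1 i) + c2 * affval (g 2) (q 1 i) \<ge> 0"
      "c0 * affval (g 0) (q 2 i) + c1 * affval (g 1) (q 2 i) \<ge> 0"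
      using r[of "q 0 i"] r[of "q 1 i"] r[of "q 2 i"] yf[OF lt(1)] yf[OF lt(2)] yf[OF lt(3)]
      unfolding z[OF lt(1) ij(1)] z[OF lt(2) ij(1)] z[OF lt(3) ij(1)]
        zf[OF lt(1) ij(1)] zf[OF lt(2) ij(1)] zf[OF lt(3) ij(1)] by linarith+
    have j0: "c1 * affval (g 1) (q 0 j) + c2 * affval (g 2) (q 0 j) \<le> 0"
      "c0 * affval (g 0) (q 1 j) + c2 * affval (g 2) (q 1 j) \<le> 0"
      "c0 * affval (g 0) (q 2 j) + c1 * affval (g 1) (q 2 j) \<le> 0"
      using r[of "q 0 j"] r[of "q 1 j"] r[of "q 2 j"] xf[OF lt(1)] xf[OF lt(2)] xf[OF lt(3)]
      unfolding z[OF lt(1) ij(2)] z[OF lt(2) ij(2)] z[OF lt(3) ij(2)]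
        zf[OF lt(1) ij(2)] zf[OF lt(2) ij(2)] zf[OF lt(3) ij(2)] by linarith+
    have sg: "\<not> (c > 0 \<and> d \<ge> 0) \<and> \<not> (c \<ge> 0 \<and> d > 0)"
      if "c * s + d * t \<le> 0" "s > 0" "t > 0" for c d s t :: real
      using that by (smt (verit) mult_nonneg_nonneg mult_pos_pos)
    have sg': "\<not> (c < 0 \<and> d \<le> 0) \<and> \<not> (c \<le> 0 \<and> d < 0)"
      if "c * s + d * t \<ge> 0" "s > 0" "t > 0" for c d s t :: real
      using sg[of "- c" s "- d" t] that by simp
    have P: "\<not> (c1 > 0 \<and> c2 \<ge> 0) \<and> \<not> (c1 \<ge> 0 \<and> c2 > 0)" "\<not> (c0 > 0 \<and> c2 \<ge> 0) \<and> \<not> (c0 \<ge> 0 \<and> c2 > 0)"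
      "\<not> (c0 > 0 \<and> c1 \<ge> 0) \<and> \<not> (c0 \<ge> 0 \<and> c1 > 0)"
      using sg[OF j0(1)] sg[OF j0(2)] sg[OF j0(3)] gpos ij(2) lt by simp_all
    have Q: "\<not> (c1 < 0 \<and> c2 \<le> 0) \<and> \<not> (c1 \<le> 0 \<and> c2 < 0)" "\<not> (c0 < 0 \<and> c2 \<le> 0) \<and> \<not> (c0 \<le> 0 \<and> c2 < 0)"
      "\<not> (c0 < 0 \<and> c1 \<le> 0) \<and> \<not> (c0 \<le> 0 \<and> c1 < 0)"
      using sg'[OF i0(1)] sg'[OF i0(2)] sg'[OF i0(3)] gpos ij(1) lt by simp_all
    \<comment> \<open>Any two of the coefficients are both zero or have strictly opposite signs.
      Three numbers cannot have pairwise opposite signs, so all of them vanish.\<close>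
    have c: "c0 = 0" "c1 = 0" "c2 = 0" using P Q by linarith+
    have "y * affval (f j) (q 0 i) = 0" "x * affval (f i) (q 0 j) = 0"
      using r[of "q 0 i"] r[of "q 0 j"] c ij lt fz by simp_all
    then show False using fpos[of j 0 i] fpos[of i 0 j] ij lt xy(3) by simp
  qed
  have ex: "\<exists>c0 c1 c2 x. x > 0 \<and> rel c0 c1 c2 1 i x j" if ij: "i < 3" "j < 3" "i \<noteq> j" for i j
  proof -
    have "DIM('b \<times> real) \<le> 4" using dim by simp
    then obtain c0 c1 c2 x y :: real where c: "(c0, c1, c2, x, y) \<noteq> (0, 0, 0, 0, 0)"
      "c0 *\<^sub>R g 0 + c1 *\<^sub>R g 1 + c2 *\<^sub>R g 2 + x *\<^sub>R f i + y *\<^sub>R f j = 0"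
      using five_vectors_dependent by blast
    have "comb c0 c1 c2 x i y j z = 0" for z
    proof -
      have "affval (c0 *\<^sub>R g 0 + c1 *\<^sub>R g 1 + c2 *\<^sub>R g 2 + x *\<^sub>R f i + y *\<^sub>R f j) z = 0"
        unfolding c(2) by (rule affval_zero)
      then show ?thesis by (simp add: comb_def affval_add affval_scaleR)
    qed
    then have rel: "rel c0 c1 c2 x i y j" by (simp add: rel_def)
    note r = rel[unfolded rel_def comb_def, rule_format]
    \<comment> \<open>\<open>a k\<close> lies on two of the planes \<open>g\<close> and off the
      third, so the three \<open>g\<close> are independent and the relation must involve an
      \<open>f\<close>.\<close>
    have xy: "(x, y) \<noteq> (0, 0)"
    proof
      assume "(x, y) = (0, 0)"
      then have "c0 = 0" "c1 = 0" "c2 = 0"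
        using r[of "a 0"] r[of "a 1"] r[of "a 2"] az ap[of 0] ap[of 1] ap[of 2] by simp_all
      then show False using c(1) \<open>(x, y) = (0, 0)\<close> by simp
    qed
    have neg: "rel (- c0) (- c1) (- c2) (- x) i (- y) j" 
    proof -
      have "comb (- c0) (- c1) (- c2) (- x) i (- y) j z = - comb c0 c1 c2 x i y j z" for z by (simp add: comb_def)
      then show ?thesis using rel by (simp add: rel_def)
    qed
    \<comment> \<open>At a common zero of the \<open>g\<close>, if there is one, such a relation
      says that \<open>f i\<close> and \<open>f j\<close> have opposite signs or both
      vanish.\<close>
    have "x * y > 0"
    proof (rule ccontr)
      assume "\<not> x * y > 0"
      then have "x \<ge> 0 \<and> y \<le> 0 \<or> x \<le> 0 \<and> y \<ge> 0" by (auto simp: zero_less_mult_iff)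
      then show False using opp[OF ij _ _ xy rel] opp[OF ij _ _ _ neg] xy by auto
    qed
    then have "x \<noteq> 0" "y / x > 0" by (auto simp: zero_less_mult_iff zero_less_divide_iff)
    moreover have "rel (c0 / x) (c1 / x) (c2 / x) 1 i (y / x) j"
      unfolding rel_def
    proof
      fix z
      have "comb (c0 / x) (c1 / x) (c2 / x) 1 i (y / x) j z = comb c0 c1 c2 x i y j z / x"
        using \<open>x \<noteq> 0\<close> by (simp add: comb_def add_divide_distrib)
      then show "comb (c0 / x) (c1 / x) (c2 / x) 1 i (y / x) j z = 0" using rel by (simp add: rel_def)
    qed
    ultimately show ?thesis by blast
  qed
  obtain c0 c1 c2 x where x: "x > 0" "rel c0 c1 c2 1 0 x 1" using ex[of 0 1] by auto
  obtain d0 d1 d2 y where y: "y > 0" "rel d0 d1 d2 1 1 y 2" using ex[of 1 2] by auto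
  \<comment> \<open>Eliminating \<open>f 1\<close> gives \<open>f 0\<close> and \<open>f 2\<close>
    coefficients of opposite signs. This takes the place of the pigeonhole argument on the two sides
    of the apex, which need not exist.\<close>
  have "rel (c0 - x * d0) (c1 - x * d1) (c2 - x * d2) 1 0 (- (x * y)) 2"
    unfolding rel_def
  proof
    fix z
    have "comb (c0 - x * d0) (c1 - x * d1) (c2 - x * d2) 1 0 (- (x * y)) 2 z =
        comb c0 c1 c2 1 0 x 1 z - x * comb d0 d1 d2 1 1 y 2 z"
      by (simp add: comb_def algebra_simps)
    then show "comb (c0 - x * d0) (c1 - x * d1) (c2 - x * d2) 1 0 (- (x * y)) 2 z = 0"
      using x(2) y(2) by (simp add: rel_def)
  qed
  then show False using opp[of 0 2 1 "- (x * y)"] x(1) y(1) by simp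
qed

section \<open>Adjacent polygons of a fixed convex surface\<close>

context
  fixes \<S> :: "corner_list set"
  assumes surf: "convex_polyhedral_surface \<S>"
begin

lemma surf_convex_polygon: "P \<in> \<S> \<Longrightarrow> strictly_convex_polygon P"
  using surf unfolding convex_polyhedral_surface_def by (elim conjE) (rule bspec)

lemma surf_region: "P \<in> \<S> \<Longrightarrow> region P = convex hull set P"
  by (rule region_eq_hull[OF surf_convex_polygon])

lemma surf_aff_dim: "P \<in> \<S> \<Longrightarrow> aff_dim (set P) = 2"
  using surf_convex_polygon[of P] unfolding strictly_convex_polygon_def polygon_def by simp

lemma surf_extreme: "P \<in> \<S> \<Longrightarrow> c \<in> set P \<Longrightarrow> c extreme_point_of region P"
  using surf_convex_polygon[of P] unfolding strictly_convex_polygon_def by simp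

lemma surf_affine_hull: "P \<in> \<S> \<Longrightarrow> affine hull region P = affine hull set P"
  by (simp add: surf_region affine_hull_convex_hull)

lemma surf_side:
  assumes "P \<in> \<S>" "s \<in> sides P"
  obtains a b where "a \<in> set P" "b \<in> set P" "a \<noteq> b" "s = closed_segment a b"
proof -
  obtain i where i: "i < length P" "s = side P i" using assms(2) by (auto simp: sides_def)
  have "distinct P" "3 \<le> length P"
    using surf_convex_polygon[OF assms(1)] by (auto simp: strictly_convex_polygon_def polygon_def)
  then have "P ! i \<noteq> next_corner P i"
    using i(1) Suc_mod_less[OF i(1)] Suc_mod_neq(1)[OF i(1)] by (auto simp: nth_eq_iff_index_eq)
  then show ?thesis using that[of "P ! i" "next_corner P i"] i next_corner_in_set[OF i(1)] by (simp add: side_def)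
qed

text \<open>A common side has two ends, which rules out that the regions meet in a single
  corner.\<close>

lemma surf_adjacent_inter:
  assumes PQ: "P \<in> \<S>" "Q \<in> \<S>" "P \<noteq> Q" and adj: "sides P \<inter> sides Q \<noteq> {}"
  shows "region P \<inter> region Q \<in> sides P \<inter> sides Q"
proof -
  obtain s where s: "s \<in> sides P" "s \<in> sides Q" using adj by blast
  obtain a b where ab: "a \<noteq> b" "s = closed_segment a b" using surf_side[OF PQ(1) s(1)] by metis
  have "s \<subseteq> region P \<inter> region Q" using s by (auto simp: region_def boundary_chain_def)
  then have in2: "a \<in> region P \<inter> region Q" "b \<in> region P \<inter> region Q" unfolding ab(2) by auto
  then have "region P \<inter> region Q \<noteq> {}" by blast
  then have "(\<exists>c \<in> set P \<inter> set Q. region P \<inter> region Q = {c}) \<or> region P \<inter> region Q \<in> sides P \<inter> sides Q"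
    using surf PQ unfolding convex_polyhedral_surface_def polyhedral_surface_def by blast
  then show ?thesis using in2 ab(1) by (metis singletonD)
qed

text \<open>The midpoint of the shared side works: a third polygon could meet both others only in a
  corner, which is extreme, and the midpoint is not. These points turn adjacencies into positions at
  which signs can be compared.\<close>

lemma surf_adjacent_point:
  assumes PQ: "P \<in> \<S>" "Q \<in> \<S>" "P \<noteq> Q" and adj: "sides P \<inter> sides Q \<noteq> {}"
  obtains m where "\<And>R. R \<in> \<S> \<Longrightarrow> m \<in> region R \<longleftrightarrow> R = P \<or> R = Q"
proof -
  have s: "region P \<inter> region Q \<in> sides P" using surf_adjacent_inter[OF assms] by blast
  obtain a b where ab: "a \<noteq> b" "region P \<inter> region Q = closed_segment a b" using surf_side[OF PQ(1) s] by metis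
  define m where "m = midpoint a b"
  have m: "m \<in> open_segment a b" using ab(1) by (simp add: m_def)
  then have mPQ: "m \<in> region P \<inter> region Q" unfolding ab(2) by (simp add: open_segment_def)
  have "m \<notin> region R" if R: "R \<in> \<S>" "R \<noteq> P" "R \<noteq> Q" for R
  proof
    assume "m \<in> region R"
    then have ne: "region P \<inter> region Q \<inter> region R \<noteq> {}" using mPQ by blast
    have tri: "\<forall>P\<in>\<S>. \<forall>Q\<in>\<S>. \<forall>R\<in>\<S>. P \<noteq> Q \<longrightarrow> P \<noteq> R \<longrightarrow> Q \<noteq> R \<longrightarrow>
        region P \<inter> region Q \<inter> region R \<noteq> {} \<longrightarrow>
        (\<exists>c \<in> set P \<inter> set Q \<inter> set R. region P \<inter> region Q \<inter> region R = {c})"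
      using surf unfolding convex_polyhedral_surface_def polyhedral_surface_def by (elim conjE)
    obtain c where c: "c \<in> set P \<inter> set Q \<inter> set R" "region P \<inter> region Q \<inter> region R = {c}"
      using tri[rule_format, OF PQ(1,2) R(1) PQ(3) R(2,3)[symmetric] ne] by blast
    have "m = c" using c(2) mPQ \<open>m \<in> region R\<close> by blast
    then have "m extreme_point_of region P" using surf_extreme[OF PQ(1)] c(1) by blast
    moreover have "a \<in> region P" "b \<in> region P" using ab(2) by auto
    ultimately show False using m unfolding extreme_point_of_def by blast
  qed
  then show ?thesis using that[of m] mPQ by blast
qed

lemma surf_plane:
  assumes "Q \<in> \<S>"
  obtains f where "affine hull set Q = {x. affval f x = 0}"
proof -
  have "\<exists>a b. a \<noteq> 0 \<and> affine hull set Q = {x. a \<bullet> x = b}"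
    by (subst aff_dim_eq_hyperplane[symmetric]) (simp add: surf_aff_dim[OF assms])
  then obtain a b where "affine hull set Q = {x. a \<bullet> x = b}" by blast
  then have "affine hull set Q = {x. affval (a, - b) x = 0}" by (auto simp: affval_def)
  then show ?thesis using that by blast
qed

text \<open>The plane of \<open>Q\<close> contains the shared side but not all of \<open>P\<close>,
  so it supports \<open>P\<close> along this side and meets \<open>P\<close> nowhere else.\<close>

lemma surf_adjacent_supports:
  assumes PQ: "P \<in> \<S>" "Q \<in> \<S>" "P \<noteq> Q" "sides P \<inter> sides Q \<noteq> {}"
    and ncop: "affine hull set P \<noteq> affine hull set Q"
    and f: "affine hull set Q = {x. affval f x = 0}"
  obtains \<sigma> :: real where "\<sigma> = 1 \<or> \<sigma> = - 1" "\<And>x. x \<in> region P \<Longrightarrow> \<sigma> * affval f x \<ge> 0"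
    "\<And>x. x \<in> region P \<Longrightarrow> affval f x = 0 \<longleftrightarrow> x \<in> region Q"
proof -
  have s: "region P \<inter> region Q \<in> sides P" using surf_adjacent_inter[OF PQ] by blast
  have Qf: "affval f x = 0" if "x \<in> region Q" for x
    using that f surf_affine_hull[OF PQ(2)] hull_subset[of "region Q" affine] by blast
  obtain z where z: "z \<in> set P" "affval f z \<noteq> 0"
  proof (rule ccontr)
    assume n: "\<not> thesis"
    have "set P \<subseteq> affine hull set Q" using n that f by blast
    then have "affine hull set P \<subseteq> affine hull set Q" by (intro hull_minimal) auto
    moreover have "affine hull set P \<noteq> {}"
    proof
      assume "affine hull set P = {}"
      then have "set P = {}" by simp
      then show False using surf_aff_dim[OF PQ(1)] by simp
    qed
    ultimately have "affine hull set P = affine hull set Q"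
      using surf_aff_dim PQ by (intro affine_dim_equal) auto
    then show False using ncop by simp
  qed
  have "z \<in> region P" using z surf_region[OF PQ(1)] by (simp add: hull_inc)
  from side_supports_region[OF surf_convex_polygon[OF PQ(1)] s _ this z(2)]
  obtain \<sigma> :: real where "\<sigma> = 1 \<or> \<sigma> = - 1" "\<And>x. x \<in> region P \<Longrightarrow> \<sigma> * affval f x \<ge> 0"
    "\<And>x. x \<in> region P \<Longrightarrow> affval f x = 0 \<longleftrightarrow> x \<in> region P \<inter> region Q"
    using Qf by (metis IntD2)
  then show ?thesis using that by blast
qed

text \<open>If \<open>R\<close> left the common plane, it would meet this plane only within
  \<open>P\<close>. But a point of the side shared by \<open>R\<close> and \<open>Q\<close> lies in
  the plane and not on \<open>P\<close>.\<close>

lemma surf_coplanar_triangle: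
  assumes PQR: "P \<in> \<S>" "Q \<in> \<S>" "R \<in> \<S>" "P \<noteq> Q" "P \<noteq> R" "Q \<noteq> R"
    and adj: "sides R \<inter> sides P \<noteq> {}" "sides R \<inter> sides Q \<noteq> {}"
    and cop: "affine hull set P = affine hull set Q"
  shows "affine hull set R = affine hull set P"
proof (rule ccontr)
  assume ncop: "affine hull set R \<noteq> affine hull set P"
  obtain f where f: "affine hull set P = {x. affval f x = 0}" by (rule surf_plane[OF PQR(1)])
  obtain \<sigma> :: real where \<sigma>: "\<And>x. x \<in> region R \<Longrightarrow> affval f x = 0 \<longleftrightarrow> x \<in> region P"
    using surf_adjacent_supports[OF PQR(3,1) PQR(5)[symmetric] adj(1) ncop f] by metis
  obtain m where m: "\<And>T. T \<in> \<S> \<Longrightarrow> m \<in> region T \<longleftrightarrow> T = R \<or> T = Q"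
    by (rule surf_adjacent_point[OF PQR(3,2) PQR(6)[symmetric] adj(2)]) blast
  have mR: "m \<in> region R" "m \<in> region Q" "m \<notin> region P" using m PQR by auto
  have "m \<in> affine hull set Q" using mR(2) surf_affine_hull[OF PQR(2)] hull_subset[of "region Q" affine] by blast
  then have "affval f m = 0" using f cop by blast
  then show False using \<sigma>[OF mR(1)] mR(3) by simp
qed

text \<open>Each member of \<open>K\<close> lies on one side of the plane of \<open>Q\<close>. It is
  the same side for all, because two members share a side with a point off \<open>Q\<close>, at
  which the function is nonzero and both signs can be read.\<close>

lemma surf_functional:
  assumes Q: "Q \<in> \<S>" and K: "K \<subseteq> \<S>" "Q \<notin> K" "K \<noteq> {}"
    and adj: "\<And>P. P \<in> K \<Longrightarrow> sides P \<inter> sides Q \<noteq> {}"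
    and ncop: "\<And>P. P \<in> K \<Longrightarrow> affine hull set P \<noteq> affine hull set Q"
    and adjK: "\<And>P P'. P \<in> K \<Longrightarrow> P' \<in> K \<Longrightarrow> P \<noteq> P' \<Longrightarrow> sides P \<inter> sides P' \<noteq> {}"
  obtains f where "\<And>x. x \<in> region Q \<Longrightarrow> affval f x = 0"
    "\<And>P x. P \<in> K \<Longrightarrow> x \<in> region P \<Longrightarrow> affval f x \<ge> 0 \<and> (affval f x = 0 \<longleftrightarrow> x \<in> region Q)"
proof -
  obtain f where f: "affine hull set Q = {x. affval f x = 0}" by (rule surf_plane[OF Q])
  have Qf: "affval f x = 0" if "x \<in> region Q" for x
    using that f surf_affine_hull[OF Q] hull_subset[of "region Q" affine] by blast
  have ex: "\<exists>\<sigma>::real. (\<sigma> = 1 \<or> \<sigma> = - 1) \<and> (\<forall>x\<in>region P. \<sigma> * affval f x \<ge> 0 \<and> (affval f x = 0 \<longleftrightarrow> x \<in> region Q))"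
    if P: "P \<in> K" for P
  proof -
    have "P \<in> \<S>" "P \<noteq> Q" using P K by auto
    then show ?thesis using surf_adjacent_supports[OF _ Q _ adj[OF P] ncop[OF P] f] by metis
  qed
  obtain P0 where P0: "P0 \<in> K" using K(3) by blast
  obtain \<sigma> :: real where \<sigma>: "\<sigma> = 1 \<or> \<sigma> = - 1"
    "\<forall>x\<in>region P0. \<sigma> * affval f x \<ge> 0 \<and> (affval f x = 0 \<longleftrightarrow> x \<in> region Q)" using ex[OF P0] by blast
  have all: "\<sigma> * affval f x \<ge> 0 \<and> (affval f x = 0 \<longleftrightarrow> x \<in> region Q)" if P: "P \<in> K" and x: "x \<in> region P" for P x
  proof (cases "P = P0")
    case True
    then show ?thesis using \<sigma>(2) x by blast
  next
    case False
    obtain \<tau> :: real where \<tau>: "\<tau> = 1 \<or> \<tau> = - 1"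
      "\<forall>x\<in>region P. \<tau> * affval f x \<ge> 0 \<and> (affval f x = 0 \<longleftrightarrow> x \<in> region Q)" using ex[OF P] by blast
    have "P \<in> \<S>" "P0 \<in> \<S>" using K P P0 by auto
    from surf_adjacent_point[OF this False adjK[OF P P0 False]]
    obtain m where m: "\<And>R. R \<in> \<S> \<Longrightarrow> m \<in> region R \<longleftrightarrow> R = P \<or> R = P0" by metis
    have "m \<in> region P" "m \<in> region P0" "m \<notin> region Q" using m \<open>P \<in> \<S>\<close> \<open>P0 \<in> \<S>\<close> Q K(2) P P0 by auto
    then have "\<sigma> * affval f m \<ge> 0" "\<tau> * affval f m \<ge> 0" "affval f m \<noteq> 0" using \<sigma>(2) \<tau>(2) by auto
    then have "\<tau> = \<sigma>" using \<sigma>(1) \<tau>(1) by auto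
    then show ?thesis using \<tau>(2) x by blast
  qed
  show ?thesis
  proof (rule that[of "\<sigma> *\<^sub>R f"])
    show "affval (\<sigma> *\<^sub>R f) x = 0" if "x \<in> region Q" for x using Qf[OF that] by (simp add: affval_scaleR)
    show "affval (\<sigma> *\<^sub>R f) x \<ge> 0 \<and> (affval (\<sigma> *\<^sub>R f) x = 0 \<longleftrightarrow> x \<in> region Q)"
      if "P \<in> K" "x \<in> region P" for P x using all[OF that] \<sigma>(1) by (auto simp: affval_scaleR)
  qed
qed

end

section \<open>Drawing coplanar polygons\<close>

text \<open>\<open>rel_interior S\<close> is open in the common affine hull, and the convex set
  \<open>T\<close> lies in the closure of its relative interior. So a point of \<open>T\<close> in
  that open set would bring relative interior points of \<open>T\<close> with it.\<close>

lemma rel_interiors_disjoint: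
  fixes S T :: "'b::euclidean_space set"
  assumes "convex T" "affine hull S = affine hull T" "rel_interior S \<inter> rel_interior T = {}"
  shows "rel_interior S \<inter> T = {}"
proof (rule ccontr)
  assume "rel_interior S \<inter> T \<noteq> {}"
  then obtain x where x: "x \<in> rel_interior S" "x \<in> T" by blast
  have "x \<in> closure (rel_interior T)"
    using x(2) convex_closure_rel_interior[OF assms(1)] closure_subset by blast
  obtain U where U: "open U" "rel_interior S = affine hull S \<inter> U"
    using openin_rel_interior[of S] unfolding openin_open by blast
  then have "U \<inter> rel_interior T \<noteq> {}"
    using x(1) \<open>x \<in> closure (rel_interior T)\<close> open_Int_closure_eq_empty[of U "rel_interior T"] by blast
  then obtain y where "y \<in> U" "y \<in> rel_interior T" by blast
  moreover have "y \<in> affine hull S"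
    using \<open>y \<in> rel_interior T\<close> rel_interior_subset[of T] hull_subset[of T affine] assms(2) by blast
  ultimately show False using U(2) assms(3) by blast
qed

lemma adjacency_edge_iff:
  "{P, Q} \<in> snd (adjacency_graph \<S>) \<longleftrightarrow> P \<in> \<S> \<and> Q \<in> \<S> \<and> P \<noteq> Q \<and> sides P \<inter> sides Q \<noteq> {}"
proof
  assume "{P, Q} \<in> snd (adjacency_graph \<S>)"
  then obtain P' Q' where PQ: "{P, Q} = {P', Q'}" "P' \<in> \<S>" "Q' \<in> \<S>" "P' \<noteq> Q'" "sides P' \<inter> sides Q' \<noteq> {}"
    by (auto simp: adjacency_graph_def)
  from PQ(1) have "P = P' \<and> Q = Q' \<or> P = Q' \<and> Q = P'" by (simp add: doubleton_eq_iff)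
  then show "P \<in> \<S> \<and> Q \<in> \<S> \<and> P \<noteq> Q \<and> sides P \<inter> sides Q \<noteq> {}"
    using PQ(2-5) by (elim disjE conjE) (simp_all add: Int_commute)
next
  assume "P \<in> \<S> \<and> Q \<in> \<S> \<and> P \<noteq> Q \<and> sides P \<inter> sides Q \<noteq> {}"
  then show "{P, Q} \<in> snd (adjacency_graph \<S>)" unfolding adjacency_graph_def snd_conv by blast
qed

text \<open>If the segments met again, they would run along one ray from \<open>c\<close>. The
  nearer of \<open>m\<close> and \<open>m'\<close> would then lie strictly between \<open>c\<close>
  and the other, hence in the relative interior.\<close>

lemma open_segments_disjoint:
  fixes c m m' :: "'b::euclidean_space"
  assumes C: "convex C" and c: "c \<in> rel_interior C" and m: "m \<in> C" "m \<notin> rel_interior C"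
    and m': "m' \<in> C" "m' \<notin> rel_interior C" and "m \<noteq> m'"
    and x: "x \<in> closed_segment c m" "x \<in> closed_segment c m'"
  shows "x = c"
proof (rule ccontr)
  assume "x \<noteq> c"
  have seg: "open_segment c y \<subseteq> rel_interior C" if "y \<in> C" for y
    by (rule rel_interior_closure_convex_segment[OF C c]) (use that closure_subset in blast)
  obtain s where s: "0 \<le> s" "s \<le> 1" "x = (1 - s) *\<^sub>R c + s *\<^sub>R m" using x(1) by (auto simp: in_segment)
  obtain t where t: "0 \<le> t" "t \<le> 1" "x = (1 - t) *\<^sub>R c + t *\<^sub>R m'" using x(2) by (auto simp: in_segment)
  have st: "s > 0" "t > 0" using s t \<open>x \<noteq> c\<close> by (auto simp: less_le)
  have eq: "s *\<^sub>R (m - c) = t *\<^sub>R (m' - c)" using s(3) t(3) by (simp add: algebra_simps)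
  have key: "y \<in> rel_interior C"
    if h: "y' \<in> C" "a *\<^sub>R (y - c) = b *\<^sub>R (y' - c)" "0 < b" "b < a" "y \<noteq> c" for a b :: real and y y'
  proof -
    have "y - c = (b / a) *\<^sub>R (y' - c)"
    proof -
      have "y - c = (1 / a) *\<^sub>R (a *\<^sub>R (y - c))" using h(3,4) by simp
      also have "\<dots> = (b / a) *\<^sub>R (y' - c)" unfolding h(2) by simp
      finally show ?thesis .
    qed
    then have "y = (1 - b / a) *\<^sub>R c + (b / a) *\<^sub>R y'" by (simp add: algebra_simps)
    moreover have "0 < b / a" "b / a < 1" using h(3,4) by auto
    moreover have "c \<noteq> y'" using \<open>y - c = (b / a) *\<^sub>R (y' - c)\<close> h(5) by auto
    ultimately have "y \<in> open_segment c y'" unfolding in_segment by blast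
    then show ?thesis using seg[OF h(1)] by blast
  qed
  have ne: "m \<noteq> c" "m' \<noteq> c" using m m' c by auto
  consider "s < t" | "t < s" | "s = t" by linarith
  then show False
  proof cases
    case 1 then show ?thesis using key[OF m(1) eq[symmetric] st(1) _ ne(2)] m'(2) by blast
  next
    case 2 then show ?thesis using key[OF m'(1) eq st(2) _ ne(1)] m(2) by blast
  next
    case 3 then show ?thesis using eq st \<open>m \<noteq> m'\<close> by simp
  qed
qed

text \<open>Each polygon is drawn as a point of its relative interior, and each edge as two segments
  from there to a point of the shared side. The halves inside one polygon form a star, and the
  relative interior of a polygon meets no other polygon.\<close>

lemma coplanar_adjacency_planar:
  assumes surf: "convex_polyhedral_surface \<S>" and cop: "\<And>P. P \<in> \<S> \<Longrightarrow> affine hull set P = A"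
  shows "planar (adjacency_graph \<S>)"
proof (cases "\<S> = {}")
  case True
  then show ?thesis by (simp add: planar_def adjacency_graph_def)
next
  case False
  let ?E = "snd (adjacency_graph \<S>)"
  have fst: "fst (adjacency_graph \<S>) = \<S>" by (simp add: adjacency_graph_def)
  have "aff_dim A = 2"
    using surf_aff_dim[OF surf] cop False by (metis aff_dim_affine_hull ex_in_conv)
  moreover have "affine A" using cop False by (metis affine_affine_hull ex_in_conv)
  ultimately have "A homeomorphic (UNIV :: complex set)" by (simp add: homeomorphic_affine_sets_eq)
  then obtain h :: "real^3 \<Rightarrow> complex" and h' where "homeomorphism A UNIV h h'"
    unfolding homeomorphic_def by blast
  then have h: "continuous_on A h" "inj_on h A"
    unfolding homeomorphism_def by (auto intro: inj_on_inverseI)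
  have reg: "convex (region P)" "affine hull region P = A" "region P \<subseteq> A" if P: "P \<in> \<S>" for P
  proof -
    show "convex (region P)" using surf_region[OF surf P] by simp
    show "affine hull region P = A" using surf_affine_hull[OF surf P] cop[OF P] by simp
    then show "region P \<subseteq> A" using hull_subset[of "region P" affine] by simp
  qed
  have rel: "rel_interior (region P) \<inter> region Q = {}" if PQ: "P \<in> \<S>" "Q \<in> \<S>" "P \<noteq> Q" for P Q
  proof (rule rel_interiors_disjoint)
    show "rel_interior (region P) \<inter> rel_interior (region Q) = {}"
      using surf PQ unfolding convex_polyhedral_surface_def polyhedral_surface_def by (elim conjE) metis
  qed (use reg PQ in simp_all)
  have "\<forall>P\<in>\<S>. \<exists>c. c \<in> rel_interior (region P)"
  proof
    fix P assume P: "P \<in> \<S>"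
    have "region P \<noteq> {}" using surf_region[OF surf P] surf_aff_dim[OF surf P] by auto
    then show "\<exists>c. c \<in> rel_interior (region P)" using rel_interior_eq_empty[OF reg(1)[OF P]] by blast
  qed
  then obtain c where c: "\<And>P. P \<in> \<S> \<Longrightarrow> c P \<in> rel_interior (region P)" by (rule bchoice[THEN exE]) blast
  have E: "\<exists>P Q. e = {P, Q} \<and> P \<in> \<S> \<and> Q \<in> \<S> \<and> P \<noteq> Q \<and> sides P \<inter> sides Q \<noteq> {}" if "e \<in> ?E" for e
    using that by (auto simp: adjacency_graph_def)
  have "\<forall>e\<in>?E. \<exists>m. \<forall>R\<in>\<S>. m \<in> region R \<longleftrightarrow> R \<in> e"
  proof
    fix e assume "e \<in> ?E"
    then obtain P Q where PQ: "e = {P, Q}" "P \<in> \<S>" "Q \<in> \<S>" "P \<noteq> Q" "sides P \<inter> sides Q \<noteq> {}"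
      using E by metis
    obtain m where "\<And>R. R \<in> \<S> \<Longrightarrow> m \<in> region R \<longleftrightarrow> R = P \<or> R = Q"
      using surf_adjacent_point[OF surf PQ(2-5)] by metis
    then show "\<exists>m. \<forall>R\<in>\<S>. m \<in> region R \<longleftrightarrow> R \<in> e" unfolding PQ(1) by (intro exI[of _ m]) simp
  qed
  then obtain m where m: "\<And>e R. e \<in> ?E \<Longrightarrow> R \<in> \<S> \<Longrightarrow> m e \<in> region R \<longleftrightarrow> R \<in> e"
    by (rule bchoice[THEN exE]) blast
  from E obtain B C where BC: "\<And>e. e \<in> ?E \<Longrightarrow> e = {B e, C e} \<and> B e \<in> \<S> \<and> C e \<in> \<S> \<and> B e \<noteq> C e"
    by metis
  have eS: "e \<subseteq> \<S>" if "e \<in> ?E" for e using BC[OF that] by (metis empty_subsetI insert_subset)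
  have m_rel: "m e \<notin> rel_interior (region R)" if e: "e \<in> ?E" and R: "R \<in> e" for e R
  proof -
    obtain R' where R': "R' \<in> e" "R' \<noteq> R" using BC[OF e] by (metis insertI1 insertI2)
    have "R \<in> \<S>" "R' \<in> \<S>" using eS[OF e] R R' by auto
    then show ?thesis using rel[of R R'] R'(2) m[OF e, of R'] R'(1) by blast
  qed
  have c_reg: "c P \<in> region P" if "P \<in> \<S>" for P using c[OF that] rel_interior_subset by blast
  define H where "H P e = closed_segment (c P) (m e)" for P e
  have H: "x = m e \<or> x \<in> rel_interior (region P)" if x: "x \<in> H P e" and e: "e \<in> ?E" "P \<in> e" for x P e
  proof -
    have P: "P \<in> \<S>" using eS[OF e(1)] e(2) by blast
    have "open_segment (c P) (m e) \<subseteq> rel_interior (region P)"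
      by (rule rel_interior_closure_convex_segment[OF reg(1)[OF P] c[OF P]])
        (use m[OF e(1) P] e(2) closure_subset in blast)
    then show ?thesis using x c[OF P] unfolding H_def open_segment_def by blast
  qed
  have HA: "H P e \<subseteq> A" if e: "e \<in> ?E" "P \<in> e" for P e
  proof -
    have P: "P \<in> \<S>" using eS[OF e(1)] e(2) by blast
    have "m e \<in> region P" using m[OF e(1) P] e(2) by simp
    then have "H P e \<subseteq> region P" unfolding H_def using reg(1)[OF P] c_reg[OF P] by (simp add: closed_segment_subset)
    then show ?thesis using reg(3)[OF P] by blast
  qed
  \<comment> \<open>The points \<open>m e\<close> and \<open>m e'\<close> lie in no relative
    interior, so halves of different edges can only meet in the relative interiors of both polygons.
    These are then the same polygon, and its star leaves only the centre.\<close>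
  have HH: "\<exists>R\<in>e \<inter> e'. x = c R" if e: "e \<in> ?E" "e' \<in> ?E" "e \<noteq> e'" and PQ: "P \<in> e" "Q \<in> e'"
    and x: "x \<in> H P e" "x \<in> H Q e'" for e e' P Q x
  proof -
    have S: "P \<in> \<S>" "Q \<in> \<S>" using eS e PQ by blast+
    have mm: "m e \<noteq> m e'"
    proof
      assume "m e = m e'"
      then have "R \<in> e \<longleftrightarrow> R \<in> e'" if "R \<in> \<S>" for R using m[OF e(1) that] m[OF e(2) that] by simp
      then have "e = e'" using eS[OF e(1)] eS[OF e(2)] by blast
      then show False using e(3) by simp
    qed
    have no: "m d \<notin> rel_interior (region R)" if "d \<in> ?E" "R \<in> \<S>" for d R
    proof
      assume r: "m d \<in> rel_interior (region R)"
      then have "m d \<in> region R" using rel_interior_subset by blast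
      then have "R \<in> d" using m[OF that] by simp
      then show False using m_rel[OF that(1)] r by blast
    qed
    have x1: "x \<in> rel_interior (region P)"
      using H[OF x(1) e(1) PQ(1)] H[OF x(2) e(2) PQ(2)] no[OF e(1) S(2)] mm by metis
    have x2: "x \<in> rel_interior (region Q)"
      using H[OF x(1) e(1) PQ(1)] H[OF x(2) e(2) PQ(2)] no[OF e(2) S(1)] mm by metis
    have "P = Q"
    proof (rule ccontr)
      assume "P \<noteq> Q"
      then show False using rel[OF S] x1 x2 rel_interior_subset by blast
    qed
    have "x = c P"
    proof (rule open_segments_disjoint[OF reg(1)[OF S(1)] c[OF S(1)] _ no[OF e(1) S(1)] _ no[OF e(2) S(1)] mm])
      show "m e \<in> region P" "m e' \<in> region P" using m e S PQ \<open>P = Q\<close> by simp_all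
      show "x \<in> closed_segment (c P) (m e)" "x \<in> closed_segment (c P) (m e')"
        using x \<open>P = Q\<close> by (simp_all add: H_def)
    qed
    then show ?thesis using PQ \<open>P = Q\<close> by blast
  qed
  define \<gamma>0 where "\<gamma>0 e = linepath (c (B e)) (m e) +++ linepath (m e) (c (C e))" for e
  define \<gamma> where "\<gamma> e = h \<circ> \<gamma>0 e" for e
  have im0: "path_image (\<gamma>0 e) = H (B e) e \<union> H (C e) e" for e
    by (simp add: \<gamma>0_def path_image_join H_def closed_segment_commute)
  have im: "path_image (\<gamma> e) = h ` (H (B e) e \<union> H (C e) e)" for e
    by (simp add: \<gamma>_def path_image_compose im0)
  have BCe: "B e \<in> e" "C e \<in> e" "B e \<in> \<S>" "C e \<in> \<S>" "B e \<noteq> C e" "{B e, C e} = e" if "e \<in> ?E" for e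
    using BC[OF that] by (metis insertI1 insertI2)+
  have arc: "arc (\<gamma> e)" if e: "e \<in> ?E" for e
  proof -
    note b = BCe[OF e]
    have "c (B e) \<noteq> m e" "c (C e) \<noteq> m e" using c b m_rel[OF e] by metis+
    moreover have "H (B e) e \<inter> H (C e) e \<subseteq> {m e}"
    proof
      fix x assume x: "x \<in> H (B e) e \<inter> H (C e) e"
      show "x \<in> {m e}"
      proof (rule ccontr)
        assume "x \<notin> {m e}"
        then have "x \<in> rel_interior (region (B e))" "x \<in> rel_interior (region (C e))"
          using H[OF _ e b(1)] H[OF _ e b(2)] x by blast+
        then show False using rel[OF b(3-5)] rel_interior_subset by blast
      qed
    qed
    ultimately have a0: "arc (\<gamma>0 e)" unfolding \<gamma>0_def
      by (intro arc_join arc_linepath) (simp_all add: H_def closed_segment_commute)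
    have sub: "path_image (\<gamma>0 e) \<subseteq> A" unfolding im0 using HA[OF e b(1)] HA[OF e b(2)] by blast
    show ?thesis unfolding arc_def
    proof
      show "path (\<gamma> e)" unfolding \<gamma>_def
        by (rule path_continuous_image[OF arc_imp_path[OF a0] continuous_on_subset[OF h(1) sub]])
      have "inj_on h (\<gamma>0 e ` {0..1})" using sub inj_on_subset[OF h(2)] by (simp add: path_image_def)
      then show "inj_on (\<gamma> e) {0..1}" unfolding \<gamma>_def
        using a0 by (intro comp_inj_on) (simp_all add: arc_def)
    qed
  qed
  define pos where "pos P = h (c P)" for P
  have cA: "c P \<in> A" if "P \<in> \<S>" for P using c_reg[OF that] reg(3)[OF that] by blast
  have ends: "{pathstart (\<gamma> e), pathfinish (\<gamma> e)} = pos ` e" if e: "e \<in> ?E" for e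
  proof -
    have "pathstart (\<gamma> e) = pos (B e)" "pathfinish (\<gamma> e) = pos (C e)"
      by (simp_all add: \<gamma>_def \<gamma>0_def pathstart_compose pathfinish_compose pos_def)
    moreover have "pos ` e = pos ` {B e, C e}" using BCe(6)[OF e] by simp
    ultimately show ?thesis by simp
  qed
  have pos_in: "pos ` e \<subseteq> path_image (\<gamma> e)" if e: "e \<in> ?E" for e
    unfolding ends[OF e, symmetric]
    using pathstart_in_path_image[of "\<gamma> e"] pathfinish_in_path_image[of "\<gamma> e"] by blast
  have arcpos: "path_image (\<gamma> e) \<inter> pos ` \<S> = pos ` e" if e: "e \<in> ?E" for e
  proof
    show "pos ` e \<subseteq> path_image (\<gamma> e) \<inter> pos ` \<S>" using pos_in[OF e] eS[OF e] by blast
    show "path_image (\<gamma> e) \<inter> pos ` \<S> \<subseteq> pos ` e"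
    proof
      fix z assume "z \<in> path_image (\<gamma> e) \<inter> pos ` \<S>"
      then obtain P x R where P: "P \<in> e" "x \<in> H P e" "z = h x" and R: "R \<in> \<S>" "z = h (c R)"
        using BCe(1,2)[OF e] unfolding im pos_def by blast
      have "x \<in> A" using HA[OF e P(1)] P(2) by blast
      then have x: "x = c R" using h(2) P(3) R(2) cA[OF R(1)] by (simp add: inj_on_def)
      have "P \<in> \<S>" using eS[OF e] P(1) by blast
      have "R \<in> e"
        using H[OF P(2) e P(1)]
      proof
        assume "x = m e"
        then have "m e \<in> region R" using x c_reg[OF R(1)] by simp
        then show ?thesis using m[OF e R(1)] by simp
      next
        assume "x \<in> rel_interior (region P)"
        then have "R = P" using rel[OF \<open>P \<in> \<S>\<close> R(1)] x c_reg[OF R(1)] by blast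
        then show ?thesis using P(1) by simp
      qed
      then show "z \<in> pos ` e" using R(2) by (simp add: pos_def)
    qed
  qed
  have cross: "path_image (\<gamma> e) \<inter> path_image (\<gamma> e') = pos ` (e \<inter> e')"
    if e: "e \<in> ?E" "e' \<in> ?E" "e \<noteq> e'" for e e'
  proof
    show "pos ` (e \<inter> e') \<subseteq> path_image (\<gamma> e) \<inter> path_image (\<gamma> e')" using pos_in[OF e(1)] pos_in[OF e(2)] by blast
    show "path_image (\<gamma> e) \<inter> path_image (\<gamma> e') \<subseteq> pos ` (e \<inter> e')"
    proof
      fix z assume "z \<in> path_image (\<gamma> e) \<inter> path_image (\<gamma> e')"
      then obtain P x Q y where P: "P \<in> e" "x \<in> H P e" "z = h x" and Q: "Q \<in> e'" "y \<in> H Q e'" "z = h y"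
        using BCe(1,2)[OF e(1)] BCe(1,2)[OF e(2)] unfolding im by blast
      have "x \<in> A" "y \<in> A" using HA[OF e(1) P(1)] P(2) HA[OF e(2) Q(1)] Q(2) by blast+
      then have "x = y" using h(2) P(3) Q(3) by (simp add: inj_on_def)
      then obtain R where "R \<in> e \<inter> e'" "x = c R" using HH[OF e P(1) Q(1) P(2)] Q(2) by blast
      then show "z \<in> pos ` (e \<inter> e')" using P(3) by (simp add: pos_def)
    qed
  qed
  have "inj_on pos \<S>"
  proof (rule inj_onI)
    fix P Q assume PQ: "P \<in> \<S>" "Q \<in> \<S>" "pos P = pos Q"
    then have "c P = c Q" using h(2) cA unfolding pos_def inj_on_def by blast
    then show "P = Q" using rel[OF PQ(1,2)] c[OF PQ(1)] c_reg[OF PQ(2)] by (metis disjoint_iff)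
  qed
  then show ?thesis
    unfolding planar_def fst using arc ends arcpos cross
    by (intro exI[of _ pos] exI[of _ \<gamma>] conjI ballI impI)
qed

lemma ball_mono1: "\<forall>P\<in>S. X P \<Longrightarrow> T \<subseteq> S \<Longrightarrow> \<forall>P\<in>T. X P"
  by blast

lemma ball_mono2: "\<forall>P\<in>S. \<forall>Q\<in>S. X P Q \<Longrightarrow> T \<subseteq> S \<Longrightarrow> \<forall>P\<in>T. \<forall>Q\<in>T. X P Q"
  by blast

lemma ball_mono3: "\<forall>P\<in>S. \<forall>Q\<in>S. \<forall>R\<in>S. X P Q R \<Longrightarrow> T \<subseteq> S \<Longrightarrow> \<forall>P\<in>T. \<forall>Q\<in>T. \<forall>R\<in>T. X P Q R"
  by blast

text \<open>All conditions on a surface are universal in its polygons, apart from finiteness. The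
  coplanar case uses this to pass to six polygons.\<close>

lemma convex_polyhedral_surface_subset:
  assumes "convex_polyhedral_surface \<S>" "\<T> \<subseteq> \<S>"
  shows "convex_polyhedral_surface \<T>"
  using assms unfolding convex_polyhedral_surface_def polyhedral_surface_def
  by (elim conjE, intro conjI)
     (erule (1) finite_subset[rotated] ball_mono3 ball_mono2 ball_mono1)+

text \<open>\<open>U\<close> is the triangle and \<open>X\<close> lists its common neighbours. Their
  oriented planes are \<open>g\<close> and \<open>f\<close>. Points of shared sides provide
  \<open>a k\<close>, on the two polygons of the triangle other than \<open>U k\<close>, and
  \<open>q k i\<close>, on \<open>U k\<close> and \<open>X i\<close>. Together they have the sign
  pattern refuted by \<open>no_three_caps\<close>.\<close>

lemma surface_not_triple_stacked:
  assumes surf: "convex_polyhedral_surface \<S>"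
  shows "\<not> triple_stacked (snd (adjacency_graph \<S>))"
proof
  assume "triple_stacked (snd (adjacency_graph \<S>))"
  then obtain u v w x y z where d: "distinct [u, v, w, x, y, z]"
    and tri: "{u, v} \<in> snd (adjacency_graph \<S>)" "{v, w} \<in> snd (adjacency_graph \<S>)"
      "{u, w} \<in> snd (adjacency_graph \<S>)"
    and star: "\<forall>p\<in>{u, v, w}. \<forall>q\<in>{x, y, z}. {p, q} \<in> snd (adjacency_graph \<S>)"
    unfolding triple_stacked_def by metis
  define U where "U k = [u, v, w] ! k" for k :: nat
  define X where "X i = [x, y, z] ! i" for i :: nat
  have lt3: "k < 3 \<longleftrightarrow> k = 0 \<or> k = 1 \<or> k = 2" for k :: nat by auto
  have Us: "U 0 = u" "U 1 = v" "U 2 = w" and Xs: "X 0 = x" "X 1 = y" "X 2 = z" by (simp_all add: U_def X_def)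
  have dU: "U k \<noteq> U l" if "k < 3" "l < 3" "k \<noteq> l" for k l
    using that d Us unfolding lt3 by (elim disjE) auto
  have dX: "X k \<noteq> X l" if "k < 3" "l < 3" "k \<noteq> l" for k l
    using that d Xs unfolding lt3 by (elim disjE) auto
  have dUX: "U k \<noteq> X l" if "k < 3" "l < 3" for k l
    using that d Us Xs unfolding lt3 by (elim disjE) simp_all
  have star': "{U k, X i} \<in> snd (adjacency_graph \<S>)" if "k < 3" "i < 3" for k i
    using star that Us Xs unfolding lt3 by (elim disjE) simp_all
  have triU: "{U k, U l} \<in> snd (adjacency_graph \<S>)" if "k < 3" "l < 3" "k \<noteq> l" for k l
    using tri that Us unfolding lt3 by (elim disjE) (simp_all add: insert_commute)
  have US: "U k \<in> \<S>" and XS: "X k \<in> \<S>" if "k < 3" for k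
    using star'[OF that, of 0] star'[of 0, OF _ that] adjacency_edge_iff by auto
  have UX: "sides (U k) \<inter> sides (X i) \<noteq> {}" "sides (X i) \<inter> sides (U k) \<noteq> {}" if "k < 3" "i < 3" for k i
    using star'[OF that] unfolding adjacency_edge_iff by (simp_all add: Int_commute)
  have UU: "sides (U k) \<inter> sides (U l) \<noteq> {}" if "k < 3" "l < 3" "k \<noteq> l" for k l
    using triU[OF that] unfolding adjacency_edge_iff by simp
  let ?aff = "\<lambda>P. affine hull set P"
  \<comment> \<open>If two polygons of the triangle are coplanar, being adjacent to both pulls the
    third one and every \<open>X i\<close> into the same plane.\<close>
  have nU: "?aff (U k) \<noteq> ?aff (U l)" if kl: "k < 3" "l < 3" "k \<noteq> l" for k l
  proof
    assume cop: "?aff (U k) = ?aff (U l)"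
    have aU: "?aff (U i) = ?aff (U k)" if i: "i < 3" for i
    proof (cases "i = k \<or> i = l")
      case False
      then show ?thesis
        using surf_coplanar_triangle[OF surf US[OF kl(1)] US[OF kl(2)] US[OF i] _ _ _ _ _ cop]
          dU kl i UU by metis
    qed (use cop in auto)
    have aX: "?aff (X i) = ?aff (U k)" if i: "i < 3" for i
      using surf_coplanar_triangle[OF surf US[OF kl(1)] US[OF kl(2)] XS[OF i] _ _ _ _ _ cop]
        dU[OF kl] dUX kl i UX by metis
    let ?T = "{U 0, U 1, U 2, X 0, X 1, X 2}"
    have TS: "?T \<subseteq> \<S>" using US XS by simp
    have "planar (adjacency_graph ?T)"
    proof (rule coplanar_adjacency_planar[OF convex_polyhedral_surface_subset[OF surf TS]])
      show "?aff P = ?aff (U k)" if "P \<in> ?T" for P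
        using that aU[of 0] aU[of 1] aU[of 2] aX[of 0] aX[of 1] aX[of 2] by (elim insertE emptyE) simp_all
    qed
    moreover have "distinct [U 0, U 1, U 2, X 0, X 1, X 2]" using d Us Xs by simp
    moreover have "{P, Q} \<in> snd (adjacency_graph ?T)"
      if PQ: "P \<in> {U 0, U 1, U 2}" "Q \<in> {X 0, X 1, X 2}" for P Q
    proof -
      obtain i j where ij: "P = U i" "Q = X j" "i < 3" "j < 3" using PQ by fastforce
      have "P \<in> ?T" "Q \<in> ?T" using PQ by blast+
      then show ?thesis unfolding adjacency_edge_iff ij(1,2) using UX(1)[OF ij(3,4)] dUX[OF ij(3,4)] by blast
    qed
    ultimately show False
      by (rule planar_no_K33) (simp_all add: adjacency_graph_def)
  qed
  \<comment> \<open>A different \<open>U l\<close> is adjacent to both \<open>U k\<close> and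
    \<open>X i\<close> and would have to lie in their common plane, in conflict with
    \<open>nU\<close>.\<close>
  have nUX: "?aff (U k) \<noteq> ?aff (X i)" if ki: "k < 3" "i < 3" for k i
  proof
    assume cop: "?aff (U k) = ?aff (X i)"
    obtain l where l: "l < 3" "l \<noteq> k" by (metis lt3 zero_neq_one)
    have "?aff (U l) = ?aff (U k)"
      by (rule surf_coplanar_triangle[OF surf US[OF ki(1)] XS[OF ki(2)] US[OF l(1)] dUX[OF ki]
            dU[OF ki(1) l(1) l(2)[symmetric]] dUX[OF l(1) ki(2), symmetric] UU[OF l(1) ki(1) l(2)]
            UX(1)[OF l(1) ki(2)] cop])
    then show False using nU[OF l(1) ki(1) l(2)] by simp
  qed
  have "\<exists>f. (\<forall>x\<in>region (U k). affval f x = 0) \<and>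
      (\<forall>l<3. l \<noteq> k \<longrightarrow> (\<forall>x\<in>region (U l). affval f x \<ge> 0 \<and> (affval f x = 0 \<longleftrightarrow> x \<in> region (U k))))"
    if k: "k < 3" for k
  proof -
    let ?K = "U ` ({..<3} - {k})"
    have ne: "?K \<noteq> {}" using lt3 by (metis (no_types) Diff_eq_empty_iff image_is_empty lessThan_iff numeral_1_eq_Suc_0 singletonD subset_iff zero_neq_one)
    obtain f where f: "\<And>x. x \<in> region (U k) \<Longrightarrow> affval f x = 0"
      "\<And>P x. P \<in> ?K \<Longrightarrow> x \<in> region P \<Longrightarrow> affval f x \<ge> 0 \<and> (affval f x = 0 \<longleftrightarrow> x \<in> region (U k))"
    proof (rule surf_functional[OF surf US[OF k], of ?K])
      show "?K \<subseteq> \<S>" using US by auto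
      show "U k \<notin> ?K" using dU k by fastforce
      show "sides P \<inter> sides (U k) \<noteq> {}" "?aff P \<noteq> ?aff (U k)" if "P \<in> ?K" for P
        using that UU nU k by auto
      show "sides P \<inter> sides P' \<noteq> {}" if "P \<in> ?K" "P' \<in> ?K" "P \<noteq> P'" for P P'
        using that UU by auto
    qed (use ne in blast)+
    have "affval f x \<ge> 0 \<and> (affval f x = 0 \<longleftrightarrow> x \<in> region (U k))"
      if "l < 3" "l \<noteq> k" "x \<in> region (U l)" for l x using f(2)[of "U l" x] that by blast
    then show ?thesis using f(1) by (intro exI[of _ f]) simp
  qed
  then obtain g where g0: "\<And>k x. k < 3 \<Longrightarrow> x \<in> region (U k) \<Longrightarrow> affval (g k) x = 0"
    and g1: "\<And>k l x. k < 3 \<Longrightarrow> l < 3 \<Longrightarrow> l \<noteq> k \<Longrightarrow> x \<in> region (U l) \<Longrightarrow>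
      affval (g k) x \<ge> 0 \<and> (affval (g k) x = 0 \<longleftrightarrow> x \<in> region (U k))"
    by metis
  have "\<exists>f. \<forall>l<3. \<forall>x\<in>region (U l). affval f x \<ge> 0 \<and> (affval f x = 0 \<longleftrightarrow> x \<in> region (X i))"
    if i: "i < 3" for i
  proof -
    let ?K = "U ` {..<3}"
    obtain f where f:
      "\<And>P x. P \<in> ?K \<Longrightarrow> x \<in> region P \<Longrightarrow> affval f x \<ge> 0 \<and> (affval f x = 0 \<longleftrightarrow> x \<in> region (X i))"
    proof (rule surf_functional[OF surf XS[OF i], of ?K])
      show "?K \<subseteq> \<S>" using US by auto
      show "X i \<notin> ?K" using dUX i by fastforce
      show "sides P \<inter> sides (X i) \<noteq> {}" "?aff P \<noteq> ?aff (X i)" if "P \<in> ?K" for P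
        using that UX nUX i by auto
      show "sides P \<inter> sides P' \<noteq> {}" if "P \<in> ?K" "P' \<in> ?K" "P \<noteq> P'" for P P'
        using that UU by auto
      show "?K \<noteq> {}" by (simp add: lessThan_empty_iff)
    qed blast
    have "affval f x \<ge> 0 \<and> (affval f x = 0 \<longleftrightarrow> x \<in> region (X i))"
      if "l < 3" "x \<in> region (U l)" for l x using f[of "U l" x] that by blast
    then show ?thesis by (intro exI[of _ f]) simp
  qed
  then obtain f where f: "\<And>i l x. i < 3 \<Longrightarrow> l < 3 \<Longrightarrow> x \<in> region (U l) \<Longrightarrow>
      affval (f i) x \<ge> 0 \<and> (affval (f i) x = 0 \<longleftrightarrow> x \<in> region (X i))"
    by metis
  have "\<exists>a. \<forall>l<3. a \<in> region (U l) \<longleftrightarrow> l \<noteq> k" if k: "k < 3" for k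
  proof -
    have "\<exists>l m. l < 3 \<and> m < 3 \<and> l \<noteq> m \<and> (\<forall>j<3. j = l \<or> j = m \<longleftrightarrow> j \<noteq> k)"
      using k unfolding lt3[of k]
    proof (elim disjE)
      show ?thesis if "k = 0" by (intro exI[of _ 1] exI[of _ 2]) (auto simp: that lt3)
      show ?thesis if "k = 1" by (intro exI[of _ 0] exI[of _ 2]) (auto simp: that lt3)
      show ?thesis if "k = 2" by (intro exI[of _ 0] exI[of _ 1]) (auto simp: that lt3)
    qed
    then obtain l m where lm: "l < 3" "m < 3" "l \<noteq> m"
      and cov: "\<And>j. j < 3 \<Longrightarrow> j = l \<or> j = m \<longleftrightarrow> j \<noteq> k" by blast
    obtain a where a: "\<And>R. R \<in> \<S> \<Longrightarrow> a \<in> region R \<longleftrightarrow> R = U l \<or> R = U m"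
      using surf_adjacent_point[OF surf US[OF lm(1)] US[OF lm(2)] dU[OF lm(1-3)] UU[OF lm(1-3)]] by metis
    have "a \<in> region (U j) \<longleftrightarrow> j \<noteq> k" if j: "j < 3" for j
      using a[OF US[OF j]] cov[OF j] dU[OF j lm(1)] dU[OF j lm(2)] by metis
    then show ?thesis by blast
  qed
  then obtain a where a1: "\<And>k l. k < 3 \<Longrightarrow> l < 3 \<Longrightarrow> a k \<in> region (U l) \<longleftrightarrow> l \<noteq> k"
    by metis
  have "\<exists>q. (\<forall>l<3. q \<in> region (U l) \<longleftrightarrow> l = k) \<and> (\<forall>j<3. q \<in> region (X j) \<longleftrightarrow> j = i)"
    if ki: "k < 3" "i < 3" for k i
  proof -
    obtain q where q: "\<And>R. R \<in> \<S> \<Longrightarrow> q \<in> region R \<longleftrightarrow> R = U k \<or> R = X i"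
      using surf_adjacent_point[OF surf US[OF ki(1)] XS[OF ki(2)] dUX[OF ki] UX(1)[OF ki]] by metis
    have "q \<in> region (U l) \<longleftrightarrow> l = k" if l: "l < 3" for l
      using q[OF US[OF l]] dU[OF l ki(1)] dUX[OF l ki(2)] by metis
    moreover have "q \<in> region (X j) \<longleftrightarrow> j = i" if j: "j < 3" for j
      using q[OF XS[OF j]] dX[OF j ki(2)] dUX[OF ki(1) j] by metis
    ultimately show ?thesis by blast
  qed
  then obtain q where q1: "\<And>k i l. k < 3 \<Longrightarrow> i < 3 \<Longrightarrow> l < 3 \<Longrightarrow> q k i \<in> region (U l) \<longleftrightarrow> l = k"
    and q2: "\<And>k i j. k < 3 \<Longrightarrow> i < 3 \<Longrightarrow> j < 3 \<Longrightarrow> q k i \<in> region (X j) \<longleftrightarrow> j = i"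
    by metis
  have other: "\<exists>l<3. l \<noteq> k" for k :: nat by (metis lt3 zero_neq_one)
  show False
  proof (rule no_three_caps[of g a q f])
    show "affval (g l) (a k) \<ge> 0 \<and> (affval (g l) (a k) = 0 \<longleftrightarrow> l \<noteq> k)" if lk: "l < 3" "k < 3" for l k
    proof (cases "l = k")
      case True
      \<comment> \<open>The sign of \<open>g k\<close> at \<open>a k\<close> is read off on another
        polygon \<open>U j\<close> through this point, since \<open>a k\<close> is off
        \<open>U k\<close> itself.\<close>
      obtain j where j: "j < 3" "j \<noteq> k" using other by blast
      then have "a k \<in> region (U j)" using a1 lk by simp
      then show ?thesis using g1[OF lk(1) j(1)] j(2) True a1[OF lk(2,1)] by simp
    next
      case False
      then show ?thesis using g0[OF lk(1)] a1[OF lk(2,1)] by simp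
    qed
    show "affval (g l) (q k i) \<ge> 0 \<and> (affval (g l) (q k i) = 0 \<longleftrightarrow> l = k)" if lki: "l < 3" "k < 3" "i < 3" for l k i
    proof (cases "l = k")
      case True
      then show ?thesis using g0[OF lki(1)] q1[OF lki(2,3,1)] by simp
    next
      case False
      then show ?thesis using g1[OF lki(1,2)] q1[OF lki(2,3,1)] q1[OF lki(2,3,2)] by simp
    qed
    show "affval (f j) (q k i) \<ge> 0 \<and> (affval (f j) (q k i) = 0 \<longleftrightarrow> j = i)" if "j < 3" "k < 3" "i < 3" for j k i
      using f[OF that(1,2)] q1[OF that(2,3,2)] q2[OF that(2,3,1)] by simp
  qed simp
qed

section \<open>Transfer to abstract graphs and conclusion\<close>

text \<open>The configuration is pulled back along the inverse of the isomorphism. Simplicity of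
  \<open>G\<close> keeps the ends of its edges among the vertices, to which the isomorphism is
  confined.\<close>

lemma triple_stacked_iso:
  assumes iso: "ugraph_iso H G" and G: "simple_ugraph G" and ts: "triple_stacked (snd G)"
  shows "triple_stacked (snd H)"
proof -
  obtain f where f: "bij_betw f (fst H) (fst G)"
    "\<And>u v. u \<in> fst H \<Longrightarrow> v \<in> fst H \<Longrightarrow> {u, v} \<in> snd H \<longleftrightarrow> {f u, f v} \<in> snd G"
    using iso unfolding ugraph_iso_def by blast
  define h where "h = inv_into (fst H) f"
  have h: "h u \<in> fst H" "f (h u) = u" if "u \<in> fst G" for u
    using that f(1) unfolding h_def bij_betw_def by (auto intro: inv_into_into f_inv_into_f)
  have hE: "{h u, h v} \<in> snd H" if e: "{u, v} \<in> snd G" for u v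
  proof -
    have "u \<in> fst G" "v \<in> fst G" using e G by (auto simp: simple_ugraph_def)
    then show ?thesis using f(2)[of "h u" "h v"] h e by simp
  qed
  obtain u v w x y z where d: "distinct [u, v, w, x, y, z]"
    and tri: "{u, v} \<in> snd G" "{v, w} \<in> snd G" "{u, w} \<in> snd G"
    and star: "\<forall>p\<in>{u, v, w}. \<forall>q\<in>{x, y, z}. {p, q} \<in> snd G"
    using ts unfolding triple_stacked_def by metis
  have "{u, x} \<in> snd G" "{u, y} \<in> snd G" "{u, z} \<in> snd G" using star by simp_all
  then have "set [u, v, w, x, y, z] \<subseteq> fst G" using tri G unfolding simple_ugraph_def by auto
  moreover have "inj_on h (fst G)" using h(2) by (rule inj_on_inverseI)
  ultimately have "distinct (map h [u, v, w, x, y, z])" using d by (metis distinct_map inj_on_subset)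
  then have "distinct [h u, h v, h w, h x, h y, h z]" by simp
  moreover have "\<forall>p\<in>{h u, h v, h w}. \<forall>q\<in>{h x, h y, h z}. {p, q} \<in> snd H"
    using star hE by simp
  ultimately show ?thesis unfolding triple_stacked_def using hE[OF tri(1)] hE[OF tri(2)] hE[OF tri(3)] by metis
qed

lemma planar_not_triple_stacked:
  assumes G: "simple_ugraph G" "planar G"
  shows "\<not> triple_stacked (snd G)"
proof
  assume "triple_stacked (snd G)"
  then obtain u v w x y z where d: "distinct [u, v, w, x, y, z]"
    and star: "\<forall>p\<in>{u, v, w}. \<forall>q\<in>{x, y, z}. {p, q} \<in> snd G"
    unfolding triple_stacked_def by metis
  show False
  proof (rule planar_no_K33[OF G(2) d])
    show "{p, q} \<in> snd G" if "p \<in> {u, v, w}" "q \<in> {x, y, z}" for p q using star that by blast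
    have "e \<subseteq> fst G" if "e \<in> snd G" for e using G(1) that by (simp add: simple_ugraph_def)
    from this[of "{u, x}"] this[of "{v, y}"] this[of "{w, z}"] star
    show "{u, v, w, x, y, z} \<subseteq> fst G" by simp
  qed
qed

theorem theorem15:
  fixes G :: "'a ugraph"
  assumes "three_tree G"
  shows "(\<exists>\<S>. convex_polyhedral_surface \<S> \<and> ugraph_iso (adjacency_graph \<S>) G) \<longleftrightarrow> planar G"
proof
  note simple = three_tree_simple[OF assms]
  \<comment> \<open>The surface only serves to exclude triple stacking; the drawing itself is that
    of the stacked graph.\<close>
  show "planar G" if real: "\<exists>\<S>. convex_polyhedral_surface \<S> \<and> ugraph_iso (adjacency_graph \<S>) G"
  proof -
    obtain \<S> where "convex_polyhedral_surface \<S>" "ugraph_iso (adjacency_graph \<S>) G" using real by blast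
    then have "\<not> triple_stacked (snd G)"
      using surface_not_triple_stacked triple_stacked_iso[OF _ simple] by blast
    then obtain F where "stacked (fst G) (snd G) F" by (rule three_tree_imp_stacked[OF assms])
    from stacked_planar[OF this] show ?thesis by simp
  qed
  show "\<exists>\<S>. convex_polyhedral_surface \<S> \<and> ugraph_iso (adjacency_graph \<S>) G" if pl: "planar G"
  proof -
    obtain F where "stacked (fst G) (snd G) F"
      by (rule three_tree_imp_stacked[OF assms planar_not_triple_stacked[OF simple pl]])
    from stacked_realizable[OF this] show ?thesis by simp
  qed
qed

end
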